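(* For every integer $n\ge 2$ there exists a convex polygon with $3n$ sides whose slap map has $n$ ergodic components (that is, $n$ ergodic acip's), each with even mixing period.
   Context: Slap map: let $P$ be a non-self-intersecting polygon with perimeter $L$, and let $s\in[0,L]$ be the arc length parameter of $\partial P$. For a point $s\in\partial P$ (not a vertex), let $\rho$ be the ray starting at $s$, directed inside $P$ and orthogonal to $\partial P$ at $s$, and let $s'$ be the point of $\rho\cap\partial P$, different from $s$, which is closest to $s$. The slap map of $P$ is the piecewise affine map $\psi_P\colon[0,L]\to[0,L]$, $s\mapsto s'$ (its values at the finitely many exceptional points are irrelevant). An acip of a map $f$ of an interval $I$ is an $f$-invariant Borel probability measure that is absolutely continuous with respect to Lebesgue measure on $I$. Mixing period: for a piecewise expanding map $f$ and an ergodic acip $\nu$ of $f$ with support $\Lambda$, there are an integer $k\ge 1$ and disjoint measurable sets $\Sigma_1,\dots,\Sigma_k$ with $\Lambda=\Sigma_1\cup\dots\cup\Sigma_k$ (up to null sets), cyclically permuted by $f$, such that $f^k|_{\Sigma_1}$ is exact with respect to the (normalized) restriction of $\nu$ to $\Sigma_1$. The integer $k$ is the mixing period of $\nu$. *)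

theory Defs
  imports "HOL-Probability.Probability"
begin

section \<open>Polygons\<close>

text \<open>A polygon is given by the list of its vertices in cyclic order (either orientation).
  Vertices are indexed cyclically by all natural numbers.\<close>

definition vertex :: "complex list \<Rightarrow> nat \<Rightarrow> complex" where
  "vertex vs i = vs ! (i mod length vs)"

definition side :: "complex list \<Rightarrow> nat \<Rightarrow> complex set" where
  "side vs i = closed_segment (vertex vs i) (vertex vs (Suc i))"

definition polygon_boundary :: "complex list \<Rightarrow> complex set" where
  "polygon_boundary vs = (\<Union>i<length vs. side vs i)"

definition polygon_region :: "complex list \<Rightarrow> complex set" where
  "polygon_region vs = polygon_boundary vs \<union> inside (polygon_boundary vs)"

text \<open>Distinct sides meet in common end points only. Straight angles are excluded, so that
  the number of sides is the length of the list.\<close>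

definition simple_polygon :: "complex list \<Rightarrow> bool" where
  "simple_polygon vs \<longleftrightarrow>
     3 \<le> length vs \<and> distinct vs \<and>
     (\<forall>i<length vs. \<forall>j<length vs. i \<noteq> j \<longrightarrow>
        side vs i \<inter> side vs j =
          {vertex vs i, vertex vs (Suc i)} \<inter> {vertex vs j, vertex vs (Suc j)}) \<and>
     (\<forall>i<length vs. \<not> collinear {vertex vs i, vertex vs (Suc i), vertex vs (Suc (Suc i))})"

definition convex_polygon :: "complex list \<Rightarrow> bool" where
  "convex_polygon vs \<longleftrightarrow> simple_polygon vs \<and> convex (polygon_region vs)"

section \<open>Arc length and the slap map\<close>

definition arc_upto :: "complex list \<Rightarrow> nat \<Rightarrow> real" where
  "arc_upto vs i = (\<Sum>j<i. dist (vertex vs j) (vertex vs (Suc j)))"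

definition perimeter :: "complex list \<Rightarrow> real" where
  "perimeter vs = arc_upto vs (length vs)"

definition side_index :: "complex list \<Rightarrow> real \<Rightarrow> nat" where
  "side_index vs s = (LEAST i. s < arc_upto vs (Suc i))"

text \<open>Since vertices are indexed cyclically, the following is periodic in the nonnegative reals
  with period the perimeter; in particular both end points of
  \<open>{0..perimeter vs}\<close> give the vertex with index 0.\<close>

definition arc_point :: "complex list \<Rightarrow> real \<Rightarrow> complex" where
  "arc_point vs s =
     (let i = side_index vs s
      in vertex vs i + (s - arc_upto vs i) *\<^sub>R sgn (vertex vs (Suc i) - vertex vs i))"

definition inward_normal :: "complex list \<Rightarrow> real \<Rightarrow> complex \<Rightarrow> bool" where
  "inward_normal vs s d \<longleftrightarrow>
     norm d = 1 \<and>
     orthogonal d (vertex vs (Suc (side_index vs s)) - vertex vs (side_index vs s)) \<and>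
     (\<exists>e>0. \<forall>r. 0 < r \<and> r < e \<longrightarrow>
        arc_point vs s + r *\<^sub>R d \<in> inside (polygon_boundary vs))"

definition slap_hits :: "complex list \<Rightarrow> real \<Rightarrow> complex set" where
  "slap_hits vs s =
     {arc_point vs s + r *\<^sub>R d | r d. 0 \<le> r \<and> inward_normal vs s d}
       \<inter> polygon_boundary vs - {arc_point vs s}"

text \<open>The parameter of the image is normalised to \<open>{0..<perimeter vs}\<close>;
  the value at vertices is arbitrary.\<close>

definition slap_map :: "complex list \<Rightarrow> real \<Rightarrow> real" where
  "slap_map vs s =
     (if arc_point vs s \<in> set vs then 0
      else THE s'. 0 \<le> s' \<and> s' < perimeter vs \<and>
             is_arg_min (dist (arc_point vs s)) (\<lambda>x. x \<in> slap_hits vs s) (arc_point vs s'))"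

section \<open>Invariant measures\<close>

definition invariant_prob :: "'a measure \<Rightarrow> ('a \<Rightarrow> 'a) \<Rightarrow> bool" where
  "invariant_prob M f \<longleftrightarrow> prob_space M \<and> f \<in> measurable M M \<and> distr M M f = M"

definition ergodic_prob :: "'a measure \<Rightarrow> ('a \<Rightarrow> 'a) \<Rightarrow> bool" where
  "ergodic_prob M f \<longleftrightarrow>
     invariant_prob M f \<and>
     (\<forall>A\<in>sets M. f -` A \<inter> space M = A \<longrightarrow> emeasure M A = 0 \<or> emeasure M A = 1)"

text \<open>Exactness: the tail sigma-algebra (the intersection of the preimages of
  \<open>sets M\<close> under all iterates) is trivial.\<close>

definition exact_prob :: "'a measure \<Rightarrow> ('a \<Rightarrow> 'a) \<Rightarrow> bool" where
  "exact_prob M f \<longleftrightarrow>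
     invariant_prob M f \<and>
     (\<forall>A. (\<forall>j. \<exists>B\<in>sets M. A = (f ^^ j) -` B \<inter> space M) \<longrightarrow>
        emeasure M A = 0 \<or> emeasure M A = 1)"

text \<open>In the following, \<open>L\<close> is the length of the interval \<open>{0..L}\<close> on which the map acts.\<close>

definition acip :: "real \<Rightarrow> (real \<Rightarrow> real) \<Rightarrow> real measure \<Rightarrow> bool" where
  "acip L f \<nu> \<longleftrightarrow>
     sets \<nu> = sets (restrict_space borel {0..L}) \<and>
     absolutely_continuous (restrict_space lborel {0..L}) \<nu> \<and>
     invariant_prob \<nu> f"

definition ergodic_acip :: "real \<Rightarrow> (real \<Rightarrow> real) \<Rightarrow> real measure \<Rightarrow> bool" where
  "ergodic_acip L f \<nu> \<longleftrightarrow> acip L f \<nu> \<and> ergodic_prob \<nu> f"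

definition measure_support :: "'a::topological_space measure \<Rightarrow> 'a set" where
  "measure_support \<nu> =
     {x \<in> space \<nu>. \<forall>U. open U \<and> x \<in> U \<longrightarrow> 0 < emeasure \<nu> (U \<inter> space \<nu>)}"

section \<open>Piecewise expanding maps and mixing period\<close>

text \<open>Away from finitely many points the map is, on every interval, twice continuously
  differentiable up to the end points, with derivative uniformly bounded away from the unit
  disc (the classical Lasota--Yorke class).\<close>

definition piecewise_expanding :: "real \<Rightarrow> (real \<Rightarrow> real) \<Rightarrow> bool" where
  "piecewise_expanding L f \<longleftrightarrow>
     (\<forall>x\<in>{0..L}. f x \<in> {0..L}) \<and>
     (\<exists>\<sigma>>1. \<exists>D. finite D \<and>
        (\<forall>a b. a < b \<and> {a<..<b} \<subseteq> {0..L} - D \<longrightarrow>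
           (\<exists>g g' g''. (\<forall>x\<in>{a<..<b}. g x = f x) \<and>
              (\<forall>x\<in>{a..b}. (g has_real_derivative g' x) (at x within {a..b}) \<and>
                            (g' has_real_derivative g'' x) (at x within {a..b}) \<and>
                            \<sigma> \<le> \<bar>g' x\<bar>) \<and>
              continuous_on {a..b} g'')))"

text \<open>The pieces are \<open>\<Sigma> 0, \<dots>, \<Sigma> (k - 1)\<close>; \<open>uniform_measure \<nu> (\<Sigma> 0)\<close> is the normalised
  restriction of \<open>\<nu>\<close> to \<open>\<Sigma> 0\<close>, as a measure on the whole interval. Equalities of sets hold up
  to \<open>\<nu>\<close>-null sets.\<close>

definition mixing_period :: "real \<Rightarrow> (real \<Rightarrow> real) \<Rightarrow> real measure \<Rightarrow> nat \<Rightarrow> bool" where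
  "mixing_period L f \<nu> k \<longleftrightarrow>
     piecewise_expanding L f \<and> ergodic_acip L f \<nu> \<and> 1 \<le> k \<and>
     (\<exists>\<Sigma> :: nat \<Rightarrow> real set.
        (\<forall>i<k. \<Sigma> i \<in> sets \<nu>) \<and>
        disjoint_family_on \<Sigma> {..<k} \<and>
        sym_diff (measure_support \<nu>) (\<Union>i<k. \<Sigma> i) \<in> null_sets \<nu> \<and>
        (\<forall>i<k. sym_diff (f ` \<Sigma> i) (\<Sigma> (Suc i mod k)) \<in> null_sets \<nu>) \<and>
        exact_prob (uniform_measure \<nu> (\<Sigma> 0)) (f ^^ k))"

end

(* Take a regular 2n-gon and replace n consecutive sides by low caps, each consisting of two sides
   of slope t. A side and the cap opposite to it are mapped to each other by the slap map, and the
   second iterate on the side is x |-> b x - e sgn x with b = 1 + t^2. This symmetric map is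
   renormalisable: its second iterate near 0 is a map of the same form with slope b^2. Choosing t
   with b^(2^m) = 2, the m-th renormalisation is the doubling map, so that a first return map of the
   slap map, at the constant return time 2^(m+1), is conjugate to the doubling map. Each of the n
   pairs therefore carries exactly one ergodic acip, and its mixing period is 2^(m+1). *)

theory Submission
  imports Defs
begin

section \<open>Convex polygons\<close>

text \<open>The constant \<open>e\<close> is \<open>t * (2 * H + t)\<close> with \<open>H\<close>
  the apothem: a perpendicular to a cap side drifts sideways by \<open>t\<close> times the axial
  distance to the opposite base. The caps must be so low that \<open>e < 1\<close>; then the foot
  stays on that base and the pairs do not interact. As \<open>H\<close> grows with \<open>n\<close>,
  this pushes the slope \<open>b\<close> towards 1. Taking \<open>b\<close> as a dyadic root of 2
  makes the last renormalisation the doubling map itself, which preserves Lebesgue measure, so that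
  invariance, ergodicity and exactness come from measuring dyadic intervals. For uniqueness every
  orbit must reach the tower: \<open>e > t\<^sup>2\<close> drives the orbits on a base into
  \<open>\<bar>x\<bar> < e\<close>, and at each stage repulsion from a point fixed in absolute value
  drives them into the next smaller interval. The countable set of points that ever meet a vertex, a
  centre of a base or one of these repelling points is removed at the outset. All dynamical
  statements then hold pointwise, whatever values the slap map takes at the vertices.\<close>

lemma orthogonal_complex_parallel:
  fixes N e w :: complex
  assumes "N \<noteq> 0" "e \<noteq> 0" "inner N e = 0" "inner N w = 0"
  shows "\<exists>u. w = u *\<^sub>R e"
proof -
  have 1: "Re N * Re e + Im N * Im e = 0" "Re N * Re w + Im N * Im w = 0"
    using assms by (auto simp: inner_complex_def)
  have "Re N * (Re w * Im e - Im w * Re e) = 0" "Im N * (Re w * Im e - Im w * Re e) = 0"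
    using 1 by algebra+
  then have 2: "Re w * Im e = Im w * Re e"
    using assms(1) by (auto simp: complex_eq_iff)
  show ?thesis
  proof (cases "Re e = 0")
    case True
    then have "Im e \<noteq> 0" using assms(2) by (auto simp: complex_eq_iff)
    then have "w = (Im w / Im e) *\<^sub>R e" using 2 True by (auto simp: complex_eq_iff)
    then show ?thesis by blast
  next
    case False
    then have "w = (Re w / Re e) *\<^sub>R e" using 2 by (auto simp: complex_eq_iff field_simps)
    then show ?thesis by blast
  qed
qed

lemma vertex_mod: "vertex vs (i mod length vs) = vertex vs i"
  by (simp add: vertex_def)

text \<open>The polygon is encoded by outward unit normals and support values, one half-plane per
  side. Strictness in \<open>below\<close> says that each supporting line meets the vertex set only
  in the two ends of its side; simplicity, convexity and the inward normal all become sign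
  conditions on the functionals \<open>inner (N i)\<close>.\<close>

locale convex_ngon =
  fixes vs :: "complex list" and N :: "nat \<Rightarrow> complex" and d :: "nat \<Rightarrow> real"
  assumes len: "3 \<le> length vs"
    and unit: "\<And>i. i < length vs \<Longrightarrow> norm (N i) = 1"
    and start_on: "\<And>i. i < length vs \<Longrightarrow> inner (N i) (vertex vs i) = d i"
    and end_on: "\<And>i. i < length vs \<Longrightarrow> inner (N i) (vertex vs (Suc i)) = d i"
    and below: "\<And>i j. i < length vs \<Longrightarrow> j < length vs \<Longrightarrow> j \<noteq> i \<Longrightarrow>
       j \<noteq> Suc i mod length vs \<Longrightarrow> inner (N i) (vertex vs j) < d i"
    and bdd: "bounded {z. \<forall>i<length vs. inner (N i) z \<le> d i}"
begin

definition K :: "complex set" where "K = {z. \<forall>i<length vs. inner (N i) z \<le> d i}"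

abbreviation "nx i \<equiv> Suc i mod length vs"

lemma nx: "i < length vs \<Longrightarrow> nx i < length vs" "i < length vs \<Longrightarrow> nx i \<noteq> i"
   "i < length vs \<Longrightarrow> nx (nx i) \<noteq> i"
  using len by (auto simp: mod_Suc)

lemma prev_ex: assumes "i < length vs" obtains j where "j < length vs" "nx j = i" "j \<noteq> i" "j \<noteq> nx i"
proof (cases i)
  case 0
  then show thesis using len by (intro that[of "length vs - 1"]) (auto simp: mod_Suc)
next
  case (Suc j)
  then show thesis using len assms by (intro that[of j]) (auto simp: mod_Suc)
qed

lemma vertex_le: assumes "i < length vs" shows "inner (N i) (vertex vs j) \<le> d i"
proof -
  let ?j = "j mod length vs"
  have "?j < length vs" using assms by (intro mod_less_divisor) auto
  then have "inner (N i) (vertex vs ?j) \<le> d i"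
    using below[of i ?j] start_on[of i] end_on[of i] assms
    by (metis less_eq_real_def vertex_mod)
  then show ?thesis by (simp add: vertex_mod)
qed

lemma vertex_eq_iff:
  assumes "i < length vs" "j < length vs"
  shows "inner (N i) (vertex vs j) = d i \<longleftrightarrow> j = i \<or> j = nx i"
  using below[OF assms] start_on[OF assms(1)] end_on[OF assms(1)] vertex_mod[of vs "Suc i"] by force

lemma vertex_inj: assumes "i < length vs" "j < length vs" "vertex vs i = vertex vs j" shows "i = j"
proof (rule ccontr)
  assume ij: "i \<noteq> j"
  have "j = nx i"
    using vertex_eq_iff[of i j] start_on[of i] assms ij by metis
  moreover have "i = nx j"
    using vertex_eq_iff[of j i] start_on[of j] assms ij by metis
  ultimately show False using nx(3) assms by metis
qed

lemma vertex_Suc_neq: assumes "i < length vs" shows "vertex vs (Suc i) \<noteq> vertex vs i"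
  using vertex_inj[of "nx i" i] nx[OF assms] assms by (auto simp: vertex_mod)

lemma N_nonzero: "i < length vs \<Longrightarrow> N i \<noteq> 0"
  using unit by force

lemma edge_orth: "i < length vs \<Longrightarrow> inner (N i) (vertex vs (Suc i) - vertex vs i) = 0"
  using start_on end_on by (simp add: inner_diff_right)

lemma in_sideE:
  assumes "z \<in> side vs i"
  obtains u where "0 \<le> u" "u \<le> 1" "z = (1 - u) *\<^sub>R vertex vs i + u *\<^sub>R vertex vs (Suc i)"
  using assms unfolding side_def closed_segment_def by auto

lemma side_on: assumes "z \<in> side vs i" "i < length vs" shows "inner (N i) z = d i"
  using assms(1)
proof (rule in_sideE)
  fix u assume "0 \<le> u" "u \<le> 1" "z = (1 - u) *\<^sub>R vertex vs i + u *\<^sub>R vertex vs (Suc i)"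
  then show ?thesis using start_on[OF assms(2)] end_on[OF assms(2)]
    by (simp only: inner_add_right inner_scaleR_right) (simp add: algebra_simps)
qed

lemma side_in_K: assumes "z \<in> side vs i" shows "z \<in> K"
  using assms
proof (rule in_sideE)
  fix u assume u: "0 \<le> u" "u \<le> 1" "z = (1 - u) *\<^sub>R vertex vs i + u *\<^sub>R vertex vs (Suc i)"
  have "inner (N j) z \<le> d j" if "j < length vs" for j
    using vertex_le[OF that, of i] vertex_le[OF that, of "Suc i"] u
    by (auto simp: inner_add_right intro!: convex_bound_le)
  then show ?thesis by (auto simp: K_def)
qed

text \<open>The position \<open>u\<close> along the line is confined by the two neighbouring sides:
  the functional of the preceding side is tight at \<open>u = 0\<close> and slack at
  \<open>u = 1\<close>, which forces \<open>0 \<le> u\<close>, and the following side forces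
  \<open>u \<le> 1\<close> in the same way.\<close>

lemma on_line_in_side:
  assumes "z \<in> K" "i < length vs" "inner (N i) z = d i"
  shows "z \<in> side vs i"
proof -
  let ?e = "vertex vs (Suc i) - vertex vs i"
  obtain u where u: "z - vertex vs i = u *\<^sub>R ?e"
    using orthogonal_complex_parallel[of "N i" ?e "z - vertex vs i"] N_nonzero edge_orth
      vertex_Suc_neq assms start_on by (auto simp: inner_diff_right)
  have z: "z = (1 - u) *\<^sub>R vertex vs i + u *\<^sub>R vertex vs (Suc i)"
    using u by (simp add: algebra_simps)
  obtain j where j: "j < length vs" "nx j = i" "j \<noteq> i" "j \<noteq> nx i" using prev_ex[OF assms(2)] by metis
  have A: "inner (N j) (vertex vs i) = d j"
    using end_on[OF j(1)] j(2) by (metis vertex_mod)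
  have B: "inner (N j) (vertex vs (Suc i)) < d j"
    using below[OF j(1), of "nx i"] nx assms(2) j by (metis vertex_mod)
  have "inner (N j) z \<le> d j" using assms(1) j(1) by (auto simp: K_def)
  then have "u * (d j - inner (N j) (vertex vs (Suc i))) \<ge> 0"
    unfolding z using A by (simp add: inner_add_right algebra_simps)
  then have u0: "u \<ge> 0" using B by (simp add: zero_le_mult_iff)
  have A': "inner (N (nx i)) (vertex vs (Suc i)) = d (nx i)"
    using start_on[of "nx i"] nx assms(2) by (simp add: vertex_mod)
  have B': "inner (N (nx i)) (vertex vs i) < d (nx i)"
    using below[of "nx i" i] nx assms(2) by metis
  have "inner (N (nx i)) z \<le> d (nx i)" using assms nx by (auto simp: K_def)
  then have "(1 - u) * (d (nx i) - inner (N (nx i)) (vertex vs i)) \<ge> 0"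
    unfolding z using A' by (simp add: inner_add_right algebra_simps)
  then have u1: "u \<le> 1" using B' by (simp add: zero_le_mult_iff)
  show ?thesis unfolding side_def closed_segment_def using z u0 u1 by auto
qed

lemma boundary_eq: "polygon_boundary vs = {z\<in>K. \<exists>i<length vs. inner (N i) z = d i}"
proof (intro set_eqI iffI)
  fix z assume "z \<in> polygon_boundary vs"
  then obtain i where "i < length vs" "z \<in> side vs i" by (auto simp: polygon_boundary_def)
  then show "z \<in> {z\<in>K. \<exists>i<length vs. inner (N i) z = d i}" using side_in_K side_on by auto
next
  fix z assume "z \<in> {z\<in>K. \<exists>i<length vs. inner (N i) z = d i}"
  then show "z \<in> polygon_boundary vs" using on_line_in_side by (auto simp: polygon_boundary_def)
qed

lemma K_halfspaces: "K = (\<Inter>i<length vs. {z. inner (N i) z \<le> d i})"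
  by (auto simp: K_def)

lemma closed_K: "closed K"
  unfolding K_halfspaces by (intro closed_INT ballI closed_halfspace_le)

lemma convex_K: "convex K"
  unfolding K_halfspaces by (intro convex_INT convex_halfspace_le)

lemma interior_K: "interior K = {z. \<forall>i<length vs. inner (N i) z < d i}"
proof
  have "{z. \<forall>i<length vs. inner (N i) z < d i} = (\<Inter>i\<in>{..<length vs}. {z. inner (N i) z < d i})"
    by auto
  then have "open {z. \<forall>i<length vs. inner (N i) z < d i}"
    by (auto intro!: open_INT open_halfspace_lt)
  then show "{z. \<forall>i<length vs. inner (N i) z < d i} \<subseteq> interior K"
    by (rule interior_maximal[rotated]) (auto simp: K_def intro: less_imp_le)
next
  have "interior K \<subseteq> {z. inner (N i) z < d i}" if "i < length vs" for i
  proof -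
    have "interior K \<subseteq> interior {z. inner (N i) z \<le> d i}"
      using that by (intro interior_mono) (auto simp: K_def)
    then show ?thesis using interior_halfspace_le[OF N_nonzero[OF that]] by simp
  qed
  then show "interior K \<subseteq> {z. \<forall>i<length vs. inner (N i) z < d i}" by blast
qed

lemma frontier_K: "frontier K = polygon_boundary vs"
  unfolding frontier_def boundary_eq interior_K using closed_K
  by (auto simp: K_def order.order_iff_strict)

text \<open>Boundedness enters here: for a bounded convex set the inside of the frontier is the
  interior.\<close>

lemma inside_boundary: "inside (polygon_boundary vs) = {z. \<forall>i<length vs. inner (N i) z < d i}"
  using inside_frontier_eq_interior[OF bdd[folded K_def] convex_K] frontier_K interior_K by simp

lemma region_eq: "polygon_region vs = K"
  unfolding polygon_region_def inside_boundary
  unfolding boundary_eq by (auto simp: K_def order.order_iff_strict)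

lemma vertex_on_side:
  assumes "i < length vs" "j < length vs" "vertex vs j \<in> side vs i"
  shows "j = i \<or> j = nx i"
  using side_on[OF assms(3,1)] vertex_eq_iff assms by auto

text \<open>An affine functional that is at most \<open>d i\<close> at both ends of side
  \<open>j\<close> and equals \<open>d i\<close> strictly between them equals it at both ends. Side
  \<open>j\<close> would then have both ends on line \<open>i\<close>, which for at least three
  sides means \<open>j = i\<close>.\<close>

lemma sides_inter_subset:
  assumes "i < length vs" "j < length vs" "i \<noteq> j" "z \<in> side vs i" "z \<in> side vs j"
  shows "z \<in> {vertex vs j, vertex vs (Suc j)}"
  using assms(5)
proof (rule in_sideE)
  fix u assume u: "0 \<le> u" "u \<le> 1" "z = (1 - u) *\<^sub>R vertex vs j + u *\<^sub>R vertex vs (Suc j)"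
  have z: "inner (N i) z = d i" using side_on assms by auto
  have le: "inner (N i) (vertex vs j) \<le> d i" "inner (N i) (vertex vs (Suc j)) \<le> d i"
    using vertex_le assms by auto
  have "(1 - u) * (d i - inner (N i) (vertex vs j)) + u * (d i - inner (N i) (vertex vs (Suc j))) = 0"
    using z unfolding u(3) by (simp add: inner_add_right algebra_simps)
  moreover have "(1 - u) * (d i - inner (N i) (vertex vs j)) \<ge> 0"
    "u * (d i - inner (N i) (vertex vs (Suc j))) \<ge> 0" using u le by auto
  ultimately have *: "(1 - u) * (d i - inner (N i) (vertex vs j)) = 0"
    "u * (d i - inner (N i) (vertex vs (Suc j))) = 0" by linarith+
  show ?thesis
  proof (rule ccontr)
    assume "\<not> ?thesis"
    then have "u \<noteq> 0" "u \<noteq> 1" using u(3) by auto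
    then have "inner (N i) (vertex vs j) = d i" "inner (N i) (vertex vs (nx j)) = d i"
      using * by (auto simp: vertex_mod)
    then have "j = nx i" "nx j = i \<or> nx j = nx i"
      using vertex_eq_iff assms nx by metis+
    then show False using nx assms by metis
  qed
qed

lemma simple: "simple_polygon vs"
  unfolding simple_polygon_def
proof (intro conjI allI impI)
  show "distinct vs"
    unfolding distinct_conv_nth
  proof (intro allI impI)
    fix i j assume "i < length vs" "j < length vs" "i \<noteq> j"
    then show "vs ! i \<noteq> vs ! j" using vertex_inj[of i j] by (auto simp: vertex_def)
  qed
next
  fix i j assume ij: "i < length vs" "j < length vs" "i \<noteq> j"
  show "side vs i \<inter> side vs j = {vertex vs i, vertex vs (Suc i)} \<inter> {vertex vs j, vertex vs (Suc j)}"
    using sides_inter_subset[OF ij] sides_inter_subset[OF ij(2,1) ij(3)[symmetric]]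
    by (auto simp: side_def)
next
  fix i assume i: "i < length vs"
  show "\<not> collinear {vertex vs i, vertex vs (Suc i), vertex vs (Suc (Suc i))}"
  proof
    assume "collinear {vertex vs i, vertex vs (Suc i), vertex vs (Suc (Suc i))}"
    then have "collinear {vertex vs (Suc i), vertex vs i, vertex vs (Suc (Suc i))}"
      by (simp add: insert_commute)
    then obtain w where w: "vertex vs (Suc (Suc i)) = w *\<^sub>R vertex vs (Suc i) + (1 - w) *\<^sub>R vertex vs i"
      using vertex_Suc_neq[OF i] unfolding collinear_3_expand
      by (metis collinear_3_expand insert_commute)
    then have "inner (N i) (vertex vs (Suc (Suc i))) = d i"
      by (simp only: w inner_add_right inner_scaleR_right start_on[OF i] end_on[OF i])
        (simp add: algebra_simps)
    moreover have "vertex vs (Suc (Suc i)) = vertex vs (nx (nx i))"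
      by (metis mod_Suc_eq vertex_mod)
    ultimately have "nx (nx i) = i \<or> nx (nx i) = nx i"
      using vertex_eq_iff nx i by metis
    then show False using nx i by metis
  qed
qed (use len in auto)

lemma convex_polygon: "convex_polygon vs"
  unfolding convex_polygon_def region_eq using simple convex_K by simp


section \<open>Arc length and the slap map of a convex polygon\<close>

lemma arc_upto_Suc: "arc_upto vs (Suc j) = arc_upto vs j + dist (vertex vs j) (vertex vs (Suc j))"
  by (simp add: arc_upto_def)

lemma arc_upto_mono: "i \<le> j \<Longrightarrow> arc_upto vs i \<le> arc_upto vs j"
  unfolding arc_upto_def by (intro sum_mono2) auto

lemma dist_pos: "dist (vertex vs j) (vertex vs (Suc j)) > 0"
proof -
  let ?j = "j mod length vs"
  have "?j < length vs" using len by (intro mod_less_divisor) auto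
  then have "vertex vs (Suc ?j) \<noteq> vertex vs ?j" by (rule vertex_Suc_neq)
  then have "vertex vs (Suc j) \<noteq> vertex vs j" by (metis vertex_mod mod_Suc_eq)
  then show ?thesis by simp
qed

lemma side_index_eq:
  assumes "arc_upto vs j \<le> s" "s < arc_upto vs (Suc j)"
  shows "side_index vs s = j"
  unfolding side_index_def
proof (rule Least_equality)
  fix y assume "s < arc_upto vs (Suc y)"
  then show "j \<le> y" using arc_upto_mono[of "Suc y" j] assms(1) by (meson not_less not_less_eq_eq order_trans)
qed (use assms in auto)

lemma arc_point_eq:
  assumes "arc_upto vs j \<le> s" "s < arc_upto vs (Suc j)"
  shows "arc_point vs s = vertex vs j +
     ((s - arc_upto vs j) / dist (vertex vs j) (vertex vs (Suc j))) *\<^sub>R (vertex vs (Suc j) - vertex vs j)"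
  unfolding arc_point_def Let_def side_index_eq[OF assms]
  by (simp add: sgn_div_norm dist_norm norm_minus_commute divide_inverse)

lemma arc_point_vertex: "arc_point vs (arc_upto vs j) = vertex vs j"
  using arc_point_eq[of j "arc_upto vs j"] dist_pos[of j] by (simp add: arc_upto_Suc)

lemma locate:
  assumes "0 \<le> s" "s < perimeter vs"
  obtains j where "j < length vs" "arc_upto vs j \<le> s" "s < arc_upto vs (Suc j)"
proof -
  let ?j = "side_index vs s"
  have ex: "s < arc_upto vs (Suc (length vs - 1))"
  proof -
    have "Suc (length vs - 1) = length vs" using len by simp
    then show ?thesis using assms(2) by (simp only: perimeter_def)
  qed
  then have 1: "s < arc_upto vs (Suc ?j)"
    unfolding side_index_def by (rule LeastI)
  have 2: "?j \<le> length vs - 1" unfolding side_index_def by (rule Least_le) (rule ex)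
  have 3: "arc_upto vs ?j \<le> s"
  proof (cases ?j)
    case 0
    then show ?thesis using assms by (simp add: arc_upto_def)
  next
    case (Suc i)
    then have "\<not> s < arc_upto vs (Suc i)"
      using not_less_Least[of i "\<lambda>i. s < arc_upto vs (Suc i)"] by (simp add: side_index_def)
    then show ?thesis using Suc by simp
  qed
  show thesis using that[of ?j] 1 2 3 len by linarith
qed

lemma arc_point_convex:
  assumes "arc_upto vs j \<le> s" "s < arc_upto vs (Suc j)"
  obtains u where "0 \<le> u" "u < 1" "arc_upto vs j < s \<Longrightarrow> 0 < u"
    "arc_point vs s = vertex vs j + u *\<^sub>R (vertex vs (Suc j) - vertex vs j)"
    "u = (s - arc_upto vs j) / dist (vertex vs j) (vertex vs (Suc j))"
  using assms arc_upto_Suc[of j] dist_pos[of j] arc_point_eq[OF assms]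
  by (intro that[of "(s - arc_upto vs j) / dist (vertex vs j) (vertex vs (Suc j))"]) auto

lemma arc_point_side:
  assumes "arc_upto vs j \<le> s" "s < arc_upto vs (Suc j)"
  shows "arc_point vs s \<in> side vs j" "arc_point vs s \<noteq> vertex vs (Suc j)"
    "arc_upto vs j < s \<Longrightarrow> arc_point vs s \<noteq> vertex vs j"
proof -
  obtain u where u: "0 \<le> u" "u < 1" "arc_upto vs j < s \<Longrightarrow> 0 < u"
    "arc_point vs s = vertex vs j + u *\<^sub>R (vertex vs (Suc j) - vertex vs j)"
    using arc_point_convex[OF assms] by metis
  have ne: "vertex vs (Suc j) - vertex vs j \<noteq> 0" using dist_pos[of j] by auto
  show "arc_point vs s \<in> side vs j"
    unfolding side_def closed_segment_def using u(1,2,4) by (auto intro!: exI[of _ u] simp: algebra_simps)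
  have "arc_point vs s - vertex vs (Suc j) = (u - 1) *\<^sub>R (vertex vs (Suc j) - vertex vs j)"
    using u(4) by (simp add: algebra_simps)
  then show "arc_point vs s \<noteq> vertex vs (Suc j)" using ne u(2) by auto
  show "arc_point vs s \<noteq> vertex vs j" if "arc_upto vs j < s"
    using u(3)[OF that] u(4) ne by simp
qed

lemma arc_point_inj:
  assumes "0 \<le> s" "s < perimeter vs" "0 \<le> s'" "s' < perimeter vs" "arc_point vs s = arc_point vs s'"
  shows "s = s'"
proof -
  obtain j where j: "j < length vs" "arc_upto vs j \<le> s" "s < arc_upto vs (Suc j)"
    using locate[OF assms(1,2)] by metis
  obtain i where i: "i < length vs" "arc_upto vs i \<le> s'" "s' < arc_upto vs (Suc i)"
    using locate[OF assms(3,4)] by metis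
  have "i = j"
  proof (rule ccontr)
    assume ij: "i \<noteq> j"
    note S = arc_point_side[OF j(2,3)] arc_point_side[OF i(2,3)]
    have "arc_point vs s \<in> {vertex vs j, vertex vs (Suc j)}" "arc_point vs s' \<in> {vertex vs i, vertex vs (Suc i)}"
      using sides_inter_subset[OF i(1) j(1) ij] sides_inter_subset[OF j(1) i(1) ij[symmetric]] S assms(5) by auto
    then have "vertex vs i = vertex vs j" using S assms(5) by auto
    then show False using vertex_inj i j ij by auto
  qed
  then show ?thesis
    using assms(5) arc_point_eq[OF j(2,3)] arc_point_eq[OF i(2,3)] dist_pos[of j] by auto
qed

lemma arc_point_strict:
  assumes "j < length vs" "arc_upto vs j < s" "s < arc_upto vs (Suc j)" "i < length vs" "i \<noteq> j"
  shows "inner (N i) (arc_point vs s) < d i"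
proof -
  note S = arc_point_side[OF less_imp_le[OF assms(2)] assms(3)]
  have K: "arc_point vs s \<in> K" using side_in_K S(1) by auto
  have "arc_point vs s \<notin> side vs i"
    using sides_inter_subset[OF assms(4,1,5)] S assms(2) by auto
  then have "inner (N i) (arc_point vs s) \<noteq> d i" using on_line_in_side[OF K assms(4)] by auto
  then show ?thesis using K assms(4) by (force simp: K_def)
qed

lemma arc_point_not_vertex:
  assumes "j < length vs" "arc_upto vs j < s" "s < arc_upto vs (Suc j)"
  shows "arc_point vs s \<notin> set vs"
proof
  assume "arc_point vs s \<in> set vs"
  then obtain k where k: "k < length vs" "arc_point vs s = vertex vs k"
    by (metis in_set_conv_nth mod_less vertex_def)
  note S = arc_point_side[OF less_imp_le[OF assms(2)] assms(3)]
  have "vertex vs k \<in> side vs j" using S(1) k by simp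
  then have "k = j \<or> k = nx j" using vertex_on_side assms(1) k by blast
  then show False using S k assms(2) by (auto simp: vertex_mod)
qed

text \<open>Orthogonality to the side leaves only the two unit normals, and entering the interior
  selects the sign. Conversely, every other half-plane condition is strict at an inner point of the
  side, hence holds on a whole ball around it.\<close>

lemma inward_normal_iff:
  assumes "j < length vs" "arc_upto vs j < s" "s < arc_upto vs (Suc j)"
  shows "inward_normal vs s w \<longleftrightarrow> w = - N j"
proof
  let ?z = "arc_point vs s" and ?e = "vertex vs (Suc j) - vertex vs j"
  note S = arc_point_side[OF less_imp_le[OF assms(2)] assms(3)]
  have zj: "inner (N j) ?z = d j" using side_on S assms by auto
  have NN: "inner (N j) (N j) = 1" using unit[OF assms(1)] by (simp add: dot_square_norm)
  {
    assume "inward_normal vs s w"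
    then have w: "norm w = 1" "inner w ?e = 0"
      and ex: "\<exists>e>0. \<forall>r. 0 < r \<and> r < e \<longrightarrow> ?z + r *\<^sub>R w \<in> inside (polygon_boundary vs)"
      unfolding inward_normal_def side_index_eq[OF less_imp_le[OF assms(2)] assms(3)]
      by (auto simp: orthogonal_def)
    obtain e where e: "e > 0" "\<And>r. 0 < r \<Longrightarrow> r < e \<Longrightarrow> ?z + r *\<^sub>R w \<in> inside (polygon_boundary vs)"
      using ex by blast
    have "?e \<noteq> 0" using dist_pos[of j] by auto
    then obtain u where u: "w = u *\<^sub>R N j"
      using orthogonal_complex_parallel[of ?e "N j" w] w edge_orth N_nonzero assms(1) by (metis inner_commute)
    have "\<bar>u\<bar> = 1" using w(1) u unit[OF assms(1)] by simp
    moreover have "inner (N j) (?z + (e/2) *\<^sub>R w) < d j"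
      using e(1) e(2)[of "e/2"] assms(1) by (auto simp: inside_boundary)
    then have "e/2 * u < 0" using zj u NN by (simp add: inner_add_right)
    then have "u < 0" using e(1) by (simp add: mult_less_0_iff)
    ultimately show "w = - N j" using u by auto
  }
  {
    assume w: "w = - N j"
    let ?U = "\<Inter>i\<in>{..<length vs} - {j}. {z. inner (N i) z < d i}"
    have "open ?U" by (intro open_INT ballI open_halfspace_lt) auto
    moreover have "?z \<in> ?U" using arc_point_strict[OF assms] by auto
    ultimately obtain e where e: "e > 0" "ball ?z e \<subseteq> ?U" by (meson open_contains_ball)
    have "?z + r *\<^sub>R w \<in> inside (polygon_boundary vs)" if "0 < r" "r < e" for r
    proof -
      have "?z + r *\<^sub>R w \<in> ball ?z e" using that unit[OF assms(1)] w by (auto simp: dist_norm)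
      then have "?z + r *\<^sub>R w \<in> ?U" using e by auto
      moreover have "inner (N j) (?z + r *\<^sub>R w) < d j"
        using zj w NN that by (simp add: inner_add_right inner_diff_right)
      ultimately show ?thesis unfolding inside_boundary by auto
    qed
    then show "inward_normal vs s w"
      unfolding inward_normal_def side_index_eq[OF less_imp_le[OF assms(2)] assms(3)]
      using w unit[OF assms(1)] edge_orth[OF assms(1)] e(1) by (auto simp: orthogonal_def)
  }
qed

text \<open>By convexity the ray from an inner point of a side meets the boundary once more, so any
  boundary point exhibited on it is the image and no search for the nearest one is needed.\<close>

lemma slap_map_eq:
  assumes j: "j < length vs" "arc_upto vs j < s" "s < arc_upto vs (Suc j)"
    and s': "0 \<le> s'" "s' < perimeter vs" and r: "r > 0"
    and hit: "arc_point vs s' = arc_point vs s - r *\<^sub>R N j"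
  shows "slap_map vs s = s'"
proof -
  let ?z = "arc_point vs s" and ?z' = "arc_point vs s'"
  note S = arc_point_side[OF less_imp_le[OF j(2)] j(3)]
  have zj: "inner (N j) ?z = d j" using side_on S j by auto
  have NN: "inner (N j) (N j) = 1" using unit[OF j(1)] by (simp add: dot_square_norm)
  obtain i where i: "i < length vs" "arc_upto vs i \<le> s'" "s' < arc_upto vs (Suc i)"
    using locate[OF s'] by metis
  have z'b: "?z' \<in> side vs i" using arc_point_side[OF i(2,3)] by auto
  then have z'K: "?z' \<in> K" using side_in_K by auto
  have z'i: "inner (N i) ?z' = d i" using side_on z'b i by auto
  have "inner (N j) ?z' = d j - r" using hit zj NN by (simp add: inner_diff_right)
  then have ij: "i \<noteq> j" using z'i r by auto
  have zi: "inner (N i) ?z < d i" using arc_point_strict[OF j i(1) ij] .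
  have hits: "slap_hits vs s = {?z'}"
  proof (intro set_eqI iffI)
    fix x assume "x \<in> slap_hits vs s"
    then obtain q where q: "0 \<le> q" "x = ?z - q *\<^sub>R N j" "x \<in> polygon_boundary vs" "x \<noteq> ?z"
      unfolding slap_hits_def inward_normal_iff[OF j] by auto
    then have "q > 0" by (cases "q = 0") auto
    \<comment> \<open>Along the ray every functional is affine, with parameter \<open>q / r\<close>
      between the start and the claimed hit. Past \<open>r\<close> the side through the hit is
      violated; before \<open>r\<close> all conditions are strict.\<close>
    have a: "inner (N k) x = (1 - q / r) * inner (N k) ?z + (q / r) * inner (N k) ?z'" for k
      using r by (simp only: q(2) hit inner_diff_right inner_scaleR_right) (simp add: field_simps)
    have "q \<le> r"
    proof (rule ccontr)
      assume "\<not> q \<le> r"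
      then have "(q / r - 1) * (d i - inner (N i) ?z) > 0" using zi r by (intro mult_pos_pos) auto
      then have "inner (N i) x > d i" using a[of i] z'i by (simp add: algebra_simps)
      then show False using q(3) i(1) by (force simp: boundary_eq K_def)
    qed
    moreover have "\<not> q < r"
    proof
      assume qr: "q < r"
      have "inner (N k) x < d k" if k: "k < length vs" for k
      proof (cases "k = j")
        case True
        then show ?thesis using q(2) zj NN \<open>q > 0\<close> by (simp add: inner_diff_right)
      next
        case False
        have "(1 - q / r) * (d k - inner (N k) ?z) > 0"
          using arc_point_strict[OF j k False] qr r by (intro mult_pos_pos) auto
        moreover have "(q / r) * (d k - inner (N k) ?z') \<ge> 0"
          using z'K k r q(1) by (intro mult_nonneg_nonneg) (auto simp: K_def)
        ultimately show ?thesis using a[of k] by (simp add: algebra_simps)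
      qed
      then show False using q(3) by (force simp: boundary_eq)
    qed
    ultimately show "x \<in> {?z'}" using q(2) hit by auto
  next
    fix x assume "x \<in> {?z'}"
    moreover have "?z' \<noteq> ?z" using zi z'i by auto
    moreover have "?z' \<in> polygon_boundary vs" using z'b i by (auto simp: polygon_boundary_def)
    ultimately show "x \<in> slap_hits vs s"
      unfolding slap_hits_def inward_normal_iff[OF j] using hit r
      by (auto intro!: exI[of _ r])
  qed
  have "(THE s'. 0 \<le> s' \<and> s' < perimeter vs \<and>
             is_arg_min (dist ?z) (\<lambda>x. x \<in> slap_hits vs s) (arc_point vs s')) = s'"
    unfolding hits is_arg_min_def using s' arc_point_inj by (intro the_equality) auto
  then show ?thesis unfolding slap_map_def using arc_point_not_vertex[OF j] by simp
qed

lemma slap_map_vertex: "slap_map vs (arc_upto vs j) = 0"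
proof -
  have "j mod length vs < length vs" using len by (intro mod_less_divisor) auto
  then have "vertex vs j \<in> set vs" unfolding vertex_def by simp
  then show ?thesis unfolding slap_map_def arc_point_vertex by simp
qed

end

section \<open>A polygon with n independent pairs of facing sides\<close>

lemma cos_less: fixes y z :: real assumes "\<bar>z\<bar> < \<bar>y\<bar>" "\<bar>y\<bar> + \<bar>z\<bar> < 2 * pi" shows "cos y < cos z"
proof -
  have "cos \<bar>z\<bar> - cos \<bar>y\<bar> = 2 * sin ((\<bar>z\<bar> + \<bar>y\<bar>) / 2) * sin ((\<bar>y\<bar> - \<bar>z\<bar>) / 2)"
    by (rule cos_diff_cos)
  moreover have "0 < sin ((\<bar>z\<bar> + \<bar>y\<bar>) / 2)" "0 < sin ((\<bar>y\<bar> - \<bar>z\<bar>) / 2)"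
    using assms by (intro sin_gt_zero; simp)+
  ultimately have "0 < cos \<bar>z\<bar> - cos \<bar>y\<bar>" by simp
  then show ?thesis by simp
qed

lemma inner_cis: "inner (cis x) (of_real r * cis y) = r * cos (y - x)"
  by (simp add: inner_complex_def cos_diff algebra_simps)

text \<open>A regular \<open>2 n\<close>-gon with sides of length 2 and apothem \<open>H\<close>; each of \<open>n\<close> consecutive sides
  is replaced by two sides of slope \<open>\<plusminus>t\<close> meeting at a vertex at distance \<open>H + t\<close> from the centre.
  The vertices have polar angles \<open>ang j * \<delta>\<close>.\<close>

locale capped_polygon =
  fixes n :: nat and t :: real
  assumes n: "2 \<le> n" and t: "0 < t" and t_small: "t * (2 * cot (pi / (2 * n)) + t) < 1"
begin

definition \<delta> :: real where "\<delta> = pi / (2 * n)"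
definition H :: real where "H = cot \<delta>"
definition \<tau> :: real where "\<tau> = arctan t"
text \<open>Angles in units of \<open>\<delta>\<close>: over the capped half regular vertices and
  apexes alternate in steps of one, over the other half only even multiples occur. The parity of
  \<open>ang\<close> therefore tells an apex from a regular vertex.\<close>

definition ang :: "nat \<Rightarrow> nat" where "ang j = (if j < 2 * n then j else 2 * (j - n))"
definition rad :: "nat \<Rightarrow> real" where "rad g = (if even g then 1 / sin \<delta> else H + t)"
definition V :: "nat \<Rightarrow> complex" where "V j = of_real (rad (ang j)) * cis (ang j * \<delta>)"
definition vs :: "complex list" where "vs = map V [0..<3 * n]"
definition dir :: "nat \<Rightarrow> real" where
  "dir j = (if j < 2 * n then (if even j then (j + 1) * \<delta> - \<tau> else j * \<delta> + \<tau>)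
     else (2 * (real j - n) + 1) * \<delta>)"
definition off :: "nat \<Rightarrow> real" where "off j = (if j < 2 * n then (H + t) * cos \<tau> else H)"
text \<open>Axis of the \<open>i\<close>-th pair. Multiplication by \<open>u i\<close> carries a
  fixed frame, with the ends of the cap at real part \<open>H\<close> and the base at real part
  \<open>- H\<close>, to the actual position.\<close>

definition u :: "nat \<Rightarrow> complex" where "u i = cis ((2 * real i + 1) * \<delta>)"
definition a :: real where "a = sqrt (1 + t\<^sup>2)"

lemma delta: "0 < \<delta>" "2 * real n * \<delta> = pi" "\<delta> < pi / 2" "2 * \<delta> \<le> pi / 2"
  using n by (auto simp: \<delta>_def field_simps)

lemma sin_pos: "0 < sin \<delta>" and cos_pos: "0 < cos \<delta>"
  using delta pi_gt_zero by (auto intro!: sin_gt_zero cos_gt_zero)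

lemma H: "0 < H" "H * sin \<delta> = cos \<delta>" "cos \<delta> / sin \<delta> = H"
  using sin_pos cos_pos by (auto simp: H_def cot_def)

text \<open>Two adjacent caps leave an exterior angle \<open>2 * \<delta> - 2 * \<tau>\<close> at
  their common vertex, so convexity there amounts to \<open>\<tau> < \<delta>\<close>. The condition
  on \<open>t\<close> gives more than this, namely room for the sideways drift of the
  perpendiculars.\<close>

lemma t_lt_tan: "t < tan \<delta>"
proof -
  have "t * (2 * H) + t * t < 1" using t_small by (simp add: H_def \<delta>_def algebra_simps)
  moreover have "0 < t * t" "0 < t * H" using t H by auto
  ultimately have "t * H < 1" by linarith
  then have "t * cos \<delta> < sin \<delta>" using sin_pos by (simp add: H(3)[symmetric] field_simps)
  then show ?thesis using cos_pos by (simp add: tan_def field_simps)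
qed

lemma tau: "0 < \<tau>" "\<tau> < \<delta>"
proof -
  show "0 < \<tau>" using t by (simp add: \<tau>_def)
  have "arctan t < arctan (tan \<delta>)" using t_lt_tan by (rule arctan_monotone)
  also have "arctan (tan \<delta>) = \<delta>" using delta by (intro arctan_tan) auto
  finally show "\<tau> < \<delta>" by (simp add: \<tau>_def)
qed

lemma cos_tau: "0 < cos \<tau>" "sin \<tau> = t * cos \<tau>"
proof -
  show 1: "0 < cos \<tau>" using tau delta by (intro cos_gt_zero) auto
  have "tan \<tau> = t" by (simp add: \<tau>_def tan_arctan)
  then show "sin \<tau> = t * cos \<tau>" using 1 by (simp add: tan_def field_simps)
qed

lemma off_cap: "(H + t) * cos \<tau> = cos (\<delta> - \<tau>) / sin \<delta>"
proof -
  have "cos (\<delta> - \<tau>) = (H + t) * cos \<tau> * sin \<delta>"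
    using H(2)[symmetric] cos_tau(2) by (simp add: cos_diff algebra_simps)
  then show ?thesis using sin_pos by (simp add: field_simps)
qed

lemma length_vs: "length vs = 3 * n" by (simp add: vs_def)

lemma V_cycle: "V (3 * n) = V 0"
proof -
  have "ang (3 * n) = 4 * n" "ang 0 = 0" by (auto simp: ang_def)
  moreover have "real (4 * n) * \<delta> = 2 * (2 * real n * \<delta>)" by simp
  then have "cis (real (4 * n) * \<delta>) = 1" by (simp only: delta(2) cis_2pi)
  ultimately show ?thesis by (simp add: V_def rad_def)
qed

lemma vertex_V: "j \<le> 3 * n \<Longrightarrow> vertex vs j = V j"
proof (cases "j = 3 * n")
  case True
  then show ?thesis using n by (simp add: vertex_def length_vs V_cycle) (simp add: vs_def)
next
  case False
  assume "j \<le> 3 * n"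
  then show ?thesis using False by (simp add: vertex_def length_vs) (simp add: vs_def)
qed

lemma inner_V: "inner (cis x) (V j) = rad (ang j) * cos (ang j * \<delta> - x)"
  by (simp add: V_def inner_cis)

lemma ang_le: "j < 3 * n \<Longrightarrow> ang j \<le> 4 * n - 2"
  by (auto simp: ang_def)

lemma ang_odd: "odd (ang j) \<Longrightarrow> ang j < 2 * n"
  by (auto simp: ang_def split: if_splits)

lemma ang_inj: "j < 3 * n \<Longrightarrow> j' < 3 * n \<Longrightarrow> ang j = ang j' \<Longrightarrow> j = j'"
  by (auto simp: ang_def split: if_splits)

lemma multiple_bounds:
  fixes k lo hi :: int
  assumes "lo \<le> \<bar>k\<bar>" "\<bar>k\<bar> \<le> hi"
  shows "lo * \<delta> \<le> \<bar>k * \<delta>\<bar>" "\<bar>k * \<delta>\<bar> \<le> hi * \<delta>"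
proof -
  have "\<bar>k * \<delta>\<bar> = real_of_int \<bar>k\<bar> * \<delta>" using delta by (simp add: abs_mult)
  moreover have "real_of_int lo \<le> real_of_int \<bar>k\<bar>" "real_of_int \<bar>k\<bar> \<le> real_of_int hi"
    using assms by (simp_all only: of_int_le_iff)
  ultimately show "lo * \<delta> \<le> \<bar>k * \<delta>\<bar>" "\<bar>k * \<delta>\<bar> \<le> hi * \<delta>"
    using delta(1) by (simp_all add: mult_right_mono)
qed

text \<open>Here \<open>k\<close> is the angle from the axis of the cap to the vertex in units of
  \<open>\<delta>\<close>, signed so that 0 is the apex and -1 the other end of the side; the
  mirrored side uses the same inequality with the sign reversed. Even \<open>k\<close> are apexes,
  and what remains is a comparison of absolute angles by \<open>cos_less\<close>.\<close>

lemma below_cap: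
  fixes k :: int
  assumes k: "\<bar>k\<bar> \<le> 4 * int n - 3" "k \<noteq> 0" "k \<noteq> - 1" "even k \<Longrightarrow> \<bar>k\<bar> \<le> 2 * int n - 2"
  shows "(if even k then H + t else 1 / sin \<delta>) * cos (k * \<delta> + \<tau>) < (H + t) * cos \<tau>"
proof (cases "even k")
  case True
  have "2 \<le> \<bar>k\<bar>" "\<bar>k\<bar> \<le> 2 * int n - 2" using True k by (auto elim!: evenE)
  from multiple_bounds[OF this] have "2 * \<delta> \<le> \<bar>k * \<delta>\<bar>" "\<bar>k * \<delta>\<bar> \<le> pi - 2 * \<delta>"
    using delta(2) by (simp_all add: algebra_simps)
  then have "cos (k * \<delta> + \<tau>) < cos \<tau>" using tau by (intro cos_less) linarith+
  then show ?thesis using True H t by simp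
next
  case False
  have "cos (k * \<delta> + \<tau>) < cos (\<delta> - \<tau>)"
  proof (cases "0 < k")
    case True
    then have "1 \<le> \<bar>k\<bar>" by simp
    from multiple_bounds[OF this k(1)] have "\<delta> \<le> \<bar>k * \<delta>\<bar>" "\<bar>k * \<delta>\<bar> \<le> 2 * pi - 3 * \<delta>"
      using delta(2) by (simp_all add: algebra_simps)
    moreover have "0 < k * \<delta>" using True delta by simp
    ultimately show ?thesis using tau by (intro cos_less) linarith+
  next
    case neg: False
    then have "3 \<le> \<bar>k\<bar>" using False k by presburger
    from multiple_bounds[OF this k(1)] have "3 * \<delta> \<le> \<bar>k * \<delta>\<bar>" "\<bar>k * \<delta>\<bar> \<le> 2 * pi - 3 * \<delta>"
      using delta(2) by (simp_all add: algebra_simps)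
    moreover have "k * \<delta> \<le> 0" using neg delta by (simp add: mult_nonpos_nonneg)
    ultimately show ?thesis using tau by (intro cos_less) linarith+
  qed
  then show ?thesis using False sin_pos off_cap by (simp add: divide_strict_right_mono)
qed

text \<open>The critical competitor is an apex two steps away from the axis of the base. It stays
  below because \<open>t < tan \<delta>\<close> and
  \<open>(H + tan \<delta>) * cos (2 * \<delta>) = H - tan \<delta>\<close>.\<close>

lemma below_base:
  fixes k :: int
  assumes k: "even k \<Longrightarrow> 2 \<le> \<bar>k\<bar> \<and> \<bar>k\<bar> \<le> 4 * int n - 2" "odd k \<Longrightarrow> 3 \<le> \<bar>k\<bar> \<and> \<bar>k\<bar> \<le> 4 * int n - 3"
  shows "(if even k then H + t else 1 / sin \<delta>) * cos (k * \<delta>) < H"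
proof (cases "even k")
  case True
  then have "2 \<le> \<bar>k\<bar>" "\<bar>k\<bar> \<le> 4 * int n - 2" using k by auto
  from multiple_bounds[OF this] have b: "2 * \<delta> \<le> \<bar>k * \<delta>\<bar>" "\<bar>k * \<delta>\<bar> \<le> 2 * pi - 2 * \<delta>"
    using delta(2) by (simp_all add: algebra_simps)
  have "cos (k * \<delta>) \<le> cos (2 * \<delta>)"
  proof (cases "\<bar>k * \<delta>\<bar> = 2 * \<delta> \<or> \<bar>k * \<delta>\<bar> = 2 * pi - 2 * \<delta>")
    case True
    have "cos (2 * pi - 2 * \<delta>) = cos (2 * \<delta>)" by (simp add: cos_diff)
    then have "cos \<bar>k * \<delta>\<bar> = cos (2 * \<delta>)" using True by metis
    then show ?thesis by simp
  next
    case False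
    then have "cos (k * \<delta>) < cos (2 * \<delta>)" using b delta by (intro cos_less) linarith+
    then show ?thesis by simp
  qed
  then have "(H + t) * cos (k * \<delta>) \<le> (H + t) * cos (2 * \<delta>)" using H t by simp
  also have "\<dots> < H"
  proof -
    have c: "0 \<le> cos (2 * \<delta>)" using delta by (intro cos_ge_zero) auto
    have tt: "t * cos \<delta> < sin \<delta>" using t_lt_tan cos_pos by (simp add: tan_def field_simps)
    have "(H + t) * cos (2 * \<delta>) \<le> (H + tan \<delta>) * cos (2 * \<delta>)" using t_lt_tan c by (intro mult_right_mono) auto
    also have "(H + tan \<delta>) * cos (2 * \<delta>) = H - tan \<delta>"
    proof -
      have "(H + tan \<delta>) * (sin \<delta> * cos \<delta>) = (cos \<delta>)\<^sup>2 + (sin \<delta>)\<^sup>2"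
        using sin_pos cos_pos by (simp add: H(3)[symmetric] tan_def field_simps power2_eq_square)
      then have "(H + tan \<delta>) * (sin \<delta> * cos \<delta>) = 1" by simp
      moreover have "(H - tan \<delta>) * (sin \<delta> * cos \<delta>) = (cos \<delta>)\<^sup>2 - (sin \<delta>)\<^sup>2"
        using sin_pos cos_pos by (simp add: H(3)[symmetric] tan_def field_simps power2_eq_square)
      then have "(H - tan \<delta>) * (sin \<delta> * cos \<delta>) = cos (2 * \<delta>)" by (simp only: cos_double)
      ultimately have "(H + tan \<delta>) * cos (2 * \<delta>) = (H - tan \<delta>) * 1"
        by (metis mult.assoc mult.commute)
      then show ?thesis by simp
    qed
    also have "\<dots> < H" using t_lt_tan t by linarith
    finally show ?thesis .
  qed
  finally show ?thesis using True by simp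
next
  case False
  then have "3 \<le> \<bar>k\<bar>" "\<bar>k\<bar> \<le> 4 * int n - 3" using k by auto
  from multiple_bounds[OF this] have "3 * \<delta> \<le> \<bar>k * \<delta>\<bar>" "\<bar>k * \<delta>\<bar> \<le> 2 * pi - 3 * \<delta>"
    using delta(2) by (simp_all add: algebra_simps)
  then have "cos (k * \<delta>) < cos \<delta>" using delta by (intro cos_less) linarith+
  then have "cos (k * \<delta>) / sin \<delta> < cos \<delta> / sin \<delta>" using sin_pos by (simp add: divide_strict_right_mono)
  then show ?thesis using False H(3) by simp
qed

lemma side_cases:
  assumes "i < 3 * n"
  obtains (lower) "i < 2 * n" "even i" "Suc i < 2 * n" | (upper) "i < 2 * n" "odd i" | (base) "2 * n \<le> i"
  using assms by (cases "i < 2 * n"; cases "even i") (auto elim!: evenE)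

lemma start_on: assumes "i < 3 * n" shows "inner (cis (dir i)) (V i) = off i"
  using assms
proof (cases rule: side_cases)
  case lower
  have "cos (i * \<delta> - dir i) = cos (\<delta> - \<tau>)"
    using lower cos_minus[of "\<delta> - \<tau>"] by (simp add: dir_def algebra_simps)
  then show ?thesis using lower off_cap by (simp add: inner_V off_def ang_def rad_def)
next
  case upper
  then show ?thesis by (simp add: inner_V off_def ang_def rad_def dir_def)
next
  case base
  have "cos (ang i * \<delta> - dir i) = cos \<delta>"
    using base cos_minus[of \<delta>] by (simp add: dir_def ang_def algebra_simps of_nat_diff)
  then show ?thesis using base H(3) by (simp add: inner_V off_def ang_def rad_def)
qed

lemma ang_Suc: "i < 2 * n \<Longrightarrow> ang (Suc i) = Suc i"
  by (auto simp: ang_def)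

lemma end_on: assumes "i < 3 * n" shows "inner (cis (dir i)) (V (Suc i)) = off i"
  using assms
proof (cases rule: side_cases)
  case lower
  then show ?thesis by (simp add: inner_V off_def ang_Suc rad_def dir_def algebra_simps)
next
  case upper
  have "cos (Suc i * \<delta> - dir i) = cos (\<delta> - \<tau>)"
    using upper by (simp add: dir_def algebra_simps)
  then show ?thesis using upper off_cap by (simp add: inner_V off_def ang_Suc rad_def)
next
  case base
  have "cos (ang (Suc i) * \<delta> - dir i) = cos \<delta>"
    using base by (simp add: dir_def ang_def algebra_simps of_nat_diff)
  then show ?thesis using base H(3) by (simp add: inner_V off_def ang_def rad_def)
qed

lemma below:
  assumes i: "i < 3 * n" and j: "j < 3 * n" "j \<noteq> i" "j \<noteq> Suc i mod (3 * n)"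
  shows "inner (cis (dir i)) (V j) < off i"
  using i
proof (cases rule: side_cases)
  case lower
  define k where "k = int (ang j) - (int i + 1)"
  have "Suc i mod (3 * n) = Suc i" using lower by simp
  then have ne: "ang j \<noteq> i" "ang j \<noteq> Suc i"
    using ang_inj[of j i] ang_inj[of j "Suc i"] j lower by (auto simp: ang_def[of i] ang_def[of "Suc i"])
  have ev: "even k \<longleftrightarrow> odd (ang j)" using lower by (simp add: k_def)
  have "\<bar>k\<bar> \<le> 4 * int n - 3" using ang_le[OF j(1)] lower n by (auto simp: k_def)
  moreover have "\<bar>k\<bar> \<le> 2 * int n - 2" if "even k"
    using ang_odd[of j] ev that lower odd_pos[of "ang j"] by (auto simp: k_def)
  moreover have "k \<noteq> 0" "k \<noteq> - 1" using ne by (auto simp: k_def)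
  ultimately have "(if even k then H + t else 1 / sin \<delta>) * cos (k * \<delta> + \<tau>) < (H + t) * cos \<tau>"
    by (intro below_cap)
  moreover have "k * \<delta> + \<tau> = ang j * \<delta> - dir i" using lower by (simp add: k_def dir_def algebra_simps)
  ultimately show ?thesis using lower ev by (simp add: inner_V off_def rad_def split: if_splits)
next
  case upper
  define k where "k = int i - int (ang j)"
  have "Suc i mod (3 * n) = Suc i" using upper n by simp
  then have ne: "ang j \<noteq> i" "ang j \<noteq> Suc i"
    using ang_inj[of j i] ang_inj[of j "Suc i"] j upper n ang_Suc[of i] by (auto simp: ang_def[of i])
  have ev: "even k \<longleftrightarrow> odd (ang j)" using upper by (simp add: k_def)
  have "\<bar>k\<bar> \<le> 4 * int n - 3" using ang_le[OF j(1)] upper n odd_pos[of i] by (auto simp: k_def)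
  moreover have "\<bar>k\<bar> \<le> 2 * int n - 2" if "even k"
    using ang_odd[of j] ev that upper odd_pos[of "ang j"] odd_pos[of i] by (auto simp: k_def)
  moreover have "k \<noteq> 0" "k \<noteq> - 1" using ne by (auto simp: k_def)
  ultimately have "(if even k then H + t else 1 / sin \<delta>) * cos (k * \<delta> + \<tau>) < (H + t) * cos \<tau>"
    by (intro below_cap)
  moreover have "k * \<delta> + \<tau> = - (ang j * \<delta> - dir i)" using upper by (simp add: k_def dir_def algebra_simps)
  then have "cos (k * \<delta> + \<tau>) = cos (ang j * \<delta> - dir i)" by (simp only: cos_minus)
  ultimately show ?thesis using upper ev by (simp add: inner_V off_def rad_def split: if_splits)
next
  case base
  define k where "k = int (ang j) - (2 * (int i - int n) + 1)"
  have ai: "int (ang i) = 2 * (int i - int n)" using base by (simp add: ang_def)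
  have as: "int (ang (Suc i)) = 2 * (int i - int n) + 2" using base by (simp add: ang_def)
  have aj: "int (ang j) \<le> 4 * int n - 2" using ang_le[OF j(1)] n by linarith
  have k1: "k \<noteq> - 1"
  proof
    assume "k = - 1"
    then have "ang j = ang i" using ai by (simp add: k_def)
    then show False using ang_inj[OF j(1) i] j by simp
  qed
  have k2: "k \<noteq> 1"
  proof
    assume k: "k = 1"
    then have eq: "ang j = ang (Suc i)" using as by (simp add: k_def)
    show False
    proof (cases "Suc i = 3 * n")
      case True
      then show ?thesis using as eq aj by simp
    next
      case False
      then have "Suc i < 3 * n" using i by simp
      then show ?thesis using ang_inj[OF j(1), of "Suc i"] eq j by simp
    qed
  qed
  \<comment> \<open>The last side ends at vertex 0, whose angle is recorded as 0 and not as a full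
    turn.\<close>
  have k3: "k \<noteq> - (4 * int n - 1)"
  proof
    assume k: "k = - (4 * int n - 1)"
    then have "ang j = 0" "Suc i = 3 * n" using i by (auto simp: k_def)
    then have "j = 0" using ang_inj[OF j(1), of 0] n by (simp add: ang_def[of 0])
    then show False using j \<open>Suc i = 3 * n\<close> by simp
  qed
  have ev: "even k \<longleftrightarrow> odd (ang j)" by (simp add: k_def)
  have b: "\<bar>k\<bar> \<le> 4 * int n - 1" using aj base i by (auto simp: k_def)
  have "2 \<le> \<bar>k\<bar> \<and> \<bar>k\<bar> \<le> 4 * int n - 2" if "even k"
  proof -
    have "k \<le> - 2" using that ev ang_odd[of j] base by (auto simp: k_def)
    moreover have "\<bar>k\<bar> \<noteq> 4 * int n - 1" using that by presburger
    ultimately show ?thesis using b by linarith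
  qed
  moreover have "3 \<le> \<bar>k\<bar> \<and> \<bar>k\<bar> \<le> 4 * int n - 3" if "odd k"
  proof -
    have "k \<noteq> 4 * int n - 1" using aj base by (simp add: k_def)
    then have "\<bar>k\<bar> \<noteq> 4 * int n - 1" using k3 by linarith
    moreover have "\<bar>k\<bar> \<noteq> 4 * int n - 2" using that by presburger
    moreover have "3 \<le> \<bar>k\<bar>" using that k1 k2 by presburger
    ultimately show ?thesis using b by linarith
  qed
  ultimately have "(if even k then H + t else 1 / sin \<delta>) * cos (k * \<delta>) < H" by (intro below_base)
  moreover have "k * \<delta> = ang j * \<delta> - dir i" using base by (simp add: k_def dir_def algebra_simps)
  ultimately show ?thesis using base ev by (simp add: inner_V off_def rad_def split: if_splits)
qed

lemma cis_dir:
  assumes "i < n"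
  shows "cis (dir (2 * i)) = u i * cis (- \<tau>)" "cis (dir (2 * i + 1)) = u i * cis \<tau>"
    "cis (dir (2 * n + i)) = - u i"
proof -
  show "cis (dir (2 * i)) = u i * cis (- \<tau>)" "cis (dir (2 * i + 1)) = u i * cis \<tau>"
    using assms by (simp_all add: dir_def u_def cis_mult algebra_simps)
  have "dir (2 * n + i) = (2 * real i + 1) * \<delta> + pi" using delta(2) by (simp add: dir_def algebra_simps)
  then have "cis (dir (2 * n + i)) = u i * cis pi" by (simp only: u_def cis_mult)
  then show "cis (dir (2 * n + i)) = - u i" by simp
qed

text \<open>The normals of the two sides of a cap add up to a multiple of \<open>u i\<close>, and
  the normal of the opposite base is \<open>- u i\<close>, so the pair confines the region to a
  strip.\<close>

lemma inner_u_bounds: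
  assumes z: "\<forall>i<3 * n. inner (cis (dir i)) z \<le> off i" and i: "i < n"
  shows "\<bar>inner (u i) z\<bar> \<le> H + t"
proof -
  have "inner (cis (dir (2 * i))) z + inner (cis (dir (2 * i + 1))) z \<le> 2 * ((H + t) * cos \<tau>)"
    using z[rule_format, of "2 * i"] z[rule_format, of "2 * i + 1"] i by (simp add: off_def)
  moreover have "cis (dir (2 * i)) + cis (dir (2 * i + 1)) = (2 * cos \<tau>) *\<^sub>R u i"
    unfolding cis_dir[OF i] by (simp add: complex_eq_iff algebra_simps)
  then have "inner (cis (dir (2 * i))) z + inner (cis (dir (2 * i + 1))) z = 2 * cos \<tau> * inner (u i) z"
    by (simp flip: inner_add_left)
  ultimately have "cos \<tau> * inner (u i) z \<le> cos \<tau> * (H + t)" by (simp add: algebra_simps)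
  then have 1: "inner (u i) z \<le> H + t" using cos_tau by simp
  have "- inner (u i) z \<le> H"
    using z[rule_format, of "2 * n + i"] i cis_dir(3)[OF i] by (simp add: off_def)
  then show ?thesis using 1 t by linarith
qed

text \<open>Two strips with different axes suffice, and \<open>2 \<le> n\<close> provides them. The
  coordinate \<open>v\<close> orthogonal to \<open>u 0\<close> is recovered from \<open>u 1\<close>,
  which makes the angle \<open>2 * \<delta>\<close> with \<open>u 0\<close>.\<close>

lemma bounded_region: "bounded {z. \<forall>i<3 * n. inner (cis (dir i)) z \<le> off i}"
proof (rule boundedI)
  fix z assume "z \<in> {z. \<forall>i<3 * n. inner (cis (dir i)) z \<le> off i}"
  then have b: "\<bar>inner (u 0) z\<bar> \<le> H + t" "\<bar>inner (u 1) z\<bar> \<le> H + t"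
    using inner_u_bounds[of z] n by auto
  define v where "v = inner (\<i> * u 0) z"
  have s: "0 < sin (2 * \<delta>)" using delta by (intro sin_gt_zero) auto
  have "u 1 = cis (2 * \<delta>) * u 0" by (simp add: u_def cis_mult algebra_simps)
  also have "\<dots> = cos (2 * \<delta>) *\<^sub>R u 0 + sin (2 * \<delta>) *\<^sub>R (\<i> * u 0)"
    by (simp add: complex_eq_iff)
  finally have "inner (u 1) z = cos (2 * \<delta>) * inner (u 0) z + sin (2 * \<delta>) * v"
    by (simp only: inner_add_left inner_scaleR_left v_def)
  moreover have "\<bar>cos (2 * \<delta>) * inner (u 0) z\<bar> \<le> 1 * (H + t)"
    unfolding abs_mult using b by (intro mult_mono) auto
  ultimately have "\<bar>sin (2 * \<delta>) * v\<bar> \<le> 2 * (H + t)"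
    using b(2) abs_triangle_ineq4[of "inner (u 1) z" "cos (2 * \<delta>) * inner (u 0) z"] by simp
  then have "\<bar>v\<bar> * sin (2 * \<delta>) \<le> 2 * (H + t)" using s by (simp add: abs_mult mult.commute)
  then have v: "\<bar>v\<bar> \<le> 2 * (H + t) / sin (2 * \<delta>)" using s by (simp add: pos_le_divide_eq)
  have "cnj (u 0) * z = Complex (inner (u 0) z) v"
    by (simp add: complex_eq_iff inner_complex_def v_def algebra_simps)
  then have "norm z = norm (Complex (inner (u 0) z) v)"
    by (metis complex_mod_cnj mult_1 norm_cis norm_mult u_def)
  also have "\<dots> \<le> \<bar>inner (u 0) z\<bar> + \<bar>v\<bar>"
    using cmod_le[of "Complex (inner (u 0) z) v"] by simp
  finally show "norm z \<le> (H + t) + 2 * (H + t) / sin (2 * \<delta>)" using b v by linarith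
qed

sublocale convex_ngon vs "\<lambda>j. cis (dir j)" off
proof
  show "3 \<le> length vs" using n by (simp add: length_vs)
  fix i assume i: "i < length vs"
  then show "norm (cis (dir i)) = 1" by simp
  show "inner (cis (dir i)) (vertex vs i) = off i" using i start_on vertex_V by (simp add: length_vs)
  show "inner (cis (dir i)) (vertex vs (Suc i)) = off i" using i end_on vertex_V by (simp add: length_vs)
next
  fix i j assume "i < length vs" "j < length vs" "j \<noteq> i" "j \<noteq> Suc i mod length vs"
  then show "inner (cis (dir i)) (vertex vs j) < off i" using below vertex_V by (simp add: length_vs)
next
  show "bounded {z. \<forall>i<length vs. inner (cis (dir i)) z \<le> off i}" using bounded_region by (simp add: length_vs)
qed


section \<open>The slap map of the capped polygon in coordinates\<close>

lemma a: "0 < a" "a\<^sup>2 = 1 + t\<^sup>2" "1 < a"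
  using t by (auto simp: a_def intro!: real_less_rsqrt add_pos_nonneg)

lemma frame:
  "of_real (1 / sin \<delta>) * cis (x + \<delta>) = cis x * Complex H 1"
  "of_real (1 / sin \<delta>) * cis (x - \<delta>) = cis x * Complex H (- 1)"
proof -
  have "of_real (1 / sin \<delta>) * cis \<delta> = Complex H 1" "of_real (1 / sin \<delta>) * cis (- \<delta>) = Complex H (- 1)"
    using H(3) sin_pos by (simp_all add: complex_eq_iff)
  then show "of_real (1 / sin \<delta>) * cis (x + \<delta>) = cis x * Complex H 1"
    "of_real (1 / sin \<delta>) * cis (x - \<delta>) = cis x * Complex H (- 1)"
    by (simp_all only: diff_conv_add_uminus cis_mult[symmetric] mult.left_commute)
qed

text \<open>The base with index \<open>2 * n + i\<close> lies opposite to cap \<open>i\<close>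
  because \<open>2 * n * \<delta> = pi\<close>. In the common frame it is traversed downwards and
  the cap upwards, which accounts for the signs in the formulas for the slap map.\<close>

lemma V_frame:
  assumes "i < n"
  shows "V (2 * i) = u i * Complex H (- 1)" "V (Suc (2 * i)) = u i * Complex (H + t) 0"
    "V (Suc (Suc (2 * i))) = u i * Complex H 1"
    "V (2 * n + i) = u i * Complex (- H) 1" "V (Suc (2 * n + i)) = u i * Complex (- H) (- 1)"
proof -
  have ai: "ang (2 * i) = 2 * i" "ang (Suc (2 * i)) = Suc (2 * i)" "ang (Suc (Suc (2 * i))) = Suc (Suc (2 * i))"
    "ang (2 * n + i) = 2 * (n + i)" "ang (Suc (2 * n + i)) = 2 * (n + i) + 2"
    using assms by (auto simp: ang_def)
  have ang: "ang (2 * i) * \<delta> = (2 * real i + 1) * \<delta> - \<delta>" "ang (Suc (2 * i)) * \<delta> = (2 * real i + 1) * \<delta>"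
    "ang (Suc (Suc (2 * i))) * \<delta> = (2 * real i + 1) * \<delta> + \<delta>"
    "ang (2 * n + i) * \<delta> = (2 * real i + 1) * \<delta> - \<delta> + pi"
    "ang (Suc (2 * n + i)) * \<delta> = (2 * real i + 1) * \<delta> + \<delta> + pi"
    unfolding ai delta(2)[symmetric] by (simp_all add: algebra_simps)
  have ev: "even (ang (2 * i))" "odd (ang (Suc (2 * i)))" "even (ang (Suc (Suc (2 * i))))"
    "even (ang (2 * n + i))" "even (ang (Suc (2 * n + i)))"
    unfolding ai by simp_all
  show "V (2 * i) = u i * Complex H (- 1)"
    unfolding V_def ang rad_def u_def using ev(1) frame(2) by simp
  show "V (Suc (2 * i)) = u i * Complex (H + t) 0"
    unfolding V_def ang rad_def u_def using ev(2) by (simp add: complex_eq_iff)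
  show "V (Suc (Suc (2 * i))) = u i * Complex H 1"
    unfolding V_def ang rad_def u_def using ev(3) frame(1) by simp
  have neg: "of_real r * cis (x + pi) = - (of_real r * cis x)" for r x by (simp flip: cis_mult)
  have "V (2 * n + i) = - (u i * Complex H (- 1))"
    unfolding V_def ang rad_def u_def neg using ev(4) frame(2) by simp
  then show "V (2 * n + i) = u i * Complex (- H) 1" by (simp add: complex_eq_iff)
  have "V (Suc (2 * n + i)) = - (u i * Complex H 1)"
    unfolding V_def ang rad_def u_def neg using ev(5) frame(1) by simp
  then show "V (Suc (2 * n + i)) = u i * Complex (- H) (- 1)" by (simp add: complex_eq_iff)
qed

lemma dist_frame: "dist (u i * z) (u i * w) = cmod (z - w)"
proof -
  have "dist (u i * z) (u i * w) = cmod (u i) * cmod (z - w)"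
    by (simp only: dist_norm right_diff_distrib[symmetric] norm_mult)
  then show ?thesis by (simp add: u_def)
qed

lemma dist_V:
  assumes "j < 3 * n"
  shows "dist (V j) (V (Suc j)) = (if j < 2 * n then a else 2)"
proof -
  consider i where "i < n" "j = 2 * i" | i where "i < n" "j = Suc (2 * i)" | i where "i < n" "j = 2 * n + i"
  proof (cases "j < 2 * n")
    case True
    then show thesis using that(1)[of "j div 2"] that(2)[of "j div 2"] by (cases "even j") auto
  next
    case False
    then show thesis using that(3)[of "j - 2 * n"] assms by auto
  qed
  then show ?thesis
    by cases (simp_all add: V_frame dist_frame a_def cmod_def power2_eq_square real_sqrt_mult_self)
qed

lemma arc: "j \<le> 3 * n \<Longrightarrow> arc_upto vs j = (if j \<le> 2 * n then real j * a else 2 * real n * a + 2 * (real j - 2 * real n))"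
proof (induction j)
  case 0
  then show ?case by (simp add: arc_upto_def)
next
  case (Suc j)
  then have IH: "arc_upto vs j = (if j \<le> 2 * n then real j * a else 2 * real n * a + 2 * (real j - 2 * real n))"
    by simp
  have S: "arc_upto vs (Suc j) = arc_upto vs j + (if j < 2 * n then a else 2)"
    using Suc.prems dist_V[of j] by (simp add: arc_upto_Suc vertex_V)
  consider "j < 2 * n" | "j = 2 * n" | "2 * n < j" by linarith
  then show ?case by cases (use S IH in \<open>simp_all add: distrib_right\<close>)
qed

lemma arc_point_frame:
  assumes "j < 3 * n" "V j = u i * A" "V (Suc j) = u i * C"
    and "arc_upto vs j \<le> s" "s < arc_upto vs (Suc j)"
    and "s = arc_upto vs j + r * cmod (A - C)"
  shows "arc_point vs s = u i * (A + r *\<^sub>R (C - A))"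
proof -
  have v: "vertex vs j = u i * A" "vertex vs (Suc j) = u i * C" using assms vertex_V by auto
  have "0 < cmod (A - C)" using dist_pos[of j] unfolding v dist_frame .
  then have "(s - arc_upto vs j) / cmod (A - C) = r" using assms(6) by simp
  then have "arc_point vs s = u i * A + r *\<^sub>R (u i * C - u i * A)"
    using arc_point_eq[OF assms(4,5)] unfolding v dist_frame by simp
  also have "\<dots> = u i * (A + r *\<^sub>R (C - A))"
    by (simp add: scaleR_conv_of_real algebra_simps)
  finally show ?thesis .
qed

lemma cap_side:
  assumes "i < n" "0 < \<bar>y\<bar>" "\<bar>y\<bar> < 1"
  defines "j \<equiv> (if y < 0 then 2 * i else 2 * i + 1)"
  shows "arc_upto vs j < (2 * real i + 1) * a + a * y" "(2 * real i + 1) * a + a * y < arc_upto vs (Suc j)" "j < 2 * n"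
proof -
  show j: "j < 2 * n" using assms by (auto simp: j_def)
  have eq: "arc_upto vs j = real j * a" "arc_upto vs (Suc j) = (real j + 1) * a"
    using arc[of j] arc[of "Suc j"] j by (auto simp: algebra_simps)
  have s: "(2 * real i + 1) * a + a * y = (2 * real i + 1 + y) * a" by (simp add: algebra_simps)
  have "real j < 2 * real i + 1 + y" "2 * real i + 1 + y < real j + 1" using assms(2,3) by (auto simp: j_def)
  then show "arc_upto vs j < (2 * real i + 1) * a + a * y" "(2 * real i + 1) * a + a * y < arc_upto vs (Suc j)"
    unfolding eq s using a by simp_all
qed

text \<open>The parameter \<open>y\<close> is the coordinate orthogonal to the axis; on a side of
  slope \<open>t\<close> a unit of \<open>y\<close> takes arc length \<open>a\<close>.\<close>

lemma arc_point_cap: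
  assumes i: "i < n" and y: "\<bar>y\<bar> < 1"
  shows "arc_point vs ((2 * real i + 1) * a + a * y) = u i * Complex (H + t - t * \<bar>y\<bar>) y"
proof -
  consider "y < 0" | "y = 0" | "0 < y" by linarith
  then show ?thesis
  proof cases
    case 1
    then have S: "arc_upto vs (2 * i) < (2 * real i + 1) * a + a * y" "(2 * real i + 1) * a + a * y < arc_upto vs (Suc (2 * i))"
      using cap_side[OF i _ y] by auto
    have A: "cmod (Complex H (- 1) - Complex (H + t) 0) = a"
      by (simp add: cmod_def a_def power2_eq_square)
    have "arc_point vs ((2 * real i + 1) * a + a * y) =
        u i * (Complex H (- 1) + (1 + y) *\<^sub>R (Complex (H + t) 0 - Complex H (- 1)))"
    proof (rule arc_point_frame[OF _ V_frame(1,2)[OF i] less_imp_le[OF S(1)] S(2)])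
      show "(2 * real i + 1) * a + a * y =
          arc_upto vs (2 * i) + (1 + y) * cmod (Complex H (- 1) - Complex (H + t) 0)"
        unfolding A using i arc[of "2 * i"] by (simp add: algebra_simps)
    qed (use i in simp)
    also have "Complex H (- 1) + (1 + y) *\<^sub>R (Complex (H + t) 0 - Complex H (- 1)) = Complex (H + t - t * \<bar>y\<bar>) y"
      using 1 by (simp add: complex_eq_iff algebra_simps)
    finally show ?thesis .
  next
    case 2
    have "arc_point vs (arc_upto vs (Suc (2 * i))) = V (Suc (2 * i))"
      using arc_point_vertex vertex_V i by simp
    moreover have "arc_upto vs (Suc (2 * i)) = (2 * real i + 1) * a" using arc[of "Suc (2 * i)"] i by simp
    ultimately show ?thesis using 2 V_frame(2)[OF i] by simp
  next
    case 3
    then have S: "arc_upto vs (Suc (2 * i)) < (2 * real i + 1) * a + a * y"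
      "(2 * real i + 1) * a + a * y < arc_upto vs (Suc (Suc (2 * i)))"
      using cap_side[OF i _ y] by auto
    have A: "cmod (Complex (H + t) 0 - Complex H 1) = a"
      by (simp add: cmod_def a_def power2_eq_square)
    have "arc_point vs ((2 * real i + 1) * a + a * y) =
        u i * (Complex (H + t) 0 + y *\<^sub>R (Complex H 1 - Complex (H + t) 0))"
    proof (rule arc_point_frame[OF _ V_frame(2,3)[OF i] less_imp_le[OF S(1)] S(2)])
      show "(2 * real i + 1) * a + a * y =
          arc_upto vs (Suc (2 * i)) + y * cmod (Complex (H + t) 0 - Complex H 1)"
        unfolding A using i arc[of "Suc (2 * i)"] by (simp add: algebra_simps)
    qed (use i in simp)
    also have "Complex (H + t) 0 + y *\<^sub>R (Complex H 1 - Complex (H + t) 0) = Complex (H + t - t * \<bar>y\<bar>) y"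
      using 3 by (simp add: complex_eq_iff algebra_simps)
    finally show ?thesis .
  qed
qed

lemma base_side:
  assumes "i < n" "\<bar>x\<bar> < 1"
  shows "arc_upto vs (2 * n + i) < 2 * real n * a + 2 * real i + 1 + x"
    "2 * real n * a + 2 * real i + 1 + x < arc_upto vs (Suc (2 * n + i))"
  using assms arc[of "2 * n + i"] arc[of "Suc (2 * n + i)"] by auto

lemma arc_point_base:
  assumes i: "i < n" and x: "\<bar>x\<bar> < 1"
  shows "arc_point vs (2 * real n * a + 2 * real i + 1 + x) = u i * Complex (- H) (- x)"
proof -
  have A: "cmod (Complex (- H) 1 - Complex (- H) (- 1)) = 2" by (simp add: cmod_def)
  have "arc_point vs (2 * real n * a + 2 * real i + 1 + x) =
      u i * (Complex (- H) 1 + ((1 + x) / 2) *\<^sub>R (Complex (- H) (- 1) - Complex (- H) 1))"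
    using base_side[OF i x] i arc[of "2 * n + i"]
    by (intro arc_point_frame[where j = "2 * n + i"] V_frame) (auto simp: A algebra_simps)
  also have "Complex (- H) 1 + ((1 + x) / 2) *\<^sub>R (Complex (- H) (- 1) - Complex (- H) 1) = Complex (- H) (- x)"
    by (simp add: complex_eq_iff field_simps)
  finally show ?thesis .
qed

lemma perimeter_eq: "perimeter vs = 2 * real n * a + 2 * real n"
  using arc[of "3 * n"] n by (simp add: perimeter_def length_vs)

text \<open>The inward normal of the base is the axis itself, so the transversal coordinate
  \<open>- x\<close> is kept and only the arc length is stretched, by the factor
  \<open>a\<close>.\<close>

lemma slap_base:
  assumes i: "i < n" and x: "\<bar>x\<bar> < 1"
  shows "slap_map vs (2 * real n * a + 2 * real i + 1 + x) = (2 * real i + 1) * a - a * x"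
proof (rule slap_map_eq[where j = "2 * n + i" and r = "2 * H + t - t * \<bar>x\<bar>"])
  show "2 * n + i < length vs" using i by (simp add: length_vs)
  show "arc_upto vs (2 * n + i) < 2 * real n * a + 2 * real i + 1 + x"
    "2 * real n * a + 2 * real i + 1 + x < arc_upto vs (Suc (2 * n + i))" by (fact base_side[OF i x])+
  have "(2 * real i + 1) * a - a * x = (2 * real i + 1 - x) * a" by (simp add: algebra_simps)
  moreover have "0 < 2 * real i + 1 - x" "2 * real i + 1 - x < 2 * real n" using i x by linarith+
  then have "0 < (2 * real i + 1 - x) * a" "(2 * real i + 1 - x) * a < 2 * real n * a"
    using a by (simp_all only: zero_less_mult_iff mult_less_cancel_right_pos) auto
  ultimately show "0 \<le> (2 * real i + 1) * a - a * x" "(2 * real i + 1) * a - a * x < perimeter vs"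
    using n by (simp_all add: perimeter_eq)
  have "t * \<bar>x\<bar> < t * 1" using t x by (intro mult_strict_left_mono) auto
  then show "0 < 2 * H + t - t * \<bar>x\<bar>" using H by simp
  show "arc_point vs ((2 * real i + 1) * a - a * x) =
      arc_point vs (2 * real n * a + 2 * real i + 1 + x) - (2 * H + t - t * \<bar>x\<bar>) *\<^sub>R cis (dir (2 * n + i))"
    using arc_point_cap[OF i, of "- x"] arc_point_base[OF i x] x cis_dir(3)[OF i]
    by (simp add: complex_eq_iff algebra_simps)
qed

text \<open>In the frame the inward normal is a multiple of \<open>- Complex 1 (sgn y * t)\<close>.
  Covering the axial distance \<open>2 * H + t - t * \<bar>y\<bar>\<close> to the base changes
  \<open>y\<close> by \<open>t\<close> times that distance, against the sign of \<open>y\<close>;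
  this is the source of both \<open>1 + t\<^sup>2\<close> and
  \<open>t * (2 * H + t)\<close>.\<close>

lemma slap_cap:
  assumes i: "i < n" and y: "0 < \<bar>y\<bar>" "\<bar>y\<bar> < 1"
  shows "slap_map vs ((2 * real i + 1) * a + a * y) =
    2 * real n * a + 2 * real i + 1 - ((1 + t\<^sup>2) * y - t * (2 * H + t) * sgn y)"
proof -
  define j where "j = (if y < 0 then 2 * i else 2 * i + 1)"
  define w where "w = (1 + t\<^sup>2) * y - t * (2 * H + t) * sgn y"
  note S = cap_side[OF i y, folded j_def]
  have "w = sgn y * ((1 + t\<^sup>2) * \<bar>y\<bar> - t * (2 * H + t))"
    by (simp add: w_def algebra_simps sgn_if)
  then have w_abs: "\<bar>w\<bar> = \<bar>(1 + t\<^sup>2) * \<bar>y\<bar> - t * (2 * H + t)\<bar>" using y by (simp add: abs_mult abs_sgn_eq)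
  have "0 < (1 + t\<^sup>2) * \<bar>y\<bar>" using y by (intro mult_pos_pos add_pos_nonneg) auto
  moreover have "(1 + t\<^sup>2) * \<bar>y\<bar> < (1 + t\<^sup>2) * 1" using y by (intro mult_strict_left_mono add_pos_nonneg) auto
  moreover have "t * (2 * H + t) < 1" using t_small by (simp add: H_def \<delta>_def)
  moreover have "t\<^sup>2 < t * (2 * H + t)" using t H by (simp add: algebra_simps power2_eq_square)
  moreover define X where "X = (1 + t\<^sup>2) * \<bar>y\<bar>"
  moreover define Y where "Y = t * (2 * H + t)"
  ultimately have "0 < X" "X < 1 + t\<^sup>2" "Y < 1" "t\<^sup>2 < Y" "0 \<le> t\<^sup>2" by simp_all
  \<comment> \<open>Both bounds on the constant are used: it exceeds \<open>t\<^sup>2\<close> and is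
    below 1, so the foot of the perpendicular is an inner point of the opposite base.\<close>
  then have w: "\<bar>w\<bar> < 1" unfolding w_abs X_def[symmetric] Y_def[symmetric] by linarith
  have ty: "t * \<bar>y\<bar> < t * 1" using t y by (intro mult_strict_left_mono) auto
  have cisd: "cis (dir j) = cos \<tau> *\<^sub>R (u i * Complex 1 (sgn y * t))"
    using y cis_dir(1,2)[OF i] cos_tau(2) unfolding j_def
    by (auto simp: complex_eq_iff algebra_simps)
  have "slap_map vs ((2 * real i + 1) * a + a * y) = 2 * real n * a + 2 * real i + 1 + (- w)"
  proof (rule slap_map_eq[OF _ S(1,2), where r = "(2 * H + t - t * \<bar>y\<bar>) / cos \<tau>"])
    show "j < length vs" using S(3) by (simp add: length_vs)
    have "0 \<le> 2 * real n * a" using a by simp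
    then show "0 \<le> 2 * real n * a + 2 * real i + 1 + (- w)" using w by linarith
    show "2 * real n * a + 2 * real i + 1 + (- w) < perimeter vs" using w i unfolding perimeter_eq by linarith
    show "0 < (2 * H + t - t * \<bar>y\<bar>) / cos \<tau>" using ty H cos_tau by simp
    have "Complex (- H) w = Complex (H + t - t * \<bar>y\<bar>) y - (2 * H + t - t * \<bar>y\<bar>) *\<^sub>R Complex 1 (sgn y * t)"
      using y by (auto simp: complex_eq_iff w_def power2_eq_square algebra_simps sgn_if abs_if)
    then show "arc_point vs (2 * real n * a + 2 * real i + 1 + (- w)) = arc_point vs ((2 * real i + 1) * a + a * y) -
        ((2 * H + t - t * \<bar>y\<bar>) / cos \<tau>) *\<^sub>R cis (dir j)"
      using arc_point_base[OF i, of "- w"] arc_point_cap[OF i y(2)] w cos_tau(1)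
      by (simp add: cisd right_diff_distrib)
  qed
  then show ?thesis by (simp add: w_def)
qed

lemma slap_cap_end: "j \<le> 2 * n \<Longrightarrow> slap_map vs (real j * a) = 0"
  using slap_map_vertex[of j] arc[of j] by simp

lemma slap_base_end: "i \<le> n \<Longrightarrow> slap_map vs (2 * real n * a + 2 * real i) = 0"
  using slap_map_vertex[of "2 * n + i"] arc[of "2 * n + i"] by (cases "i = 0") (simp_all add: algebra_simps)

end

section \<open>Invariant measures\<close>

lemma invariant_prob_funpow:
  assumes "invariant_prob M f"
  shows "invariant_prob M (f ^^ n)"
proof (induction n)
  case 0
  then show ?case using assms by (simp add: invariant_prob_def distr_id id_def)
next
  case (Suc n)
  have f: "f \<in> measurable M M" "f ^^ n \<in> measurable M M" "distr M M f = M" "distr M M (f ^^ n) = M"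
    using Suc assms by (auto simp: invariant_prob_def)
  have "distr M M (f \<circ> f ^^ n) = M"
    using distr_distr[OF f(1,2)] f by simp
  then show ?case using assms measurable_comp[OF f(2,1)] unfolding invariant_prob_def funpow.simps by blast
qed

lemma AE_funpow:
  assumes "invariant_prob M f" "AE x in M. Q x"
  shows "AE x in M. Q ((f ^^ n) x)"
proof (rule AE_distrD[where M' = M])
  show "f ^^ n \<in> measurable M M" "AE x in distr M M (f ^^ n). Q x"
    using invariant_prob_funpow[OF assms(1), of n] assms(2) unfolding invariant_prob_def by metis+
qed

text \<open>\<open>P\<close> is replaced by the set of points that visit \<open>P\<close> infinitely
  often: this set is strictly invariant, and it coincides with \<open>P\<close> almost
  everywhere.\<close>

lemma ergodic_almost_invariant:
  assumes erg: "ergodic_prob M f" and P: "P \<in> sets M" and AE: "AE x in M. f x \<in> P \<longleftrightarrow> x \<in> P"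
  shows "emeasure M P = 0 \<or> emeasure M P = 1"
proof -
  have inv: "invariant_prob M f" using erg by (simp add: ergodic_prob_def)
  have meas[measurable]: "f ^^ n \<in> measurable M M" for n
    using invariant_prob_funpow[OF inv, of n] by (simp add: invariant_prob_def)
  note P[measurable]
  have *: "AE x in M. (f ^^ n) x \<in> P \<longleftrightarrow> x \<in> P" for n
  proof (induction n)
    case (Suc n)
    then show ?case using AE_funpow[OF inv AE, of n] by eventually_elim simp
  qed simp
  have all: "AE x in M. \<forall>n. (f ^^ n) x \<in> P \<longleftrightarrow> x \<in> P"
    unfolding AE_all_countable using * by simp
  define A where "A = {x\<in>space M. \<forall>m. \<exists>n\<ge>m. (f ^^ n) x \<in> P}"
  have A[measurable]: "A \<in> sets M" unfolding A_def by measurable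
  have "(\<forall>m. \<exists>n\<ge>m. (f ^^ n) (f x) \<in> P) \<longleftrightarrow> (\<forall>m. \<exists>n\<ge>m. (f ^^ n) x \<in> P)" for x
  proof -
    have "(f ^^ n) (f x) = (f ^^ Suc n) x" for n by (simp add: funpow_swap1)
    then show ?thesis by (metis Suc_le_D Suc_le_mono le_SucI)
  qed
  moreover have "f x \<in> space M" if "x \<in> space M" for x
    using inv that by (auto simp: invariant_prob_def measurable_def)
  ultimately have "f -` A \<inter> space M = A" unfolding A_def by auto
  then have "emeasure M A = 0 \<or> emeasure M A = 1" using erg A by (simp add: ergodic_prob_def)
  moreover have "emeasure M A = emeasure M P"
  proof (rule emeasure_eq_AE)
    show "AE x in M. x \<in> A \<longleftrightarrow> x \<in> P"
      using all AE_space by eventually_elim (auto simp: A_def)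
  qed measurable
  ultimately show ?thesis by simp
qed

text \<open>If \<open>h\<close> is the density of \<open>\<nu>\<close>, the set \<open>{h > 1}\<close> maximises
  \<open>\<nu> - \<mu>\<close>, and so does its preimage; hence the two agree up to null sets.\<close>

lemma invariant_abs_cont_ergodic_eq:
  assumes erg: "ergodic_prob M f" and inv: "invariant_prob N f"
    and sets: "sets N = sets M" and ac: "absolutely_continuous M N"
  shows "N = M"
proof -
  interpret M: prob_space M using erg by (simp add: ergodic_prob_def invariant_prob_def)
  interpret N: prob_space N using inv by (simp add: invariant_prob_def)
  have space: "space N = space M" using sets by (rule sets_eq_imp_space_eq)
  have f[measurable]: "f \<in> measurable M M"
    using erg by (simp add: ergodic_prob_def invariant_prob_def)
  have fN: "f \<in> measurable N N" using inv by (simp add: invariant_prob_def)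
  define h where "h = RN_deriv M N"
  have h[measurable]: "h \<in> borel_measurable M" by (simp add: h_def)
  have dens: "N = density M h"
    unfolding h_def using M.density_RN_deriv[OF ac sets] by simp
  have emN: "emeasure N E = (\<integral>\<^sup>+x\<in>E. h x \<partial>M)" if "E \<in> sets M" for E
    using that dens emeasure_density[OF h that] by simp
  have le: "emeasure N E \<le> emeasure M E" if E: "E \<in> sets M" "AE x in M. x \<in> E \<longrightarrow> h x \<le> 1" for E
  proof -
    have "(\<integral>\<^sup>+x\<in>E. h x \<partial>M) \<le> (\<integral>\<^sup>+x. indicator E x \<partial>M)"
      using E(2) by (intro nn_integral_mono_AE) (auto simp: indicator_def)
    then show ?thesis using E emN by simp
  qed
  \<comment> \<open>On a part of \<open>{h > 1}\<close> where \<open>N\<close> does not exceed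
    \<open>M\<close>, the integral of \<open>h - 1\<close> vanishes, so that part is null.\<close>
  have gt: "emeasure M Q = 0" if Q: "Q \<in> sets M" "\<And>x. x \<in> Q \<Longrightarrow> h x > 1" "emeasure N Q \<le> emeasure M Q" for Q
  proof -
    note Q(1)[measurable]
    have "emeasure N Q = (\<integral>\<^sup>+x. (h x - 1) * indicator Q x + indicator Q x \<partial>M)"
      unfolding emN[OF Q(1)] using Q(2)
      by (intro nn_integral_cong) (auto simp: indicator_def diff_add_cancel_ennreal less_imp_le)
    also have "\<dots> = (\<integral>\<^sup>+x. (h x - 1) * indicator Q x \<partial>M) + emeasure M Q"
      by (subst nn_integral_add) auto
    finally have "(\<integral>\<^sup>+x. (h x - 1) * indicator Q x \<partial>M) + emeasure M Q \<le> emeasure M Q"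
      using Q(3) by simp
    then have "(\<integral>\<^sup>+x. (h x - 1) * indicator Q x \<partial>M) \<le> 0"
      using ennreal_add_left_cancel_le[of "emeasure M Q" _ 0] by (simp add: add.commute M.emeasure_finite)
    then have "AE x in M. (h x - 1) * indicator Q x = 0"
      by (subst nn_integral_0_iff_AE[symmetric]) auto
    then have "AE x in M. x \<notin> Q"
    proof eventually_elim
      case (elim x)
      then show ?case using Q(2)[of x] by (auto simp: indicator_def diff_eq_0_iff_ennreal)
    qed
    moreover have "{x\<in>space M. \<not> x \<notin> Q} = Q" using sets.sets_into_space[OF Q(1)] by auto
    ultimately show ?thesis using AE_iff_measurable[of Q M "\<lambda>x. x \<notin> Q"] Q(1) by simp
  qed
  define P where "P = {x\<in>space M. h x > 1}"
  define T where "T = f -` P \<inter> space M"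
  have P[measurable]: "P \<in> sets M" unfolding P_def by measurable
  have T[measurable]: "T \<in> sets M" unfolding T_def by measurable
  have TP: "emeasure M T = emeasure M P"
    using erg emeasure_distr[OF f P] by (simp add: ergodic_prob_def invariant_prob_def T_def)
  have TPN: "emeasure N T = emeasure N P"
    using inv emeasure_distr[OF fN, of P] P sets space by (simp add: invariant_prob_def T_def)
  have PN: "P \<in> sets N" "T \<in> sets N" using P T sets by auto
  have diffM: "measure M (P - T) = measure M (T - P)"
    using M.finite_measure_Diff'[OF P T] M.finite_measure_Diff'[OF T P] TP
    by (simp add: measure_def Int_commute)
  have diffN: "measure N (P - T) = measure N (T - P)"
    using N.finite_measure_Diff'[OF PN] N.finite_measure_Diff'[OF PN(2,1)] TPN
    by (simp add: measure_def Int_commute)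
  have "emeasure N (T - P) \<le> emeasure M (T - P)"
    by (intro le AE_I2) (auto simp: P_def)
  then have "emeasure N (P - T) \<le> emeasure M (P - T)"
    using diffM diffN by (simp add: M.emeasure_eq_measure N.emeasure_eq_measure)
  then have 0: "emeasure M (P - T) = 0" by (intro gt) (auto simp: P_def)
  then have 1: "emeasure M (T - P) = 0" using diffM by (simp add: M.emeasure_eq_measure)
  have "AE x in M. x \<notin> P - T" "AE x in M. x \<notin> T - P"
    using 0 1 by (intro AE_not_in null_setsI; simp)+
  then have "AE x in M. f x \<in> P \<longleftrightarrow> x \<in> P"
    using AE_space by eventually_elim (auto simp: T_def)
  then have "emeasure M P = 0 \<or> emeasure M P = 1" by (rule ergodic_almost_invariant[OF erg P])
  \<comment> \<open>If \<open>h > 1\<close> held almost everywhere, \<open>N\<close> would have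
    total mass above 1.\<close>
  moreover have "emeasure M P = 0" if "emeasure M P = 1"
    using that N.emeasure_le_1[of P] by (intro gt) (auto simp: P_def)
  ultimately have "emeasure M P = 0" by auto
  then have "AE x in M. x \<notin> P" by (auto intro!: AE_not_in null_setsI)
  then have h1: "AE x in M. h x \<le> 1"
    using AE_space by eventually_elim (auto simp: P_def not_less)
  have le': "measure N E \<le> measure M E" if "E \<in> sets M" for E
    using le[OF that] h1 by (simp add: M.emeasure_eq_measure N.emeasure_eq_measure eventually_mono)
  show ?thesis
  proof (rule measure_eqI[OF sets])
    fix E assume "E \<in> sets N"
    then have E: "E \<in> sets M" "E \<in> sets N" using sets by auto
    \<comment> \<open>Both measures have mass 1, so the one-sided inequality on the complement gives
      the other direction.\<close>
    have "measure N (space M - E) \<le> measure M (space M - E)" using E by (intro le') auto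
    then have "measure M E \<le> measure N E"
      using M.prob_compl[OF E(1)] N.prob_compl[OF E(2)] space by simp
    then show "emeasure N E = emeasure M E"
      using le'[OF E(1)] by (simp add: M.emeasure_eq_measure N.emeasure_eq_measure)
  qed
qed

text \<open>Average of the first \<open>k\<close> push-forwards of \<open>M\<close>, the usual
  passage from a measure invariant under \<open>f ^^ k\<close> to one invariant under
  \<open>f\<close>.\<close>

definition cesaro :: "'a measure \<Rightarrow> ('a \<Rightarrow> 'a) \<Rightarrow> nat \<Rightarrow> 'a measure" where
  "cesaro M f k = measure_of (space M) (sets M)
     (\<lambda>E. (\<Sum>j<k. emeasure M ((f ^^ j) -` E \<inter> space M)) / of_nat k)"

lemma sets_cesaro[simp]: "sets (cesaro M f k) = sets M"
  and space_cesaro[simp]: "space (cesaro M f k) = space M"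
  by (simp_all add: cesaro_def)

lemma measurable_funpow:
  assumes "f \<in> measurable M M"
  shows "f ^^ n \<in> measurable M M"
  using assms by (induction n) (auto intro: measurable_comp)

lemma emeasure_cesaro:
  assumes f: "f \<in> measurable M M" and E: "E \<in> sets M"
  shows "emeasure (cesaro M f k) E = (\<Sum>j<k. emeasure M ((f ^^ j) -` E \<inter> space M)) / of_nat k"
  unfolding cesaro_def
proof (rule emeasure_measure_of_sigma)
  let ?g = "\<lambda>E. (\<Sum>j<k. emeasure M ((f ^^ j) -` E \<inter> space M)) / of_nat k :: ennreal"
  note fn = measurable_funpow[OF f]
  show "countably_additive (sets M) ?g"
  proof (rule countably_additiveI)
    fix A :: "nat \<Rightarrow> 'a set"
    assume A: "range A \<subseteq> sets M" "disjoint_family A" "\<Union>(range A) \<in> sets M"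
    have *: "(\<Sum>i. emeasure M ((f ^^ j) -` A i \<inter> space M)) = emeasure M ((f ^^ j) -` \<Union>(range A) \<inter> space M)" for j
    proof -
      have "range (\<lambda>i. (f ^^ j) -` A i \<inter> space M) \<subseteq> sets M"
        using A(1) fn by (auto intro!: measurable_sets)
      moreover have "disjoint_family (\<lambda>i. (f ^^ j) -` A i \<inter> space M)"
        using A(2) by (auto simp: disjoint_family_on_def)
      ultimately have "(\<Sum>i. emeasure M ((f ^^ j) -` A i \<inter> space M)) =
          emeasure M (\<Union>i. (f ^^ j) -` A i \<inter> space M)" by (rule suminf_emeasure)
      also have "(\<Union>i. (f ^^ j) -` A i \<inter> space M) = (f ^^ j) -` \<Union>(range A) \<inter> space M" by auto
      finally show ?thesis .
    qed
    have "(\<Sum>i. ?g (A i)) = (\<Sum>i. \<Sum>j<k. emeasure M ((f ^^ j) -` A i \<inter> space M)) / of_nat k"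
      by (simp add: divide_ennreal_def ennreal_suminf_multc)
    also have "(\<Sum>i. \<Sum>j<k. emeasure M ((f ^^ j) -` A i \<inter> space M)) =
        (\<Sum>j<k. \<Sum>i. emeasure M ((f ^^ j) -` A i \<inter> space M))"
      by (intro suminf_sum) auto
    finally show "(\<Sum>i. ?g (A i)) = ?g (\<Union>(range A))" by (simp only: *)
  qed
qed (use E in \<open>auto simp: positive_def sets.sigma_algebra_axioms\<close>)

text \<open>The averages telescope because \<open>f ^^ k\<close> preserves \<open>M\<close>.\<close>

lemma invariant_prob_cesaro:
  assumes f: "f \<in> measurable M M" and k: "1 \<le> k" and inv: "invariant_prob M (f ^^ k)"
  shows "invariant_prob (cesaro M f k) f"
proof -
  interpret M: prob_space M using inv by (simp add: invariant_prob_def)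
  note fn = measurable_funpow[OF f]
  have k0: "of_nat k \<noteq> (0::ennreal)" "of_nat k < (\<top>::ennreal)"
    using k by (auto simp: of_nat_less_top)
  have "(f ^^ j) -` space M \<inter> space M = space M" for j
    using measurable_space[OF fn] by auto
  then have "emeasure (cesaro M f k) (space M) = 1"
    using emeasure_cesaro[OF f sets.top, of k] k0 by (simp add: M.emeasure_space_1 ennreal_divide_self)
  then have 1: "prob_space (cesaro M f k)" by (intro prob_spaceI) simp
  have 2: "f \<in> measurable (cesaro M f k) (cesaro M f k)"
    using f by (simp cong: measurable_cong_sets)
  have "distr (cesaro M f k) (cesaro M f k) f = cesaro M f k"
  proof (rule measure_eqI)
    fix E assume "E \<in> sets (distr (cesaro M f k) (cesaro M f k) f)"
    then have E: "E \<in> sets M" by simp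
    let ?g = "\<lambda>j. emeasure M ((f ^^ j) -` E \<inter> space M)"
    have fE: "f -` E \<inter> space M \<in> sets M" using measurable_sets[OF f E] .
    have "(f ^^ j) -` (f -` E \<inter> space M) \<inter> space M = (f ^^ Suc j) -` E \<inter> space M" for j
      using measurable_space[OF fn] by auto
    then have a: "emeasure (cesaro M f k) (f -` E \<inter> space M) = (\<Sum>j<k. ?g (Suc j)) / of_nat k"
      using emeasure_cesaro[OF f fE, of k] by simp
    have "emeasure (distr M M (f ^^ k)) E = emeasure M E" using inv by (simp add: invariant_prob_def)
    then have "?g k = emeasure M E" using emeasure_distr[OF fn E] by simp
    also have "emeasure M E = ?g 0" using sets.sets_into_space[OF E] by (simp add: Int_absorb2)
    finally have gk: "?g k = ?g 0" .
    have "?g 0 + (\<Sum>j<k. ?g (Suc j)) = (\<Sum>j<Suc k. ?g j)"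
      by (simp only: sum.lessThan_Suc_shift)
    also have "\<dots> = ?g 0 + (\<Sum>j<k. ?g j)" by (simp only: sum.lessThan_Suc gk add.commute)
    finally have "(\<Sum>j<k. ?g (Suc j)) = (\<Sum>j<k. ?g j)"
      by (subst (asm) ennreal_add_left_cancel) (auto simp: M.emeasure_finite)
    then show "emeasure (distr (cesaro M f k) (cesaro M f k) f) E = emeasure (cesaro M f k) E"
      using emeasure_distr[OF 2, of E] a emeasure_cesaro[OF f E, of k] E by simp
  qed simp
  then show ?thesis using 1 2 by (simp add: invariant_prob_def)
qed

text \<open>The complement of the support is a union of null open sets, and by second countability
  countably many of them suffice.\<close>

lemma null_outside_support:
  fixes N :: "'a::second_countable_topology measure"
  assumes S: "sets N = sets (restrict_space borel X)" and X: "X \<in> sets borel"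
  shows "measure_support N \<in> sets N" "space N - measure_support N \<in> null_sets N"
proof -
  have sp: "space N = X" using sets_eq_imp_space_eq[OF S] by (simp add: space_restrict_space)
  let ?F = "{U. open U \<and> emeasure N (U \<inter> space N) = 0}"
  have opn: "U \<inter> space N \<in> sets N" if "open U" for U
    using that X S sp by (auto simp: sets_restrict_space_iff)
  have eq: "space N - measure_support N = \<Union>?F \<inter> space N"
    by (auto simp: measure_support_def zero_less_iff_neq_zero)
  have "\<And>U. U \<in> ?F \<Longrightarrow> open U" by simp
  then obtain G where G: "G \<subseteq> ?F" "countable G" "\<Union>G = \<Union>?F"
    by (rule Lindelof)
  have "(\<Union>U\<in>G. U \<inter> space N) \<in> null_sets N"
    using G opn by (intro null_sets_UN') (auto intro!: null_setsI)
  moreover have "(\<Union>U\<in>G. U \<inter> space N) = \<Union>?F \<inter> space N" using G(3) by auto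
  ultimately show 1: "space N - measure_support N \<in> null_sets N" using eq by simp
  have "measure_support N = space N - (space N - measure_support N)"
    by (auto simp: measure_support_def)
  then show "measure_support N \<in> sets N" using 1 by (metis null_setsD2 sets.compl_sets)
qed

lemma emeasure_affine_vimage:
  fixes c t :: real
  assumes "c \<noteq> 0" "A \<in> sets borel"
  shows "emeasure lborel A = ennreal \<bar>c\<bar> * emeasure lborel ((\<lambda>x. t + c * x) -` A)"
proof -
  have "emeasure lborel A = emeasure (density (distr lborel borel (\<lambda>x. t + c * x)) (\<lambda>_. ennreal \<bar>c\<bar>)) A"
    using lborel_real_affine[OF assms(1), of t] by simp
  also have "\<dots> = ennreal \<bar>c\<bar> * emeasure (distr lborel borel (\<lambda>x. t + c * x)) A"
    using assms(2) by (subst emeasure_density_const) auto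
  also have "emeasure (distr lborel borel (\<lambda>x. t + c * x)) A = emeasure lborel ((\<lambda>x. t + c * x) -` A)"
    using assms(2) by (subst emeasure_distr) auto
  finally show ?thesis .
qed

section \<open>Piecewise linear expanding maps\<close>

text \<open>One slope \<open>- a\<close> serves all pieces of the slap map: a base is stretched onto
  a cap by \<open>a\<close>, and on a cap with parameter \<open>a * y\<close> the coefficient
  \<open>a\<^sup>2\<close> of \<open>y\<close> leaves \<open>a\<close> again. At the break points
  only \<open>range\<close> is imposed, since the values there are arbitrary.\<close>

locale piecewise_linear =
  fixes f :: "real \<Rightarrow> real" and L a :: real and P q :: "nat \<Rightarrow> real" and m :: nat
  assumes P_0: "P 0 = 0" and P_m: "P m = L" and P_less: "\<And>j. j < m \<Longrightarrow> P j < P (Suc j)"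
    and m_pos: "0 < m" and a: "1 < a"
    and affine: "\<And>j s. j < m \<Longrightarrow> P j < s \<Longrightarrow> s < P (Suc j) \<Longrightarrow> f s = - a * s + q j"
    and range: "\<And>s. s \<in> {0..L} \<Longrightarrow> f s \<in> {0..L}"
begin

definition Z :: "real set" where "Z = P ` {..m}"

abbreviation B :: "real measure" where "B \<equiv> restrict_space borel {0..L}"

lemma finite_Z: "finite Z" by (simp add: Z_def)

lemma P_mono: "i \<le> j \<Longrightarrow> j \<le> m \<Longrightarrow> P i \<le> P j"
proof (induction j)
  case (Suc j)
  then show ?case using P_less[of j] by (cases "i = Suc j") (auto intro: less_imp_le order_trans)
qed simp

lemma piece_subset: "j < m \<Longrightarrow> {P j<..<P (Suc j)} \<subseteq> {0..L}"
  using P_mono[of 0 j] P_mono[of "Suc j" m] P_0 P_m by auto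

lemma piece_cases:
  assumes "s \<in> {0..L}"
  obtains "s \<in> Z" | j where "j < m" "P j < s" "s < P (Suc j)"
proof -
  have "\<exists>j<m. P j \<le> s \<and> s < P (Suc j)" if "s < P i" "i \<le> m" for i
    using that
  proof (induction i)
    case 0
    then show ?case using assms P_0 by auto
  next
    case (Suc i)
    show ?case
    proof (cases "s < P i")
      case True
      then show ?thesis using Suc by auto
    next
      case False
      then show ?thesis using Suc.prems by (intro exI[of _ i]) auto
    qed
  qed
  from this[of m] have "s < L \<Longrightarrow> (\<exists>j<m. P j \<le> s \<and> s < P (Suc j))"
    using P_m by simp
  then have "s = L \<or> (\<exists>j<m. P j \<le> s \<and> s < P (Suc j))"
    using assms by force
  then show thesis
  proof
    assume "s = L"
    then show thesis using that(1) P_m by (auto simp: Z_def)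
  next
    assume "\<exists>j<m. P j \<le> s \<and> s < P (Suc j)"
    then obtain j where j: "j < m" "P j \<le> s" "s < P (Suc j)" by auto
    then show thesis using that(1) that(2)[of j] by (cases "P j = s") (auto simp: Z_def)
  qed
qed

lemma sets_B: "A \<in> sets B \<longleftrightarrow> A \<in> sets borel \<and> A \<subseteq> {0..L}"
  by (auto simp: sets_restrict_space_iff)

lemma range_funpow: "s \<in> {0..L} \<Longrightarrow> (f ^^ j) s \<in> {0..L}"
  by (induction j) (auto simp: range simp del: atLeastAtMost_iff)

lemma vimage_eq:
  "f -` E \<inter> {0..L} = (\<Union>j<m. {P j<..<P (Suc j)} \<inter> (\<lambda>s. q j + (- a) * s) -` E) \<union> (Z \<inter> {0..L} \<inter> f -` E)"
proof (intro set_eqI iffI)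
  fix s assume s: "s \<in> f -` E \<inter> {0..L}"
  then have "s \<in> {0..L}" by simp
  then show "s \<in> (\<Union>j<m. {P j<..<P (Suc j)} \<inter> (\<lambda>s. q j + (- a) * s) -` E) \<union> (Z \<inter> {0..L} \<inter> f -` E)"
    using s by (cases rule: piece_cases) (auto simp: affine)
next
  fix s assume "s \<in> (\<Union>j<m. {P j<..<P (Suc j)} \<inter> (\<lambda>s. q j + (- a) * s) -` E) \<union> (Z \<inter> {0..L} \<inter> f -` E)"
  then show "s \<in> f -` E \<inter> {0..L}" using piece_subset by (force simp: affine)
qed

text \<open>Written through preimages under the inverse branches, images of Borel sets are Borel and
  images of null sets are null. The levels of the tower are images of its base, so both facts are
  needed.\<close>

lemma image_eq:
  assumes "A \<subseteq> {0..L}"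
  shows "f ` A = (\<Union>j<m. (\<lambda>y. q j / a + (- 1 / a) * y) -` ({P j<..<P (Suc j)} \<inter> A)) \<union> f ` (A \<inter> Z)"
proof (intro set_eqI iffI)
  fix y assume "y \<in> f ` A"
  then obtain s where s: "s \<in> A" "y = f s" by auto
  then have "s \<in> {0..L}" using assms by auto
  then show "y \<in> (\<Union>j<m. (\<lambda>y. q j / a + (- 1 / a) * y) -` ({P j<..<P (Suc j)} \<inter> A)) \<union> f ` (A \<inter> Z)"
  proof (cases rule: piece_cases)
    case (2 j)
    then have "q j / a + (- 1 / a) * y = s" using s a by (simp add: affine field_simps)
    then have "y \<in> (\<lambda>y. q j / a + (- 1 / a) * y) -` ({P j<..<P (Suc j)} \<inter> A)" using 2 s by simp
    then show ?thesis using 2(1) by blast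
  qed (use s in auto)
next
  fix y assume "y \<in> (\<Union>j<m. (\<lambda>y. q j / a + (- 1 / a) * y) -` ({P j<..<P (Suc j)} \<inter> A)) \<union> f ` (A \<inter> Z)"
  then consider j where "j < m" "q j / a + (- 1 / a) * y \<in> {P j<..<P (Suc j)} \<inter> A" | "y \<in> f ` (A \<inter> Z)" by auto
  then show "y \<in> f ` A"
  proof cases
    case (1 j)
    then have "f (q j / a + (- 1 / a) * y) = y" using a by (subst affine[of j]) (auto simp: field_simps)
    then show ?thesis using 1 by (metis IntD2 image_eqI)
  qed auto
qed

lemma finite_borel: "finite (A :: real set) \<Longrightarrow> A \<in> sets borel"
  by (intro borel_closed finite_imp_closed)

lemma measurable_f: "f \<in> measurable B B"
proof (rule measurableI)
  fix A assume A: "A \<in> sets B"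
  have *: "(\<lambda>s. q j + (- a) * s) -` A \<in> sets borel" for j
    using measurable_sets[of "\<lambda>s. q j + (- a) * s" borel borel A] A sets_B by auto
  moreover have "Z \<inter> {0..L} \<inter> f -` A \<in> sets borel" using finite_Z by (intro finite_borel) auto
  moreover have "(\<Union>j<m. {P j<..<P (Suc j)} \<inter> (\<lambda>s. q j + (- a) * s) -` A) \<in> sets borel"
    by (intro sets.finite_UN sets.Int *) auto
  ultimately have "f -` A \<inter> {0..L} \<in> sets borel"
    unfolding vimage_eq by (intro sets.Un)
  then show "f -` A \<inter> space B \<in> sets B" by (auto simp: sets_B space_restrict_space)
qed (use range in \<open>auto simp: space_restrict_space\<close>)

lemma borel_image:
  assumes "A \<in> sets B"
  shows "f ` A \<in> sets B"
proof -
  have A: "A \<subseteq> {0..L}" "A \<in> sets borel" using assms sets_B by auto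
  have "(\<lambda>y. q j / a + (- 1 / a) * y) -` ({P j<..<P (Suc j)} \<inter> A) \<in> sets borel" for j
    using measurable_sets[of "\<lambda>y. q j / a + (- 1 / a) * y" borel borel "{P j<..<P (Suc j)} \<inter> A"] A by auto
  moreover have "f ` (A \<inter> Z) \<in> sets borel" using finite_Z by (intro finite_borel) auto
  ultimately have "f ` A \<in> sets borel"
    unfolding image_eq[OF A(1)] by (intro sets.Un sets.finite_UN) auto
  then show ?thesis using A range by (auto simp: sets_B simp del: atLeastAtMost_iff)
qed

lemma null_affine_vimage:
  fixes c t :: real
  assumes "c \<noteq> 0" "A \<in> null_sets lborel"
  shows "(\<lambda>x. t + c * x) -` A \<in> null_sets lborel"
proof (rule null_setsI)
  have A: "A \<in> sets borel" using assms(2) by auto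
  show "emeasure lborel ((\<lambda>x. t + c * x) -` A) = 0"
    using emeasure_affine_vimage[OF assms(1) A, of t] assms by auto
  show "(\<lambda>x. t + c * x) -` A \<in> sets lborel"
    using measurable_sets[of "\<lambda>x. t + c * x" borel borel A] A by auto
qed

lemma null_image:
  assumes "A \<in> null_sets lborel" "A \<subseteq> {0..L}"
  shows "f ` A \<in> null_sets lborel"
proof -
  have "(\<lambda>y. q j / a + (- 1 / a) * y) -` ({P j<..<P (Suc j)} \<inter> A) \<in> null_sets lborel" for j
    using a assms by (intro null_affine_vimage null_set_Int1) auto
  moreover have "f ` (A \<inter> Z) \<in> null_sets lborel"
    using finite_Z by (intro finite_imp_null_set_lborel) auto
  ultimately show ?thesis unfolding image_eq[OF assms(2)] by (intro null_sets.Un null_sets.finite_UN) auto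
qed

lemma null_vimage:
  assumes "A \<in> null_sets lborel"
  shows "f -` A \<inter> {0..L} \<in> null_sets lborel"
proof -
  have "{P j<..<P (Suc j)} \<inter> (\<lambda>s. q j + (- a) * s) -` A \<in> null_sets lborel" for j
    using a assms by (intro null_set_Int1 null_affine_vimage) auto
  moreover have "Z \<inter> {0..L} \<inter> f -` A \<in> null_sets lborel"
    using finite_Z by (intro finite_imp_null_set_lborel) auto
  ultimately show ?thesis unfolding vimage_eq by (intro null_sets.Un null_sets.finite_UN) auto
qed

lemma countable_vimage:
  assumes "countable A"
  shows "countable (f -` A \<inter> {0..L})"
proof -
  have "countable ((\<lambda>s. q j + (- a) * s) -` A)" for j
  proof -
    have "(\<lambda>s. q j + (- a) * s) -` A \<subseteq> (\<lambda>y. (q j - y) / a) ` A"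
    proof
      fix s assume "s \<in> (\<lambda>s. q j + (- a) * s) -` A"
      then show "s \<in> (\<lambda>y. (q j - y) / a) ` A"
        using a by (intro image_eqI[of _ _ "q j + (- a) * s"]) auto
    qed
    moreover have "countable ((\<lambda>y. (q j - y) / a) ` A)" using assms by simp
    ultimately show ?thesis by (rule countable_subset)
  qed
  then have "countable (\<Union>j<m. {P j<..<P (Suc j)} \<inter> (\<lambda>s. q j + (- a) * s) -` A)"
    by (intro countable_UN countable_Int2) simp_all
  moreover have "countable (Z \<inter> {0..L} \<inter> f -` A)" using finite_Z by (simp add: countable_finite)
  ultimately show ?thesis unfolding vimage_eq by simp
qed

lemma countable_vimage_funpow: "countable A \<Longrightarrow> countable ((f ^^ j) -` A \<inter> {0..L})"
proof (induction j arbitrary: A)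
  case (Suc j)
  have "(f ^^ Suc j) -` A \<inter> {0..L} = (f ^^ j) -` (f -` A \<inter> {0..L}) \<inter> {0..L}"
    using range_funpow by auto
  then show ?case using Suc.IH[OF countable_vimage[OF Suc.prems]] by (simp only:)
qed simp

lemma null_vimage_funpow:
  "A \<in> null_sets lborel \<Longrightarrow> (f ^^ j) -` A \<inter> {0..L} \<in> null_sets lborel"
proof (induction j arbitrary: A)
  case (Suc j)
  have "(f ^^ Suc j) -` A \<inter> {0..L} = (f ^^ j) -` (f -` A \<inter> {0..L}) \<inter> {0..L}"
    using range_funpow by auto
  then show ?case using Suc.IH[OF null_vimage[OF Suc.prems]] by (simp only:)
qed (auto intro: null_set_Int2)

lemma null_image_funpow:
  assumes "A \<in> null_sets lborel" "A \<subseteq> {0..L}"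
  shows "(f ^^ j) ` A \<in> null_sets lborel"
proof (induction j)
  case (Suc j)
  have "(f ^^ j) ` A \<subseteq> {0..L}" using assms(2) range_funpow by blast
  then show ?case using null_image[OF Suc] by (simp add: image_image)
qed (simp add: assms)

lemma borel_image_funpow: "A \<in> sets B \<Longrightarrow> (f ^^ j) ` A \<in> sets B"
proof (induction j)
  case (Suc j)
  then show ?case using borel_image[of "(f ^^ j) ` A"] by (simp add: image_image)
qed simp

text \<open>An interval without break points lies in the piece that contains its midpoint.\<close>

lemma piecewise_expanding: "piecewise_expanding L f"
  unfolding piecewise_expanding_def
proof (intro conjI exI[of _ a] exI[of _ Z] allI impI finite_Z a ballI range)
  fix u v :: real assume uv: "u < v \<and> {u<..<v} \<subseteq> {0..L} - Z"
  let ?x = "(u + v) / 2"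
  have x: "?x \<in> {u<..<v}" using uv by auto
  then have "?x \<in> {0..L}" "?x \<notin> Z" using uv by blast+
  then obtain j where j: "j < m" "P j < ?x" "?x < P (Suc j)" by (metis piece_cases)
  have "P j \<in> Z" "P (Suc j) \<in> Z" using j by (auto simp: Z_def)
  then have "P j \<notin> {u<..<v}" "P (Suc j) \<notin> {u<..<v}" using uv by blast+
  then have "P j \<le> u" "v \<le> P (Suc j)" using x j by auto
  then have "\<forall>s\<in>{u<..<v}. - a * s + q j = f s" using affine[OF j(1)] by auto
  then show "\<exists>g g' g''. (\<forall>x\<in>{u<..<v}. g x = f x) \<and>
              (\<forall>x\<in>{u..v}. (g has_real_derivative g' x) (at x within {u..v}) \<and>
                            (g' has_real_derivative g'' x) (at x within {u..v}) \<and>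
                            a \<le> \<bar>g' x\<bar>) \<and>
              continuous_on {u..v} g''"
    using a by (intro exI[of _ "\<lambda>s. - a * s + q j"] exI[of _ "\<lambda>_. - a"] exI[of _ "\<lambda>_. 0"])
      (auto intro!: derivative_eq_intros)
qed

end

section \<open>Towers over the doubling map\<close>

lemma funpow_funpow: "(f ^^ i) ((f ^^ j) x) = (f ^^ (i + j)) x"
  by (simp add: funpow_add)

text \<open>The base \<open>J\<close> is an interval minus a countable set, so that the
  \<open>k\<close>-th iterate is the doubling map, up to scaling, at every remaining point. By
  \<open>period\<close> no point of \<open>J\<close> is in \<open>J\<close> at a time that is not a
  multiple of \<open>k\<close>; this makes the levels of the tower disjoint.\<close>

locale doubling_tower = piecewise_linear +
  fixes k :: nat and b e :: real and N J :: "real set"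
  assumes k: "1 \<le> k" and e: "0 < e" and N: "countable N"
    and J_range: "{b - e<..<b + e} \<subseteq> {0..L}"
    and J_def: "J = {b - e<..<b + e} - N"
    and ret: "\<And>s. s \<in> J \<Longrightarrow> (f ^^ k) s \<in> J"
    and ret_eq: "\<And>s. s \<in> J \<Longrightarrow> (f ^^ k) s = b + 2 * (s - b) - e * sgn (s - b)"
    and centre: "b \<in> N"
    and period: "\<And>s l. s \<in> J \<Longrightarrow> (f ^^ l) s \<in> J \<Longrightarrow> k dvd l"
begin

text \<open>Rescales the interval to (0, 1), where the return map becomes
  \<open>frac (2 * x)\<close>.\<close>

definition \<phi> :: "real \<Rightarrow> real" where "\<phi> s = (s - b + e) / (2 * e)"

definition U :: "real measure" where "U = uniform_measure (restrict_space lborel {0..L}) J"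

lemma J_borel: "J \<in> sets borel" 
proof -
  have "N \<in> sets borel" using N by (rule sets.countable[rotated]) simp
  then show ?thesis unfolding J_def by simp
qed

lemma J_sub: "J \<subseteq> {0..L}" using J_range J_def by auto

lemma N_null: "A \<subseteq> N \<Longrightarrow> A \<in> null_sets lborel"
  using N by (auto intro: countable_imp_null_set_lborel countable_subset)

lemma emeasure_J: "emeasure lborel J = ennreal (2 * e)"
proof -
  have "emeasure lborel J = emeasure lborel {b - e<..<b + e}"
    unfolding J_def using N_null[of N] by (intro emeasure_Diff_null_set) auto
  then show ?thesis using e by simp
qed

lemma finite_in_J: assumes "A \<subseteq> J" "A \<in> sets borel" shows "emeasure lborel A \<noteq> \<infinity>"
proof -
  have "emeasure lborel A \<le> ennreal (2 * e)" using emeasure_mono[OF assms(1), of lborel] J_borel emeasure_J by simp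
  then show ?thesis by (auto simp: top_unique)
qed

lemma phi_J: "s \<in> J \<Longrightarrow> 0 < \<phi> s \<and> \<phi> s < 1"
  using e by (auto simp: J_def \<phi>_def field_simps)

lemma phi_step: assumes "s \<in> J" shows "\<phi> ((f ^^ k) s) = frac (2 * \<phi> s)"
proof -
  have "s \<noteq> b" using assms centre by (auto simp: J_def)
  then consider "s < b" | "s > b" by linarith
  then show ?thesis
  proof cases
    case 1
    then have "\<phi> ((f ^^ k) s) = 2 * \<phi> s"
      using e unfolding ret_eq[OF assms] \<phi>_def by (simp add: field_simps)
    moreover have "2 * \<phi> s < 1" using 1 e by (simp add: \<phi>_def field_simps)
    ultimately show ?thesis using phi_J[OF assms] by (simp add: frac_eq)
  next
    case 2
    then have 3: "\<phi> ((f ^^ k) s) = 2 * \<phi> s - 1"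
      using e unfolding ret_eq[OF assms] \<phi>_def by (simp add: field_simps)
    moreover have "0 < \<phi> ((f ^^ k) s) \<and> \<phi> ((f ^^ k) s) < 1" using phi_J ret assms by auto
    ultimately show ?thesis by (auto simp: frac_unique_iff intro!: frac_unique_iff[THEN iffD2, symmetric])
  qed
qed

lemma frac_double: "frac (2 * frac x) = frac (2 * (x::real))"
proof -
  have "2 * x - frac (2 * frac x) = of_int (2 * \<lfloor>x\<rfloor> + \<lfloor>2 * frac x\<rfloor>)"
    by (simp add: frac_def)
  then have "2 * x - frac (2 * frac x) \<in> \<int>" by (metis Ints_of_int)
  then show ?thesis using frac_unique_iff[of "2 * x" "frac (2 * frac x)"]
      frac_lt_1[of "2 * frac x"] by simp
qed

lemma iter: assumes "s \<in> J" shows "(f ^^ (k * j)) s \<in> J" "\<phi> ((f ^^ (k * j)) s) = frac (2 ^ j * \<phi> s)"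
proof (induction j)
  case 0
  case 1 show ?case using assms by simp
  case 2 show ?case using phi_J[OF assms] by (simp add: frac_eq)
next
  case (Suc j)
  have *: "(f ^^ (k * Suc j)) s = (f ^^ k) ((f ^^ (k * j)) s)" by (simp add: funpow_add)
  case 1 show ?case unfolding * using ret Suc by auto
  case 2 show ?case unfolding * phi_step[OF Suc(1)] Suc(2) frac_double by (simp add: mult.assoc)
qed

lemma vimage_iter_borel:
  assumes "C \<in> sets borel" shows "(f ^^ j) -` C \<inter> {0..L} \<in> sets borel"
proof -
  have "(f ^^ j) -` (C \<inter> {0..L}) \<inter> {0..L} \<in> sets B"
    using measurable_sets[OF measurable_funpow[OF measurable_f, of j], of "C \<inter> {0..L}"] assms
    by (auto simp: sets_B space_restrict_space)
  moreover have "(f ^^ j) -` (C \<inter> {0..L}) \<inter> {0..L} = (f ^^ j) -` C \<inter> {0..L}"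
    using range_funpow by auto
  ultimately show ?thesis by (simp add: sets_B)
qed

lemma JC_borel: assumes "C \<in> sets borel" shows "{s\<in>J. (f ^^ j) s \<in> C} \<in> sets borel"
proof -
  have "{s\<in>J. (f ^^ j) s \<in> C} = J \<inter> ((f ^^ j) -` C \<inter> {0..L})" using J_sub by auto
  then show ?thesis using J_borel vimage_iter_borel[OF assms] by simp
qed

text \<open>On a dyadic interval of level \<open>j\<close> the iterate \<open>f ^^ (k * j)\<close> is affine with slope \<open>2 ^ j\<close>
  onto the whole base.\<close>

lemma dyadic_piece:
  fixes p :: nat
  assumes C: "C \<in> sets borel" and p: "p < 2 ^ j"
  shows "measure lborel {s\<in>J. (f ^^ (k * j)) s \<in> C \<and> real p < 2 ^ j * \<phi> s \<and> 2 ^ j * \<phi> s \<le> real p + 1}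
    = measure lborel (J \<inter> C) / 2 ^ j"
    (is "measure lborel ?A = _")
proof -
  \<comment> \<open>\<open>?T\<close> is the affine extension of the \<open>p\<close>-th branch of
    \<open>f ^^ (k * j)\<close>; the constant is solved from
    \<open>\<phi> (?T s) = 2 ^ j * \<phi> s - real p\<close>.\<close>
  define t where "t = (b - e) + 2 ^ j * (e - b) - 2 * e * real p"
  let ?T = "\<lambda>s. t + 2 ^ j * s"
  have T: "\<phi> (?T s) = 2 ^ j * \<phi> s - real p" for s
    using e by (simp add: t_def \<phi>_def field_simps)
  have phi_inj: "\<phi> x = \<phi> y \<Longrightarrow> x = y" for x y using e by (simp add: \<phi>_def)
  have 1: "?A \<subseteq> ?T -` (J \<inter> C)"
  proof
    fix s assume s: "s \<in> ?A"
    then have s': "s \<in> J" by simp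
    note it = iter[OF s', of j]
    have fr: "frac (2 ^ j * \<phi> s) > 0" using it phi_J[OF it(1)] by simp
    have ni: "2 ^ j * \<phi> s \<noteq> real p + 1"
    proof
      assume "2 ^ j * \<phi> s = real p + 1"
      then have "2 ^ j * \<phi> s = of_int (int p + 1)" by simp
      then have "frac (2 ^ j * \<phi> s) = 0" by (simp only: frac_of_int)
      then show False using fr by simp
    qed
    then have "\<lfloor>2 ^ j * \<phi> s\<rfloor> = int p" using s by (intro floor_unique) auto
    then have "frac (2 ^ j * \<phi> s) = 2 ^ j * \<phi> s - real p" by (simp add: frac_def)
    then have "\<phi> ((f ^^ (k * j)) s) = \<phi> (?T s)" unfolding it(2) T .
    then have "(f ^^ (k * j)) s = ?T s" by (rule phi_inj)
    then show "s \<in> ?T -` (J \<inter> C)" using s it by simp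
  qed
  \<comment> \<open>Exceptional points are missing from \<open>J\<close>, so the converse inclusion
    is claimed only off the null set \<open>N\<close>.\<close>
  have 2: "?T -` (J \<inter> C) - N \<subseteq> ?A"
  proof
    fix s assume s: "s \<in> ?T -` (J \<inter> C) - N"
    then have "?T s \<in> J" by simp
    then have u: "0 < 2 ^ j * \<phi> s - real p" "2 ^ j * \<phi> s - real p < 1" using phi_J[of "?T s"] T by auto
    have "0 < 2 ^ j * \<phi> s" using u by linarith
    then have u0: "0 < \<phi> s" by (simp add: zero_less_mult_iff)
    have "real (Suc p) \<le> real (2 ^ j)" using p by (intro of_nat_mono) simp
    then have "real p + 1 \<le> 2 ^ j" by simp
    then have "2 ^ j * \<phi> s < 2 ^ j * 1" using u by linarith
    then have "\<phi> s < 1" by (subst (asm) mult_less_cancel_left_pos) auto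
    then have J: "s \<in> J" using u0 e s by (auto simp: J_def \<phi>_def field_simps)
    note it = iter[OF J, of j]
    have "\<lfloor>2 ^ j * \<phi> s\<rfloor> = int p" using u by (intro floor_unique) auto
    then have "frac (2 ^ j * \<phi> s) = 2 ^ j * \<phi> s - real p" by (simp add: frac_def)
    then have "\<phi> ((f ^^ (k * j)) s) = \<phi> (?T s)" unfolding it(2) T .
    then have "(f ^^ (k * j)) s = ?T s" by (rule phi_inj)
    then show "s \<in> ?A" using s J u by simp
  qed
  have JC: "J \<inter> C \<in> sets borel" using J_borel C by simp
  have TJC: "?T -` (J \<inter> C) \<in> sets borel" using measurable_sets[of ?T borel borel "J \<inter> C"] JC by auto
  have Abor: "?A \<in> sets borel"
  proof -
    have "?A = {s\<in>J. (f ^^ (k * j)) s \<in> C} \<inter> \<phi> -` {x. real p < 2 ^ j * x \<and> 2 ^ j * x \<le> real p + 1}" by auto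
    moreover have "\<phi> -` {x. real p < 2 ^ j * x \<and> 2 ^ j * x \<le> real p + 1} \<in> sets borel"
      unfolding \<phi>_def vimage_def mem_Collect_eq by measurable
    ultimately show ?thesis using JC_borel[OF C] by simp
  qed
  have "measure lborel ?A = measure lborel (?T -` (J \<inter> C))"
  proof -
    have "emeasure lborel (?T -` (J \<inter> C) - N) \<le> emeasure lborel ?A" using 2 Abor by (intro emeasure_mono) auto
    moreover have "emeasure lborel (?T -` (J \<inter> C) - N) = emeasure lborel (?T -` (J \<inter> C))"
      using TJC N_null[of N] by (intro emeasure_Diff_null_set) auto
    moreover have "emeasure lborel ?A \<le> emeasure lborel (?T -` (J \<inter> C))" using 1 TJC by (intro emeasure_mono) auto
    ultimately show ?thesis by (simp add: measure_def)
  qed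
  moreover have "measure lborel (J \<inter> C) = 2 ^ j * measure lborel (?T -` (J \<inter> C))"
    using emeasure_affine_vimage[of "2 ^ j" "J \<inter> C" t] JC by (simp add: measure_def enn2real_mult)
  ultimately show ?thesis by simp
qed

lemma dyadic_prefix:
  assumes C: "C \<in> sets borel" and p: "p \<le> 2 ^ j"
  shows "measure lborel {s\<in>J. (f ^^ (k * j)) s \<in> C \<and> 2 ^ j * \<phi> s \<le> real p}
    = real p * measure lborel (J \<inter> C) / 2 ^ j"
  using p
proof (induction p)
  case 0
  have "{s\<in>J. (f ^^ (k * j)) s \<in> C \<and> 2 ^ j * \<phi> s \<le> real 0} = {}"
    using phi_J by (force simp: mult_le_0_iff not_le)
  then show ?case by (simp only: measure_empty)
next
  case (Suc p)
  let ?X = "\<lambda>R. {s\<in>J. (f ^^ (k * j)) s \<in> C \<and> R (2 ^ j * \<phi> s)}"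
  have bor: "?X R \<in> sets borel" if "{x. R x} \<in> sets borel" for R
  proof -
    have "?X R = {s\<in>J. (f ^^ (k * j)) s \<in> C} \<inter> (\<lambda>s. 2 ^ j * \<phi> s) -` {x. R x}" by auto
    moreover have "(\<lambda>s. 2 ^ j * \<phi> s) -` {x. R x} \<in> sets borel"
      using measurable_sets[of "\<lambda>s. 2 ^ j * \<phi> s" borel borel "{x. R x}"] that by (simp add: \<phi>_def)
    ultimately show ?thesis using JC_borel[OF C] by simp
  qed
  have b1: "?X (\<lambda>x. x \<le> real p) \<in> sets borel" by (intro bor) measurable
  have b2: "?X (\<lambda>x. real p < x \<and> x \<le> real p + 1) \<in> sets borel" by (intro bor) measurable
  have "?X (\<lambda>x. x \<le> real (Suc p)) = ?X (\<lambda>x. x \<le> real p) \<union> ?X (\<lambda>x. real p < x \<and> x \<le> real p + 1)" by auto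
  moreover have "measure lborel (?X (\<lambda>x. x \<le> real p) \<union> ?X (\<lambda>x. real p < x \<and> x \<le> real p + 1)) =
    measure lborel (?X (\<lambda>x. x \<le> real p)) + measure lborel (?X (\<lambda>x. real p < x \<and> x \<le> real p + 1))"
    using b1 b2 finite_in_J[OF _ b1] finite_in_J[OF _ b2] by (intro measure_Union) auto
  ultimately show ?case using Suc dyadic_piece[OF C, of p j] by (simp add: add_divide_distrib distrib_right)
qed

lemma measure_iter:
  assumes C: "C \<in> sets borel"
  shows "measure lborel {s\<in>J. (f ^^ (k * j)) s \<in> C} = measure lborel (J \<inter> C)"
proof -
  have "{s\<in>J. (f ^^ (k * j)) s \<in> C \<and> 2 ^ j * \<phi> s \<le> real (2 ^ j)} = {s\<in>J. (f ^^ (k * j)) s \<in> C}"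
    using phi_J by (auto simp: less_imp_le)
  then show ?thesis using dyadic_prefix[OF C, of "2 ^ j" j] by simp
qed

lemma space_U: "space U = {0..L}" and sets_U: "sets U = sets B"
  by (auto simp: U_def space_restrict_space sets_restrict_space)

lemma emeasure_U:
  assumes "E \<in> sets B"
  shows "emeasure U E = ennreal (measure lborel (J \<inter> E) / (2 * e))"
proof -
  have E: "E \<in> sets borel" "E \<subseteq> {0..L}" using assms sets_B by auto
  have JB: "J \<in> sets B" using J_borel J_sub sets_B by auto
  have "emeasure U E = emeasure (restrict_space lborel {0..L}) (J \<inter> E) / emeasure (restrict_space lborel {0..L}) J"
    unfolding U_def using JB assms by (intro emeasure_uniform_measure) (auto simp: sets_restrict_space)
  also have "emeasure (restrict_space lborel {0..L}) (J \<inter> E) = emeasure lborel (J \<inter> E)"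
    using J_sub by (intro emeasure_restrict_space) auto
  also have "emeasure (restrict_space lborel {0..L}) J = emeasure lborel J"
    using J_sub by (intro emeasure_restrict_space) auto
  also have "emeasure lborel (J \<inter> E) / emeasure lborel J = ennreal (measure lborel (J \<inter> E)) / ennreal (2 * e)"
    using finite_in_J[of "J \<inter> E"] J_borel E emeasure_J by (simp add: emeasure_eq_ennreal_measure)
  also have "\<dots> = ennreal (measure lborel (J \<inter> E) / (2 * e))"
    using e by (simp add: divide_ennreal)
  finally show ?thesis .
qed

lemma measure_J: "measure lborel J = 2 * e" using emeasure_J e by (simp add: measure_def)

lemma measurable_fn: "f ^^ j \<in> measurable B B" by (rule measurable_funpow[OF measurable_f])

lemma measurable_U: "f ^^ j \<in> measurable U U"
  using measurable_fn[of j] sets_U by (simp cong: measurable_cong_sets)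

lemma invariant_U: "invariant_prob U (f ^^ k)"
  unfolding invariant_prob_def
proof (intro conjI measurable_U)
  have "emeasure U (space U) = 1"
    using emeasure_U[of "{0..L}"] e measure_J J_sub by (simp add: space_U sets_B Int_absorb2)
  then show "prob_space U" by (rule prob_spaceI)
  show "distr U U (f ^^ k) = U"
  proof (rule measure_eqI)
    fix E assume "E \<in> sets (distr U U (f ^^ k))"
    then have E: "E \<in> sets B" using sets_U by simp
    then have Eb: "E \<in> sets borel" using sets_B by simp
    have vE: "(f ^^ k) -` E \<inter> {0..L} \<in> sets B" using vimage_iter_borel[OF Eb] by (auto simp: sets_B)
    have "J \<inter> ((f ^^ k) -` E \<inter> {0..L}) = {s\<in>J. (f ^^ (k * 1)) s \<in> E}" using J_sub by auto
    then have "emeasure U ((f ^^ k) -` E \<inter> {0..L}) = emeasure U E"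
      using emeasure_U[OF vE] emeasure_U[OF E] measure_iter[OF Eb, of 1] by simp
    then show "emeasure (distr U U (f ^^ k)) E = emeasure U E"
      using emeasure_distr[OF measurable_U, of E k] E sets_U space_U by simp
  qed simp
qed

text \<open>A tail set \<open>A\<close> occupies the same proportion of every dyadic interval, hence is
  independent of every Borel set, in particular of itself.\<close>

lemma tail_trivial:
  assumes "\<And>j. \<exists>C\<in>sets B. A = (f ^^ (k * j)) -` C \<inter> {0..L}"
  shows "emeasure U A = 0 \<or> emeasure U A = 1"
proof -
  have "\<exists>C\<in>sets B. A = (f ^^ (k * 0)) -` C \<inter> {0..L}" by fact
  then have A: "A \<in> sets B" using sets_B by (auto simp: Int_absorb2)
  then have Ab: "A \<in> sets borel" using sets_B by simp
  have JA: "J \<inter> A \<in> sets borel" using Ab J_borel by simp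
  define \<alpha> where "\<alpha> = measure lborel (J \<inter> A)"
  have a0: "0 \<le> \<alpha>" by (simp add: \<alpha>_def)
  \<comment> \<open>Writing \<open>A\<close> as a preimage under \<open>f ^^ (k * j)\<close> shows
    that it fills every initial segment of cells of level \<open>j\<close> in proportion to its
    length.\<close>
  have pre: "measure lborel {s\<in>J \<inter> A. 2 ^ j * \<phi> s \<le> real p} = real p * \<alpha> / 2 ^ j" if "p \<le> 2 ^ j" for j p
  proof -
    obtain C where C: "C \<in> sets B" "A = (f ^^ (k * j)) -` C \<inter> {0..L}" using assms by blast
    have Cb: "C \<in> sets borel" using C sets_B by simp
    have "{s\<in>J. (f ^^ (k * j)) s \<in> C} = J \<inter> A" using C J_sub by auto
    then have "measure lborel (J \<inter> C) = \<alpha>" using measure_iter[OF Cb, of j] by (simp add: \<alpha>_def)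
    moreover have "{s\<in>J. (f ^^ (k * j)) s \<in> C \<and> 2 ^ j * \<phi> s \<le> real p} = {s\<in>J \<inter> A. 2 ^ j * \<phi> s \<le> real p}"
      using C J_sub by auto
    ultimately show ?thesis using dyadic_prefix[OF Cb that] by simp
  qed
  have phib: "\<phi> \<in> borel_measurable borel" unfolding \<phi>_def by measurable
  have subb: "{s\<in>J \<inter> A. \<phi> s \<le> x} \<in> sets borel" for x
  proof -
    have "{s\<in>J \<inter> A. \<phi> s \<le> x} = (J \<inter> A) \<inter> \<phi> -` {..x}" by auto
    then show ?thesis using JA measurable_sets[OF phib, of "{..x}"] by simp
  qed
  have mono: "measure lborel {s\<in>J \<inter> A. \<phi> s \<le> x} \<le> measure lborel {s\<in>J \<inter> A. \<phi> s \<le> y}" if "x \<le> y" for x y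
    using that subb[of x] subb[of y] finite_in_J[OF _ subb[of y]]
    by (intro measure_mono_fmeasurable) (auto simp: fmeasurable_def less_top)
  \<comment> \<open>Monotonicity carries the proportion over from dyadic to arbitrary end points;
    the error at level \<open>j\<close> is at most the share of one cell.\<close>
  have G: "measure lborel {s\<in>J \<inter> A. \<phi> s \<le> x} = \<alpha> * x" if x: "0 \<le> x" "x < 1" for x
  proof -
    have "\<bar>measure lborel {s\<in>J \<inter> A. \<phi> s \<le> x} - \<alpha> * x\<bar> \<le> \<alpha> * (1/2) ^ j" for j
    proof -
      define p where "p = nat \<lfloor>2 ^ j * x\<rfloor>"
      have p: "real p \<le> 2 ^ j * x" "2 ^ j * x < real p + 1" using x by (auto simp: p_def)
      have "2 ^ j * x < 2 ^ j * 1" using x by (intro mult_strict_left_mono) auto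
      then have "real p < 2 ^ j" using p by linarith
      then have "real p < real (2 ^ j)" by simp
      then have p2: "Suc p \<le> 2 ^ j" by (simp only: of_nat_less_iff Suc_le_eq)
      have eq: "(2 ^ j * \<phi> s \<le> real r) = (\<phi> s \<le> real r / 2 ^ j)" for s r by (simp add: field_simps)
      have "real p / 2 ^ j \<le> x" "x \<le> real (Suc p) / 2 ^ j" using p by (auto simp: field_simps)
      then have "real p * \<alpha> / 2 ^ j \<le> measure lborel {s\<in>J \<inter> A. \<phi> s \<le> x}"
        "measure lborel {s\<in>J \<inter> A. \<phi> s \<le> x} \<le> real (Suc p) * \<alpha> / 2 ^ j"
        using mono[of "real p / 2 ^ j" x] mono[of x "real (Suc p) / 2 ^ j"] pre[of p j] pre[OF p2] p2
        unfolding eq by auto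
      moreover have "real p * \<alpha> / 2 ^ j \<le> \<alpha> * x" "\<alpha> * x \<le> real (Suc p) * \<alpha> / 2 ^ j"
        using mult_left_mono[OF \<open>real p / 2 ^ j \<le> x\<close> a0] mult_left_mono[OF \<open>x \<le> real (Suc p) / 2 ^ j\<close> a0]
        by (simp_all add: mult.commute)
      moreover have "real (Suc p) * \<alpha> / 2 ^ j = real p * \<alpha> / 2 ^ j + \<alpha> * (1/2) ^ j"
        by (simp add: field_simps power_one_over)
      ultimately show ?thesis by linarith
    qed
    moreover have "(\<lambda>j. \<alpha> * (1/2) ^ j) \<longlonglongrightarrow> \<alpha> * 0"
      by (intro tendsto_mult tendsto_const LIMSEQ_power_zero) auto
    ultimately have "\<bar>measure lborel {s\<in>J \<inter> A. \<phi> s \<le> x} - \<alpha> * x\<bar> \<le> \<alpha> * 0"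
      by (intro LIMSEQ_le_const) auto
    then show ?thesis by simp
  qed
  show ?thesis
  proof (cases "\<alpha> = 0")
    case True
    then show ?thesis using emeasure_U[OF A] by (simp add: \<alpha>_def)
  next
    case False
    then have apos: "\<alpha> > 0" using a0 by simp
    have em: "emeasure lborel (J \<inter> A) = ennreal \<alpha>"
      unfolding \<alpha>_def using finite_in_J[OF _ JA] by (simp add: emeasure_eq_ennreal_measure)
    \<comment> \<open>Lebesgue measure conditioned on \<open>J \<inter> A\<close> and on
      \<open>J\<close> will have the same distribution function and hence agree. Evaluating both at
      \<open>A\<close> gives \<open>\<alpha> = 2 * e\<close>, that is, full measure.\<close>
    let ?U1 = "uniform_measure lborel (J \<inter> A)" and ?U2 = "uniform_measure lborel J"
    have p1: "real_distribution ?U1"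
      unfolding real_distribution_def real_distribution_axioms_def
      using em apos by (auto intro!: prob_space_uniform_measure)
    have p2: "real_distribution ?U2"
      unfolding real_distribution_def real_distribution_axioms_def
      using emeasure_J e by (auto intro!: prob_space_uniform_measure)
    interpret U1: prob_space ?U1 using p1 by (simp add: real_distribution_def)
    interpret U2: prob_space ?U2 using p2 by (simp add: real_distribution_def)
    have m1: "measure ?U1 E = measure lborel (J \<inter> A \<inter> E) / \<alpha>" if "E \<in> sets borel" for E
      using that JA em apos measure_uniform_measure[of lborel "J \<inter> A" E] by (simp add: \<alpha>_def)
    have m2: "measure ?U2 E = measure lborel (J \<inter> E) / (2 * e)" if "E \<in> sets borel" for E
      using that J_borel emeasure_J measure_J e measure_uniform_measure[of lborel J E] by simp
    have "cdf ?U1 = cdf ?U2"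
    proof
      fix x
      have phimono: "s \<le> x \<longleftrightarrow> \<phi> s \<le> \<phi> x" for s using e by (simp add: \<phi>_def divide_right_mono field_simps)
      have J1: "J \<inter> A \<inter> {..x} = {s\<in>J \<inter> A. \<phi> s \<le> \<phi> x}" using phimono by auto
      have full: "measure lborel (J \<inter> {..x}) = 2 * e * \<phi> x" if "0 \<le> \<phi> x" "\<phi> x < 1"
      proof -
        have "emeasure lborel (J \<inter> {..x}) = emeasure lborel ({b - e<..x} - N)"
          using that e by (intro arg_cong[of _ _ "emeasure lborel"]) (auto simp: J_def \<phi>_def field_simps)
        also have "\<dots> = emeasure lborel {b - e<..x}"
          using N_null[of N] by (intro emeasure_Diff_null_set) auto
        also have "\<dots> = ennreal (2 * e * \<phi> x)"
        proof -
          have "2 * e * \<phi> x = x - (b - e)" using e by (simp add: \<phi>_def)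
          moreover have "0 \<le> 2 * e * \<phi> x" using that e by simp
          ultimately show ?thesis by simp
        qed
        finally show ?thesis using that e by (simp add: measure_def)
      qed
      consider "\<phi> x < 0" | "0 \<le> \<phi> x" "\<phi> x < 1" | "1 \<le> \<phi> x" by linarith
      then have "measure ?U1 {..x} = measure ?U2 {..x}"
      proof cases
        case 1
        then have "J \<inter> A \<inter> {..x} = {}" "J \<inter> {..x} = {}" using phimono phi_J by force+
        then show ?thesis by (simp add: m1 m2)
      next
        case 2
        then show ?thesis using G[OF 2] full[OF 2] apos e by (simp add: m1 m2 J1)
      next
        case 3
        then have "J \<inter> A \<inter> {..x} = J \<inter> A" "J \<inter> {..x} = J" using phimono phi_J by force+
        then show ?thesis using apos e measure_J by (simp add: m1 m2 \<alpha>_def[symmetric])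
      qed
      then show "cdf ?U1 x = cdf ?U2 x" by (simp add: cdf_def)
    qed
    then have "?U1 = ?U2" by (rule cdf_unique[OF p1 p2])
    then have "measure ?U1 A = measure ?U2 A" by simp
    then have "1 = \<alpha> / (2 * e)" using Ab apos by (simp add: m1 m2 \<alpha>_def[symmetric] Int_assoc)
    then show ?thesis using emeasure_U[OF A] by (simp add: \<alpha>_def[symmetric])
  qed
qed


section \<open>The invariant measure of the tower, its uniqueness and its mixing period\<close>

definition \<mu> :: "real measure" where "\<mu> = cesaro U f k"

definition S :: "real set" where "S = (\<Union>j<k. (f ^^ j) ` J)"

text \<open>The basin of the tower. Its strict invariance means that an ergodic measure gives it
  mass 0 or 1.\<close>

definition W :: "real set" where "W = {s\<in>{0..L}. \<exists>j. (f ^^ j) s \<in> J}"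

lemma f_U: "f \<in> measurable U U" using measurable_U[of 1] by simp

lemma sets_\<mu>: "sets \<mu> = sets B" and space_\<mu>: "space \<mu> = {0..L}"
  by (simp_all add: \<mu>_def sets_U space_U)

lemma J_B: "J \<in> sets B" using J_borel J_sub sets_B by auto

lemma vimage_B: "E \<in> sets B \<Longrightarrow> (f ^^ j) -` E \<inter> {0..L} \<in> sets B"
  using vimage_iter_borel by (auto simp: sets_B)

lemma emeasure_\<mu>:
  "E \<in> sets B \<Longrightarrow> emeasure \<mu> E = (\<Sum>j<k. emeasure U ((f ^^ j) -` E \<inter> {0..L})) / of_nat k"
  unfolding \<mu>_def using emeasure_cesaro[OF f_U, of E k] by (simp add: sets_U space_U)

lemma emeasure_U_null:
  assumes "E \<in> sets B" "J \<inter> E \<in> null_sets lborel"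
  shows "emeasure U E = 0"
  using emeasure_U[OF assms(1)] assms(2) by (simp add: measure_def null_setsD1)

lemma null_\<mu>: assumes "E \<in> sets B" "E \<in> null_sets lborel" shows "emeasure \<mu> E = 0"
proof -
  have "emeasure U ((f ^^ j) -` E \<inter> {0..L}) = 0" for j
    using vimage_B[OF assms(1), of j] null_set_Int1[OF null_vimage_funpow[OF assms(2), of j]] J_borel
    by (intro emeasure_U_null) auto
  then show ?thesis using emeasure_\<mu>[OF assms(1)] by simp
qed

lemma null_restrict: "E \<in> null_sets (restrict_space lborel {0..L}) \<longleftrightarrow> E \<subseteq> {0..L} \<and> E \<in> null_sets lborel"
  by (rule null_sets_restrict_space) simp

lemma ac_\<mu>: "absolutely_continuous (restrict_space lborel {0..L}) \<mu>"
  unfolding absolutely_continuous_def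
proof
  fix E assume "E \<in> null_sets (restrict_space lborel {0..L})"
  then have E: "E \<subseteq> {0..L}" "E \<in> null_sets lborel" using null_restrict by auto
  then have "E \<in> sets B" by (auto simp: sets_B)
  then show "E \<in> null_sets \<mu>" using null_\<mu>[OF _ E(2)] sets_\<mu> by (intro null_setsI) auto
qed

text \<open>Each level is traced back to \<open>J\<close>, where \<open>U\<close> is a multiple of
  Lebesgue measure, and \<open>f ^^ j\<close> sends Lebesgue null sets to null sets. This makes any
  acip carried by the tower absolutely continuous with respect to \<open>\<mu>\<close>.\<close>

lemma null_\<mu>_on_S:
  assumes "E \<in> sets B" "emeasure \<mu> E = 0"
  shows "E \<inter> S \<in> null_sets lborel"
proof -
  have "(\<Sum>j<k. emeasure U ((f ^^ j) -` E \<inter> {0..L})) / of_nat k = (0::ennreal)"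
    using assms emeasure_\<mu> by simp
  then have "(\<Sum>j<k. emeasure U ((f ^^ j) -` E \<inter> {0..L})) = 0"
    by (auto simp: ennreal_divide_eq_0_iff)
  then have U0: "emeasure U ((f ^^ j) -` E \<inter> {0..L}) = 0" if "j < k" for j
    using that by (simp add: sum_eq_0_iff)
  have "E \<inter> (f ^^ j) ` J \<in> null_sets lborel" if "j < k" for j
  proof -
    let ?A = "J \<inter> ((f ^^ j) -` E \<inter> {0..L})"
    have A: "?A \<in> sets borel" using J_borel vimage_B[OF assms(1), of j] by (simp add: sets_B)
    have "measure lborel ?A / (2 * e) \<le> 0"
      using U0[OF that] emeasure_U[OF vimage_B[OF assms(1), of j]] by (simp add: ennreal_eq_0_iff)
    then have "measure lborel ?A = 0" using e by (simp add: divide_le_0_iff measure_le_0_iff)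
    then have "emeasure lborel ?A = 0"
      using finite_in_J[OF _ A] by (simp add: measure_def enn2real_eq_0_iff)
    then have "?A \<in> null_sets lborel" using A by (intro null_setsI) auto
    then have "(f ^^ j) ` ?A \<in> null_sets lborel" by (rule null_image_funpow) auto
    moreover have "(f ^^ j) ` ?A = E \<inter> (f ^^ j) ` J" using J_sub by auto
    ultimately show ?thesis by simp
  qed
  moreover have "E \<inter> S = (\<Union>j<k. E \<inter> (f ^^ j) ` J)" by (auto simp: S_def)
  moreover have "(\<Union>j<k. E \<inter> (f ^^ j) ` J) \<in> null_sets lborel"
    using calculation(1) by (intro null_sets.finite_UN) auto
  ultimately show ?thesis by simp
qed

lemma invariant_\<mu>: "invariant_prob \<mu> f"
  unfolding \<mu>_def by (rule invariant_prob_cesaro[OF f_U k invariant_U])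

lemma acip_\<mu>: "acip L f \<mu>"
  unfolding acip_def using sets_\<mu> ac_\<mu> invariant_\<mu> by simp

lemma average_const: "(\<Sum>j<k. c) / of_nat k = (c::ennreal)"
  using k by (simp add: mult.commute[of "of_nat k"] mult_divide_eq_ennreal)

text \<open>A strictly invariant set is its own preimage under all iterates, hence a tail set of
  \<open>f ^^ k\<close>.\<close>

lemma ergodic_\<mu>: "ergodic_prob \<mu> f"
  unfolding ergodic_prob_def
proof (intro conjI ballI impI invariant_\<mu>)
  fix A assume A: "A \<in> sets \<mu>" "f -` A \<inter> space \<mu> = A"
  have AB: "A \<in> sets B" using A sets_\<mu> by simp
  have inv: "(f ^^ j) -` A \<inter> {0..L} = A" for j
  proof (induction j)
    case 0
    show ?case using AB by (auto simp: sets_B)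
  next
    case (Suc j)
    have "(f ^^ Suc j) -` A \<inter> {0..L} = (f ^^ j) -` (f -` A \<inter> {0..L}) \<inter> {0..L}"
      using range_funpow by auto
    also have "\<dots> = A" using Suc A(2) space_\<mu> by simp
    finally show ?case .
  qed
  have "emeasure U A = 0 \<or> emeasure U A = 1" using inv AB by (intro tail_trivial) auto
  then show "emeasure \<mu> A = 0 \<or> emeasure \<mu> A = 1"
    using emeasure_\<mu>[OF AB] by (simp only: inv average_const)
qed

lemma ergodic_acip_\<mu>: "ergodic_acip L f \<mu>"
  unfolding ergodic_acip_def using acip_\<mu> ergodic_\<mu> by simp

text \<open>Only the term \<open>j = 0\<close> of the average survives, since no point of
  \<open>J\<close> is back in \<open>J\<close> before time \<open>k\<close>. Conditioning
  \<open>\<mu>\<close> on \<open>J\<close> thus recovers \<open>U\<close>, the measure for which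
  tail sets are trivial.\<close>

lemma emeasure_\<mu>_J:
  assumes "E \<in> sets B"
  shows "emeasure \<mu> (J \<inter> E) = emeasure U E / of_nat k"
proof -
  have JE: "J \<inter> E \<in> sets B" using assms J_B by simp
  have "emeasure U ((f ^^ j) -` (J \<inter> E) \<inter> {0..L}) = (if j = 0 then emeasure U E else 0)" if "j < k" for j
  proof (cases "j = 0")
    case True
    have "J \<inter> (J \<inter> E \<inter> {0..L}) = J \<inter> E" using J_sub by auto
    moreover have "J \<inter> E \<inter> {0..L} = J \<inter> E" using J_sub by auto
    ultimately show ?thesis using True emeasure_U[OF JE] emeasure_U[OF assms] by simp
  next
    case False
    have "J \<inter> ((f ^^ j) -` (J \<inter> E) \<inter> {0..L}) = {}"
    proof (rule ccontr)
      assume "J \<inter> ((f ^^ j) -` (J \<inter> E) \<inter> {0..L}) \<noteq> {}"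
      then obtain s where "s \<in> J" "(f ^^ j) s \<in> J" by auto
      then have "k dvd j" by (rule period)
      then show False using False that by (auto dest: dvd_imp_le)
    qed
    then show ?thesis using False emeasure_U[OF vimage_B[OF JE, of j]] by simp
  qed
  then have "(\<Sum>j<k. emeasure U ((f ^^ j) -` (J \<inter> E) \<inter> {0..L})) = (\<Sum>j<k. if j = 0 then emeasure U E else 0)"
    by (intro sum.cong) auto
  also have "\<dots> = emeasure U E" using k by (simp add: sum.delta)
  finally show ?thesis using emeasure_\<mu>[OF JE] by simp
qed

lemma uniform_\<mu>_J: "uniform_measure \<mu> J = U"
proof (rule measure_eqI)
  show "sets (uniform_measure \<mu> J) = sets U" by (simp add: sets_\<mu> sets_U)
  fix E assume "E \<in> sets (uniform_measure \<mu> J)"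
  then have E: "E \<in> sets B" "E \<in> sets \<mu>" by (auto simp: sets_\<mu>)
  have sp: "{0..L} \<in> sets B" by (simp add: sets_B)
  have "emeasure U {0..L} = 1"
    using invariant_U prob_space.emeasure_space_1[of U] by (simp add: invariant_prob_def space_U)
  then have "emeasure \<mu> J = 1 / of_nat k" using emeasure_\<mu>_J[OF sp] J_sub by (simp add: Int_absorb2)
  then have "emeasure (uniform_measure \<mu> J) E = (emeasure U E / of_nat k) / (1 / of_nat k)"
    using E J_B emeasure_\<mu>_J[OF E(1)] sets_\<mu> by (subst emeasure_uniform_measure) auto
  also have "\<dots> = emeasure U E"
  proof -
    have "emeasure U E = ennreal (enn2real (emeasure U E))"
      using emeasure_U[OF E(1)] by simp
    moreover have "ennreal x / of_nat k / (1 / of_nat k) = ennreal x" if "0 \<le> x" for x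
      using k that by (simp add: ennreal_of_nat_eq_real_of_nat divide_ennreal flip: ennreal_1)
    ultimately show ?thesis by (metis enn2real_nonneg)
  qed
  finally show "emeasure (uniform_measure \<mu> J) E = emeasure U E" .
qed

lemma exact_U: "exact_prob U (f ^^ k)"
  unfolding exact_prob_def
proof (intro conjI allI impI invariant_U)
  fix A assume "\<forall>j. \<exists>C\<in>sets U. A = ((f ^^ k) ^^ j) -` C \<inter> space U"
  then show "emeasure U A = 0 \<or> emeasure U A = 1"
    by (intro tail_trivial) (simp add: sets_U space_U funpow_mult)
qed

lemma piece_B: "(f ^^ j) ` J \<in> sets B" by (rule borel_image_funpow[OF J_B])

lemma S_B: "S \<in> sets B" unfolding S_def using piece_B by (intro sets.finite_UN) auto

lemma f_S: assumes "s \<in> S" shows "f s \<in> S"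
proof -
  obtain j x where jx: "j < k" "x \<in> J" "s = (f ^^ j) x" using assms by (auto simp: S_def)
  then have fs: "f s = (f ^^ Suc j) x" by simp
  show ?thesis
  proof (cases "Suc j = k")
    case True
    then have "f s \<in> (f ^^ 0) ` J" using ret[OF jx(2)] fs by simp
    then show ?thesis using k unfolding S_def by (intro UN_I[of 0]) auto
  next
    case False
    then show ?thesis using jx fs unfolding S_def by (intro UN_I[of "Suc j"]) auto
  qed
qed

lemma W_B: "W \<in> sets B"
proof -
  have "W = (\<Union>j. (f ^^ j) -` J \<inter> {0..L})" by (auto simp: W_def)
  moreover have "(\<Union>j. (f ^^ j) -` J \<inter> {0..L}) \<in> sets B"
    using vimage_B[OF J_B] by (intro sets.countable_UN) auto
  ultimately show ?thesis by simp
qed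

text \<open>A visit to \<open>J\<close> is repeated \<open>k\<close> steps later, so it may be taken
  to occur after time 0 and is inherited by the image point.\<close>

lemma W_invariant: "f -` W \<inter> {0..L} = W"
proof (intro set_eqI iffI)
  fix s assume s: "s \<in> f -` W \<inter> {0..L}"
  then obtain j where "(f ^^ j) (f s) \<in> J" by (auto simp: W_def)
  then have "(f ^^ Suc j) s \<in> J" by (simp add: funpow_swap1)
  then show "s \<in> W" using s by (auto simp: W_def intro!: exI[of _ "Suc j"])
next
  fix s assume s: "s \<in> W"
  then obtain j where j: "(f ^^ j) s \<in> J" "s \<in> {0..L}" by (auto simp: W_def)
  have "(f ^^ (j + k)) s = (f ^^ k) ((f ^^ j) s)" by (simp only: funpow_funpow add.commute)
  then have "(f ^^ (j + k)) s \<in> J" using ret j by simp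
  moreover obtain i where i: "j + k = Suc i" using k by (cases "j + k") auto
  ultimately have "(f ^^ i) (f s) \<in> J" by (simp add: funpow_swap1)
  then show "s \<in> f -` W \<inter> {0..L}" using j range[of s] by (auto simp: W_def)
qed

lemma emeasure_\<mu>_outside: "emeasure \<mu> ({0..L} - S) = 0"
proof -
  have X: "{0..L} - S \<in> sets B" using S_B by (auto simp: sets_B)
  have "emeasure U ((f ^^ j) -` ({0..L} - S) \<inter> {0..L}) = 0" if "j < k" for j
  proof (rule emeasure_U_null[OF vimage_B[OF X]])
    have "J \<inter> ((f ^^ j) -` ({0..L} - S) \<inter> {0..L}) = {}" using that by (auto simp: S_def)
    then show "J \<inter> ((f ^^ j) -` ({0..L} - S) \<inter> {0..L}) \<in> null_sets lborel" by simp
  qed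
  then show ?thesis using emeasure_\<mu>[OF X] by simp
qed

lemma emeasure_\<mu>_W: "emeasure \<mu> W = 1"
proof -
  have "S \<subseteq> W"
  proof
    fix s assume s: "s \<in> S"
    then obtain j x where jx: "j < k" "x \<in> J" "s = (f ^^ j) x" by (auto simp: S_def)
    have "(f ^^ (k - j)) s = (f ^^ (k - j + j)) x" unfolding jx(3) by (rule funpow_funpow)
    then have "(f ^^ (k - j)) s \<in> J" using jx ret by simp
    then show "s \<in> W" using s S_B by (auto simp: W_def sets_B)
  qed
  then have "emeasure \<mu> ({0..L} - W) \<le> emeasure \<mu> ({0..L} - S)"
    using S_B sets_\<mu> by (intro emeasure_mono) (auto simp: sets_B)
  then have 0: "emeasure \<mu> ({0..L} - W) = 0" using emeasure_\<mu>_outside by simp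
  have inv: "prob_space \<mu>" using invariant_\<mu> by (simp add: invariant_prob_def)
  have "W \<in> sets \<mu>" using W_B sets_\<mu> by simp
  then have "emeasure \<mu> {0..L} = emeasure \<mu> W + emeasure \<mu> ({0..L} - W)"
    using W_B sets.sets_into_space[of W \<mu>] space_\<mu>
    by (subst plus_emeasure) (auto simp: Un_absorb1 sets_\<mu> sets_B)
  then show ?thesis using 0 prob_space.emeasure_space_1[OF inv] space_\<mu> by simp
qed

text \<open>Since \<open>S\<close> is forward invariant, its preimages increase to a set containing \<open>W\<close>, and all
  have the same measure.\<close>

lemma acip_unique:
  assumes ac: "acip L f \<nu>" and full: "emeasure \<nu> W = 1"
  shows "\<nu> = \<mu>"
proof -
  have sets: "sets \<nu> = sets B" and inv: "invariant_prob \<nu> f"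
    and abs: "absolutely_continuous (restrict_space lborel {0..L}) \<nu>"
    using ac by (auto simp: acip_def)
  have sp: "space \<nu> = {0..L}" using sets_eq_imp_space_eq[OF sets] by (simp add: space_restrict_space)
  interpret prob_space \<nu> using inv by (simp add: invariant_prob_def)
  let ?A = "\<lambda>j. (f ^^ j) -` S \<inter> {0..L}"
  have A: "?A j \<in> sets \<nu>" for j using vimage_B[OF S_B] sets by simp
  have eq: "emeasure \<nu> (?A j) = emeasure \<nu> S" for j
  proof -
    have "f ^^ j \<in> measurable \<nu> \<nu>" "distr \<nu> \<nu> (f ^^ j) = \<nu>"
      using invariant_prob_funpow[OF inv, of j] by (auto simp: invariant_prob_def)
    then show ?thesis using emeasure_distr[of "f ^^ j" \<nu> \<nu> S] S_B sets sp by simp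
  qed
  have "incseq ?A" by (intro incseq_SucI) (auto intro: f_S)
  then have "(SUP j. emeasure \<nu> (?A j)) = emeasure \<nu> (\<Union>j. ?A j)"
    using A by (intro SUP_emeasure_incseq) auto
  then have "emeasure \<nu> S = emeasure \<nu> (\<Union>j. ?A j)" by (simp add: eq)
  moreover have "W \<subseteq> (\<Union>j. ?A j)"
  proof
    fix s assume "s \<in> W"
    then obtain j where j: "s \<in> {0..L}" "(f ^^ j) s \<in> J" by (auto simp: W_def)
    then have "(f ^^ j) s \<in> (f ^^ 0) ` J" by simp
    then have "(f ^^ j) s \<in> S" using k unfolding S_def by (intro UN_I[of 0]) auto
    then show "s \<in> (\<Union>j. ?A j)" using j by auto
  qed
  then have "emeasure \<nu> W \<le> emeasure \<nu> (\<Union>j. ?A j)" using A by (intro emeasure_mono sets.countable_UN) auto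
  ultimately have "emeasure \<nu> S = 1" using full emeasure_le_1[of S] by (simp add: antisym)
  then have "emeasure \<nu> ({0..L} - S) = 0"
    using prob_compl[of S] S_B sets sp by (simp add: emeasure_eq_measure)
  have "absolutely_continuous \<mu> \<nu>"
    unfolding absolutely_continuous_def
  proof
    fix E assume "E \<in> null_sets \<mu>"
    then have E: "E \<in> sets B" "emeasure \<mu> E = 0" using sets_\<mu> by auto
    then have "E \<inter> S \<in> null_sets lborel" by (rule null_\<mu>_on_S)
    then have "E \<inter> S \<in> null_sets (restrict_space lborel {0..L})"
      using null_restrict S_B by (auto simp: sets_B)
    then have 1: "E \<inter> S \<in> null_sets \<nu>" using abs by (auto simp: absolutely_continuous_def)
    have 2: "{0..L} - S \<in> null_sets \<nu>"
      using \<open>emeasure \<nu> ({0..L} - S) = 0\<close> S_B sets by (intro null_setsI) (auto simp: sets_B)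
    have "E \<subseteq> (E \<inter> S) \<union> ({0..L} - S)" using E by (auto simp: sets_B)
    moreover have "E \<in> sets \<nu>" using E sets by simp
    ultimately show "E \<in> null_sets \<nu>" using null_sets_subset[OF null_sets.Un[OF 1 2]] by blast
  qed
  then show ?thesis using invariant_abs_cont_ergodic_eq[OF ergodic_\<mu> inv] sets sets_\<mu> by simp
qed

lemma mixing_period_\<mu>: "mixing_period L f \<mu> k"
  unfolding mixing_period_def
proof (intro conjI exI[of _ "\<lambda>j. (f ^^ j) ` J"] piecewise_expanding ergodic_acip_\<mu> k allI impI)
  fix j assume "j < k"
  show "(f ^^ j) ` J \<in> sets \<mu>" using piece_B sets_\<mu> by simp
next
  show "disjoint_family_on (\<lambda>j. (f ^^ j) ` J) {..<k}"
  proof (unfold disjoint_family_on_def, intro ballI impI, rule ccontr)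
    fix i j assume ij: "i \<in> {..<k}" "j \<in> {..<k}" "i \<noteq> j" and "(f ^^ i) ` J \<inter> (f ^^ j) ` J \<noteq> {}"
    then obtain x y where xy: "x \<in> J" "y \<in> J" "(f ^^ i) x = (f ^^ j) y" by auto
    \<comment> \<open>A common point of levels \<open>i\<close> and \<open>j\<close> reaches
      \<open>J\<close> after \<open>k - i\<close> more steps, so \<open>y\<close> would return to
      \<open>J\<close> at time \<open>k - i + j\<close>, which is not a multiple of
      \<open>k\<close>.\<close>
    have "(f ^^ (k - i)) ((f ^^ i) x) = (f ^^ (k - i + i)) x" by (rule funpow_funpow)
    then have "(f ^^ (k - i)) ((f ^^ i) x) \<in> J" using ij ret[OF xy(1)] by simp
    then have "(f ^^ (k - i + j)) y \<in> J" by (simp only: xy(3) funpow_funpow)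
    then have "k dvd k - i + j" by (rule period[OF xy(2)])
    then have "int k dvd int (k - i + j)" by (simp only: int_dvd_int_iff)
    then have "int k dvd int k + (int j - int i)" using ij by (simp add: of_nat_diff algebra_simps)
    then have "int k dvd int j - int i" by (simp add: dvd_add_right_iff)
    moreover have "\<bar>int j - int i\<bar> < int k" "int j - int i \<noteq> 0" using ij by auto
    ultimately show False using dvd_imp_le_int[of "int j - int i" "int k"] by simp
  qed
next
  have s1: "measure_support \<mu> \<in> sets \<mu>" "{0..L} - measure_support \<mu> \<in> null_sets \<mu>"
    using null_outside_support[OF sets_\<mu>] space_\<mu> by auto
  have s2: "{0..L} - S \<in> null_sets \<mu>"
    using emeasure_\<mu>_outside S_B sets_\<mu> by (intro null_setsI) (auto simp: sets_B)
  have "sym_diff (measure_support \<mu>) S \<subseteq> ({0..L} - measure_support \<mu>) \<union> ({0..L} - S)"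
    using sets.sets_into_space[OF s1(1)] space_\<mu> S_B by (auto simp: sets_B)
  moreover have "sym_diff (measure_support \<mu>) S \<in> sets \<mu>" using s1 S_B sets_\<mu> by auto
  ultimately show "sym_diff (measure_support \<mu>) (\<Union>j<k. (f ^^ j) ` J) \<in> null_sets \<mu>"
    using null_sets_subset[OF null_sets.Un[OF s1(2) s2]] unfolding S_def by blast
next
  fix j assume j: "j < k"
  show "sym_diff (f ` (f ^^ j) ` J) ((f ^^ (Suc j mod k)) ` J) \<in> null_sets \<mu>"
  proof (cases "Suc j = k")
    case False
    then have "Suc j mod k = Suc j" using j by simp
    then show ?thesis by (simp add: image_image)
  next
    case True
    have fk: "f ` (f ^^ j) ` J = (f ^^ k) ` J" using True by (auto simp: image_image)
    \<comment> \<open>The right branch of the doubling map alone covers \<open>J\<close> up to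
      countably many points; its inverse gives the witness \<open>x\<close> below.\<close>
    have "J - (f ^^ k) ` J \<subseteq> (\<lambda>x. b + 2 * (x - b) - e) ` N"
    proof
      fix y assume y: "y \<in> J - (f ^^ k) ` J"
      define x where "x = (y + b + e) / 2"
      have x: "b < x" "x < b + e" "y = b + 2 * (x - b) - e" using y by (auto simp: x_def J_def field_simps)
      have "x \<in> N"
      proof (rule ccontr)
        assume "x \<notin> N"
        then have "x \<in> J" using x e by (auto simp: J_def)
        then have "(f ^^ k) x = y" using ret_eq[of x] x by simp
        then show False using y \<open>x \<in> J\<close> by auto
      qed
      then show "y \<in> (\<lambda>x. b + 2 * (x - b) - e) ` N" using x(3) by (rule image_eqI[rotated])
    qed
    moreover have "countable ((\<lambda>x. b + 2 * (x - b) - e) ` N)" using N by simp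
    ultimately have "countable (J - (f ^^ k) ` J)" by (rule countable_subset)
    then have "J - (f ^^ k) ` J \<in> null_sets lborel" by (rule countable_imp_null_set_lborel)
    moreover have "J - (f ^^ k) ` J \<in> sets B" using J_B piece_B by auto
    ultimately have "J - (f ^^ k) ` J \<in> null_sets \<mu>" using null_\<mu> sets_\<mu> by (intro null_setsI) auto
    moreover have "(f ^^ k) ` J - J = {}" using ret by auto
    moreover have "Suc j mod k = 0" using True by simp
    moreover have "(f ^^ 0) ` J = J" by simp
    ultimately show ?thesis using fk by (simp only: Un_empty_left)
  qed
next
  show "exact_prob (uniform_measure \<mu> ((f ^^ 0) ` J)) (f ^^ k)"
    using exact_U uniform_\<mu>_J by simp
qed

end

section \<open>Renormalisation\<close>

text \<open>The three clauses go through the induction together. The last two, visits only at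
  multiples of \<open>p\<close> and arrival of every orbit, finally supply the period of the tower
  and the covering by basins.\<close>

definition renormalizes :: "(real \<Rightarrow> real) \<Rightarrow> real set \<Rightarrow> nat \<Rightarrow> real \<Rightarrow> real \<Rightarrow> bool" where
  "renormalizes F G p \<gamma> e \<longleftrightarrow>
     (\<forall>x\<in>G. \<bar>x\<bar> < e \<longrightarrow> (F ^^ p) x = \<gamma> * x - e * sgn x) \<and>
     (\<forall>x\<in>G. \<forall>j. \<bar>x\<bar> < e \<longrightarrow> \<bar>(F ^^ j) x\<bar> < e \<longrightarrow> p dvd j) \<and>
     (\<forall>x\<in>G. \<exists>j. \<bar>(F ^^ j) x\<bar> < e)"

text \<open>One step of renormalisation: the second iterate of \<open>x \<mapsto> \<gamma> x - e sgn x\<close> on the middle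
  interval of half-width \<open>e (\<gamma> - 1)\<close> is a map of the same form with slope \<open>\<gamma>\<^sup>2\<close>.
  In absolute values the map is \<open>u \<mapsto> \<bar>\<gamma> u - e\<bar>\<close>, and an orbit avoiding the middle interval
  is expelled from the fixed point \<open>e / (\<gamma> + 1)\<close>, a contradiction.\<close>

lemma renormalization_step:
  fixes F :: "real \<Rightarrow> real" and e \<gamma> :: real
  assumes inv: "\<And>x. x \<in> G \<Longrightarrow> F x \<in> G"
    and ren: "renormalizes F G p \<gamma> e"
    and e: "0 < e" and \<gamma>: "1 < \<gamma>" "\<gamma>\<^sup>2 \<le> 2"
    and zero: "0 \<notin> G" and fixpt: "\<And>x. x \<in> G \<Longrightarrow> \<bar>x\<bar> \<noteq> e / (\<gamma> + 1)"
  shows "renormalizes F G (2 * p) (\<gamma>\<^sup>2) (e * (\<gamma> - 1))"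
proof -
  have eq: "\<And>x. x \<in> G \<Longrightarrow> \<bar>x\<bar> < e \<Longrightarrow> (F ^^ p) x = \<gamma> * x - e * sgn x"
    and per: "\<And>x j. x \<in> G \<Longrightarrow> \<bar>x\<bar> < e \<Longrightarrow> \<bar>(F ^^ j) x\<bar> < e \<Longrightarrow> p dvd j"
    and hit: "\<And>x. x \<in> G \<Longrightarrow> \<exists>j. \<bar>(F ^^ j) x\<bar> < e"
    using ren by (auto simp: renormalizes_def)
  define e' where e': "e' = e * (\<gamma> - 1)"
  have "\<gamma> * 1 < \<gamma> * \<gamma>" using \<gamma> by (intro mult_strict_left_mono) auto
  then have \<gamma>2: "\<gamma> < 2" using \<gamma>(2) by (simp add: power2_eq_square)
  have e'_pos: "0 < e'" using e \<gamma> by (simp add: e')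
  have e'_e: "e' < e" using e \<gamma>2 by (simp add: e')
  \<comment> \<open>Here \<open>\<gamma>\<^sup>2 \<le> 2\<close> keeps the middle interval within
    \<open>e / (\<gamma> + 1)\<close>, the point fixed in absolute value, so that one application of
    \<open>H\<close> throws every point out of it.\<close>
  have e'_mid: "(\<gamma> + 1) * e' \<le> e"
  proof -
    have "(\<gamma> + 1) * e' = e * (\<gamma>\<^sup>2 - 1)" by (simp add: e' power2_eq_square algebra_simps)
    also have "\<dots> \<le> e * 1" using e \<gamma> by (intro mult_left_mono) auto
    finally show ?thesis by simp
  qed
  have invn: "x \<in> G \<Longrightarrow> (F ^^ j) x \<in> G" for x j
    by (induction j) (auto intro: inv)
  define H where "H = F ^^ p"
  have HG: "x \<in> G \<Longrightarrow> H x \<in> G" for x using invn by (simp add: H_def)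
  have Habs: "\<bar>H x\<bar> = \<bar>\<gamma> * \<bar>x\<bar> - e\<bar>" if "x \<in> G" "\<bar>x\<bar> < e" for x
  proof -
    have "x \<noteq> 0" using that zero by auto
    then have "H x = sgn x * (\<gamma> * \<bar>x\<bar> - e)"
      unfolding H_def eq[OF that] by (simp add: algebra_simps sgn_if)
    then show ?thesis using \<open>x \<noteq> 0\<close> by (simp add: abs_mult abs_sgn_eq)
  qed
  have He: "\<bar>H x\<bar> < e" if "x \<in> G" "\<bar>x\<bar> < e" for x
  proof -
    have "0 < \<bar>x\<bar>" using that zero by auto
    then have "0 < \<gamma> * \<bar>x\<bar>" using \<gamma> by simp
    moreover have "\<gamma> * \<bar>x\<bar> < \<gamma> * e" "\<gamma> * e < 2 * e" using that \<gamma> \<gamma>2 e by auto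
    ultimately show ?thesis unfolding Habs[OF that] by linarith
  qed
  have mid: "H (H x) = \<gamma>\<^sup>2 * x - e' * sgn x" "\<bar>H (H x)\<bar> < e'" "e' < \<bar>H x\<bar>"
    if x: "x \<in> G" "\<bar>x\<bar> < e'" for x
  proof -
    have xe: "\<bar>x\<bar> < e" using x e'_e by simp
    have x0: "0 < \<bar>x\<bar>" using x zero by auto
    have gx: "\<gamma> * \<bar>x\<bar> < \<gamma> * e'" using x \<gamma> by simp
    have mide: "\<gamma> * e' + e' \<le> e" using e'_mid by (simp add: algebra_simps)
    show "e' < \<bar>H x\<bar>" unfolding Habs[OF x(1) xe] using gx mide by linarith
    have Hx: "H x = \<gamma> * x - e * sgn x" using eq[OF x(1) xe] by (simp add: H_def)
    \<comment> \<open>The first application flips the sign, so the two translations partly cancel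
      and leave \<open>e * (\<gamma> - 1)\<close>, the new half-width.\<close>
    have s: "sgn (H x) = - sgn x"
      unfolding Hx using gx mide x0 e'_pos by (auto simp: sgn_if abs_if split: if_splits)
    have "H (H x) = \<gamma> * H x - e * sgn (H x)"
      using eq[OF HG[OF x(1)] He[OF x(1) xe]] by (simp add: H_def)
    also have "\<dots> = \<gamma>\<^sup>2 * x - e' * sgn x"
      unfolding s unfolding Hx by (simp add: e' power2_eq_square algebra_simps)
    finally show HH: "H (H x) = \<gamma>\<^sup>2 * x - e' * sgn x" .
    have "H (H x) = sgn x * (\<gamma>\<^sup>2 * \<bar>x\<bar> - e')" unfolding HH by (simp add: algebra_simps sgn_if)
    then have "\<bar>H (H x)\<bar> = \<bar>\<gamma>\<^sup>2 * \<bar>x\<bar> - e'\<bar>" using x0 by (simp add: abs_mult abs_sgn_eq)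
    moreover have "0 < \<gamma>\<^sup>2 * \<bar>x\<bar>" using x0 \<gamma> by simp
    moreover have "\<gamma>\<^sup>2 * \<bar>x\<bar> < 2 * e'"
      using mult_right_mono[OF \<gamma>(2), of "\<bar>x\<bar>"] x by simp
    ultimately show "\<bar>H (H x)\<bar> < e'" by linarith
  qed
  have F2p: "F ^^ (2 * p) = H \<circ> H" by (simp add: H_def mult_2 funpow_add)
  have "(F ^^ (2 * p)) x = \<gamma>\<^sup>2 * x - e' * sgn x" if "x \<in> G" "\<bar>x\<bar> < e'" for x
    using mid(1)[OF that] by (simp add: F2p)
  moreover have "2 * p dvd j" if x: "x \<in> G" "\<bar>x\<bar> < e'" and j: "\<bar>(F ^^ j) x\<bar> < e'" for x j
  proof -
    have "p dvd j" using per[OF x(1), of j] x(2) j e'_e by linarith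
    then obtain i where i: "j = p * i" by blast
    have Fj: "(F ^^ j) x = (H ^^ i) x" unfolding i H_def by (simp add: funpow_mult)
    have ev: "(H ^^ (2 * r)) x \<in> G \<and> \<bar>(H ^^ (2 * r)) x\<bar> < e'" for r
    proof (induction r)
      case (Suc r)
      have "(H ^^ (2 * Suc r)) x = H (H ((H ^^ (2 * r)) x))" by simp
      then show ?case using Suc mid(2) HG by metis
    qed (use x in simp)
    have "even i"
    proof (rule ccontr)
      assume "odd i"
      then obtain r where "i = Suc (2 * r)" by (auto elim: oddE)
      then have "(F ^^ j) x = H ((H ^^ (2 * r)) x)" using Fj by simp
      then show False using mid(3)[of "(H ^^ (2 * r)) x"] ev[of r] j by simp
    qed
    then show ?thesis unfolding i by (auto elim!: evenE simp: mult_ac)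
  qed
  moreover have "\<exists>j. \<bar>(F ^^ j) x\<bar> < e'" if xG: "x \<in> G" for x
  proof (rule ccontr)
    assume none: "\<nexists>j. \<bar>(F ^^ j) x\<bar> < e'"
    obtain j0 where j0: "\<bar>(F ^^ j0) x\<bar> < e" using hit[OF xG] by blast
    define y where "y = (F ^^ j0) x"
    define u where "u i = \<bar>(H ^^ i) y\<bar>" for i
    have yG: "y \<in> G" using invn xG by (simp add: y_def)
    have iG: "(H ^^ i) y \<in> G" for i using yG by (induction i) (auto intro: HG)
    have ie: "u i < e" for i
    proof (induction i)
      case 0
      show ?case using j0 by (simp add: u_def y_def)
    next
      case (Suc i)
      then show ?case using He[OF iG] by (simp add: u_def)
    qed
    have big: "e' \<le> u i" for i
    proof -
      have "(H ^^ i) y = (F ^^ (p * i + j0)) x" by (simp add: H_def y_def funpow_mult funpow_add)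
      then show ?thesis using none by (metis u_def not_le)
    qed
    \<comment> \<open>Only the decreasing branch is possible: \<open>u i < e\<close> gives
      \<open>\<gamma> * u i - e < e'\<close>, whereas the next value is at least
      \<open>e'\<close>.\<close>
    have step: "u (Suc i) = e - \<gamma> * u i" for i
    proof -
      have a: "u (Suc i) = \<bar>\<gamma> * u i - e\<bar>" using Habs[OF iG, of i] ie[of i] by (simp add: u_def)
      have "\<gamma> * u i < \<gamma> * e" using ie[of i] \<gamma> by simp
      then have "\<gamma> * u i - e < e'" by (simp add: e' algebra_simps)
      then show ?thesis using a big[of "Suc i"] e'_pos by linarith
    qed
    define x0 where "x0 = e / (\<gamma> + 1)"
    have "(\<gamma> + 1) * x0 = e" using \<gamma> by (simp add: x0_def)
    then have fx: "\<gamma> * x0 + x0 = e" by (simp add: algebra_simps)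
    have dist: "\<bar>u i - x0\<bar> = \<gamma> ^ i * \<bar>u 0 - x0\<bar>" for i
    proof (induction i)
      case (Suc i)
      have "u (Suc i) - x0 = - \<gamma> * (u i - x0)" unfolding step using fx by (simp add: algebra_simps)
      then show ?case using Suc \<gamma> by (simp add: abs_mult)
    qed simp
    have pos: "0 < \<bar>u 0 - x0\<bar>" using fixpt[OF yG] by (simp add: u_def x0_def)
    obtain i where "(e + \<bar>x0\<bar>) / \<bar>u 0 - x0\<bar> < \<gamma> ^ i" using real_arch_pow[OF \<gamma>(1)] by blast
    then have "e + \<bar>x0\<bar> < \<bar>u i - x0\<bar>" using pos by (simp add: dist[of i] pos_divide_less_eq)
    moreover have "\<bar>u i - x0\<bar> \<le> e + \<bar>x0\<bar>" using ie[of i] by (simp add: u_def)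
    ultimately show False by simp
  qed
  ultimately have "renormalizes F G (2 * p) (\<gamma>\<^sup>2) e'" by (simp add: renormalizes_def)
  then show ?thesis by (simp only: e')
qed

text \<open>Each stage multiplies the half-width by the slope minus one, and the slope is squared
  from stage to stage.\<close>

definition halfwidth :: "real \<Rightarrow> real \<Rightarrow> nat \<Rightarrow> real" where
  "halfwidth \<beta> e l = e * (\<Prod>i<l. \<beta> ^ 2 ^ i - 1)"

lemma halfwidth_pos: "1 < \<beta> \<Longrightarrow> 0 < e \<Longrightarrow> 0 < halfwidth \<beta> e l"
  unfolding halfwidth_def by (intro mult_pos_pos prod_pos) (auto simp: one_less_power)

lemma renormalization:
  fixes F :: "real \<Rightarrow> real" and e \<beta> :: real
  assumes inv: "\<And>x. x \<in> G \<Longrightarrow> F x \<in> G"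
    and eq: "\<And>x. x \<in> G \<Longrightarrow> F x = \<beta> * x - e * sgn x"
    and hit: "\<And>x. x \<in> G \<Longrightarrow> \<exists>j. \<bar>(F ^^ j) x\<bar> < e"
    and e: "0 < e" and \<beta>: "1 < \<beta>" "\<beta> ^ 2 ^ m = 2"
    and zero: "0 \<notin> G"
    and fixpt: "\<And>x l. x \<in> G \<Longrightarrow> l < m \<Longrightarrow> \<bar>x\<bar> \<noteq> halfwidth \<beta> e l / (\<beta> ^ 2 ^ l + 1)"
    and "l \<le> m"
  shows "renormalizes F G (2 ^ l) (\<beta> ^ 2 ^ l) (halfwidth \<beta> e l)"
  using \<open>l \<le> m\<close>
proof (induction l)
  case 0
  then show ?case using eq hit by (simp add: halfwidth_def renormalizes_def)
next
  case (Suc l)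
  let ?e = "halfwidth \<beta> e l" and ?\<gamma> = "\<beta> ^ 2 ^ l"
  have "l < m" using Suc.prems by simp
  have g1: "1 < ?\<gamma>" using \<beta> by (simp add: one_less_power)
  have sq: "?\<gamma>\<^sup>2 = \<beta> ^ 2 ^ Suc l" by (simp add: power_mult[symmetric] mult.commute)
  have "\<beta> ^ 2 ^ Suc l \<le> \<beta> ^ 2 ^ m" using \<beta> Suc.prems by (intro power_increasing) auto
  then have g2: "?\<gamma>\<^sup>2 \<le> 2" using \<beta> sq by simp
  have e': "halfwidth \<beta> e (Suc l) = ?e * (?\<gamma> - 1)" by (simp add: halfwidth_def)
  have "renormalizes F G (2 * 2 ^ l) (?\<gamma>\<^sup>2) (?e * (?\<gamma> - 1))"
    using Suc g1 g2 zero fixpt[OF _ \<open>l < m\<close>] halfwidth_pos[OF \<beta>(1) e]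
    by (intro renormalization_step[OF inv]) auto
  then show ?case by (simp only: sq e' power_Suc)
qed

text \<open>The \<open>2 ^ m\<close>-th root of 2 tends to 1, so the renormalisation can end exactly
  at slope 2 however close to 1 the initial slope has to be.\<close>

lemma dyadic_root_of_two:
  fixes \<epsilon> :: real
  assumes "0 < \<epsilon>"
  obtains \<beta> :: real and m :: nat where "1 < \<beta>" "\<beta> < 1 + \<epsilon>" "\<beta> ^ 2 ^ m = 2"
proof -
  obtain m where m: "2 < (1 + \<epsilon>) ^ m" using real_arch_pow[of "1 + \<epsilon>" 2] assms by auto
  have "(1 + \<epsilon>) ^ m \<le> (1 + \<epsilon>) ^ 2 ^ m" using assms by (intro power_increasing) (auto intro: less_imp_le)
  then have big: "2 < (1 + \<epsilon>) ^ 2 ^ m" using m by linarith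
  define \<beta> where "\<beta> = root (2 ^ m) 2"
  have p: "\<beta> ^ 2 ^ m = 2" unfolding \<beta>_def by (intro real_root_pow_pos2) auto
  have "1 < \<beta>" unfolding \<beta>_def by (simp add: real_root_gt_1_iff)
  moreover have "\<beta> < 1 + \<epsilon>"
    using power_less_imp_less_base[of \<beta> "2 ^ m" "1 + \<epsilon>"] big p assms by simp
  ultimately show thesis using that p by blast
qed

section \<open>The components of the slap map\<close>

context doubling_tower begin

lemma ergodic_component:
  "\<exists>\<mu>. ergodic_acip L f \<mu> \<and> mixing_period L f \<mu> k \<and> emeasure \<mu> W = 1 \<and>
     (\<forall>\<nu>. acip L f \<nu> \<longrightarrow> emeasure \<nu> W = 1 \<longrightarrow> \<nu> = \<mu>)"
  using ergodic_acip_\<mu> mixing_period_\<mu> emeasure_\<mu>_W acip_unique by blast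

end

text \<open>The slap map of the polygon constructed above. The base of component \<open>i\<close> has arc length
  parameters \<open>base i + x\<close> and the opposite pair of sides \<open>cap i + a * y\<close>, with \<open>\<bar>x\<bar>, \<bar>y\<bar> < 1\<close>.\<close>

locale slap_system =
  fixes f :: "real \<Rightarrow> real" and n m :: nat and \<beta> a e :: real
  assumes n: "0 < n" and a: "0 < a" "a\<^sup>2 = \<beta>" and \<beta>: "1 < \<beta>" "\<beta> ^ 2 ^ m = 2"
    and e: "\<beta> - 1 < e" "e < 1"
    and f_base: "\<And>i x. i < n \<Longrightarrow> \<bar>x\<bar> < 1 \<Longrightarrow>
      f (2 * real n * a + 2 * real i + 1 + x) = (2 * real i + 1) * a - a * x"
    and f_cap: "\<And>i y. i < n \<Longrightarrow> 0 < \<bar>y\<bar> \<Longrightarrow> \<bar>y\<bar> < 1 \<Longrightarrow>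
      f ((2 * real i + 1) * a + a * y) = 2 * real n * a + 2 * real i + 1 - (\<beta> * y - e * sgn y)"
    and f_cap_end: "\<And>j. j \<le> 2 * n \<Longrightarrow> f (real j * a) = 0"
    and f_base_end: "\<And>i. i \<le> n \<Longrightarrow> f (2 * real n * a + 2 * real i) = 0"
begin

definition L :: real where "L = 2 * real n * a + 2 * real n"
definition base :: "nat \<Rightarrow> real" where "base i = 2 * real n * a + 2 * real i + 1"
definition cap :: "nat \<Rightarrow> real" where "cap i = (2 * real i + 1) * a"
definition F :: "real \<Rightarrow> real" where "F x = \<beta> * x - e * sgn x"
definition P :: "nat \<Rightarrow> real" where
  "P j = (if j \<le> 2 * n then real j * a else 2 * real n * a + 2 * (real j - 2 * real n))"
text \<open>Intercepts read off from \<open>f_base\<close> and \<open>f_cap\<close>; an even index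
  is the first half of a cap, where \<open>sgn y = - 1\<close>.\<close>

definition q :: "nat \<Rightarrow> real" where
  "q j = (if j < 2 * n then base (j div 2) + a * cap (j div 2) + (if even j then - e else e)
     else cap (j - 2 * n) + a * base (j - 2 * n))"

lemma a1: "1 < a"
proof -
  have "1 ^ 2 < a ^ 2" using a \<beta> by simp
  then show ?thesis using power_less_imp_less_base[of 1 2 a] a by simp
qed

lemma f_base': "i < n \<Longrightarrow> \<bar>x\<bar> < 1 \<Longrightarrow> f (base i + x) = cap i - a * x"
  using f_base[of i x] by (simp add: base_def cap_def)

lemma f_cap': "i < n \<Longrightarrow> 0 < \<bar>y\<bar> \<Longrightarrow> \<bar>y\<bar> < 1 \<Longrightarrow> f (cap i + a * y) = base i - F y"
  using f_cap[of i y] by (simp add: base_def cap_def F_def)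

lemma F_uminus: "F (- x) = - F x" by (simp add: F_def sgn_minus)

lemma F_abs: "x \<noteq> 0 \<Longrightarrow> \<bar>F x\<bar> = \<bar>\<beta> * \<bar>x\<bar> - e\<bar>"
  by (auto simp: F_def sgn_if abs_if)

lemma F_bound: assumes "0 < \<bar>x\<bar>" "\<bar>x\<bar> < 1" shows "\<bar>F x\<bar> < 1"
proof -
  have "0 < \<beta> * \<bar>x\<bar>" "\<beta> * \<bar>x\<bar> < \<beta> * 1" using assms \<beta> by auto
  then show ?thesis using F_abs[of x] assms e by auto
qed

lemma cap_interval: "i < n \<Longrightarrow> \<bar>y\<bar> < 1 \<Longrightarrow> 0 < cap i + a * y \<and> cap i + a * y < 2 * real n * a"
proof -
  assume i: "i < n" and y: "\<bar>y\<bar> < 1"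
  have "0 < a * (2 * real i + 1 + y)" using a y by (intro mult_pos_pos) auto
  moreover have "2 * real i + 1 + y < 2 * real n" using i y by linarith
  then have "a * (2 * real i + 1 + y) < a * (2 * real n)" using a by (intro mult_strict_left_mono) auto
  ultimately show ?thesis by (simp add: cap_def algebra_simps)
qed

lemma base_interval: "i < n \<Longrightarrow> \<bar>x\<bar> < 1 \<Longrightarrow> 2 * real n * a < base i + x \<and> base i + x < L"
  unfolding base_def L_def by linarith

lemma base_inj: assumes "base i + x = base i' + x'" "\<bar>x\<bar> < 1" "\<bar>x'\<bar> < 1" shows "i = i'" "x = x'"
proof -
  have "2 * real i + x = 2 * real i' + x'" using assms(1) by (simp add: base_def)
  then have "real i < real i' + 1" "real i' < real i + 1" using assms(2,3) by linarith+
  then show "i = i'" by linarith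
  then show "x = x'" using assms(1) by simp
qed

lemma side_cases:
  assumes "j < 3 * n" "P j < s" "s < P (Suc j)"
  obtains (base) x where "2 * n \<le> j" "j - 2 * n < n" "\<bar>x\<bar> < 1" "s = base (j - 2 * n) + x"
  | (cap) y where "j < 2 * n" "j div 2 < n" "0 < \<bar>y\<bar>" "\<bar>y\<bar> < 1" "s = cap (j div 2) + a * y"
      "sgn y = (if even j then - 1 else 1)"
proof (cases "j < 2 * n")
  case True
  let ?i = "j div 2"
  define y where "y = s / a - (2 * ?i + 1)"
  have s: "s = cap ?i + a * y" using a by (simp add: y_def cap_def field_simps)
  have "j < s / a" "s / a < real j + 1"
    using True assms a by (simp_all add: P_def field_simps)
  moreover have "real j = 2 * real ?i + (if even j then 0 else 1)"
    by (cases "even j") (auto elim!: evenE oddE)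
  ultimately have y: "(if even j then - 1 else 0) < y \<and> y < (if even j then 0 else 1)"
    unfolding y_def by auto
  have "?i < n" using True by auto
  then show thesis using y True s by (intro that(2)[of y]) (auto split: if_splits)
next
  case False
  define x where "x = s - base (j - 2 * n)"
  have "P j = 2 * real n * a + 2 * (real j - 2 * real n)" using False by (auto simp: P_def)
  moreover have "P (Suc j) = 2 * real n * a + 2 * (real j - 2 * real n) + 2" using False by (auto simp: P_def)
  ultimately have "\<bar>x\<bar> < 1" using assms False by (auto simp: x_def base_def of_nat_diff)
  then show thesis using False assms(1) by (intro that(1)[of x]) (auto simp: x_def)
qed

lemma f_P: "j \<le> 3 * n \<Longrightarrow> f (P j) = 0"
  using f_cap_end[of j] f_base_end[of "j - 2 * n"] by (auto simp: P_def of_nat_diff)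

lemma P_0: "P 0 = 0" by (simp add: P_def)

lemma P_3n: "P (3 * n) = L" using n by (auto simp: P_def L_def)

lemma P_less: "P j < P (Suc j)"
proof -
  consider "j < 2 * n" | "j = 2 * n" | "2 * n < j" by linarith
  then show ?thesis by cases (use a in \<open>auto simp: P_def algebra_simps\<close>)
qed

lemma P_cover:
  assumes "0 \<le> s" "s < L"
  obtains j where "j < 3 * n" "s = P j" | j where "j < 3 * n" "P j < s" "s < P (Suc j)"
proof -
  have "\<exists>j<3 * n. P j \<le> s \<and> s < P (Suc j)" if "s < P i" "i \<le> 3 * n" for i
    using that
  proof (induction i)
    case 0
    then show ?case using assms by (simp add: P_0)
  next
    case (Suc i)
    show ?case
    proof (cases "s < P i")
      case False
      then show ?thesis using Suc.prems by (intro exI[of _ i]) auto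
    qed (use Suc in auto)
  qed
  from this[of "3 * n"] assms obtain j where "j < 3 * n" "P j \<le> s" "s < P (Suc j)"
    by (auto simp: P_3n)
  then show thesis using that by (cases "s = P j") auto
qed

lemma piecewise_linear: "piecewise_linear f L a P q (3 * n)"
proof
  show "P 0 = 0" "P (3 * n) = L" "0 < 3 * n" "1 < a" using P_0 P_3n n a1 by auto
  show "P j < P (Suc j)" for j by (rule P_less)
next
  fix j s assume j: "j < 3 * n" "P j < s" "s < P (Suc j)"
  show "f s = - a * s + q j"
    using j
  proof (cases rule: side_cases)
    case (base x)
    then have "f s = cap (j - 2 * n) - a * x" by (simp only: f_base')
    then show ?thesis using base by (simp add: q_def algebra_simps)
  next
    case (cap y)
    then have "f s = base (j div 2) - (\<beta> * y - e * sgn y)" by (simp only: f_cap' F_def)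
    also have "\<dots> = - a * s + q j"
      using cap a by (auto simp: q_def algebra_simps power2_eq_square)
    finally show ?thesis .
  qed
next
  fix s assume "s \<in> {0..L}"
  then consider "s = L" | "0 \<le> s" "s < L" by force
  then show "f s \<in> {0..L}"
  proof cases
    case 1
    then show ?thesis using f_P[of "3 * n"] a by (simp add: P_3n L_def)
  next
    case 2
    then show ?thesis
    proof (cases rule: P_cover)
      case (1 j)
      then show ?thesis using f_P[of j] a by (simp add: L_def)
    next
      case (2 j)
      then show ?thesis
      proof (cases rule: side_cases)
        case (base x)
        then have "f s = cap (j - 2 * n) - a * x" by (simp only: f_base')
        then show ?thesis using cap_interval[of "j - 2 * n" "- x"] base by (auto simp: L_def)
      next
        case (cap y)
        then have "f s = base (j div 2) - F y" by (simp only: f_cap')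
        then show ?thesis
          using base_interval[of "j div 2" "- F y"] F_bound[of y] cap a
          by (smt (verit) abs_minus_cancel atLeastAtMost_iff mult_nonneg_nonneg of_nat_0_le_iff)
      qed
    qed
  qed
qed

sublocale piecewise_linear f L a P q "3 * n" by (rule piecewise_linear)

text \<open>Points to be avoided by orbits: the break points, where \<open>f\<close> has default
  values; the centres of the bases, where \<open>sgn\<close> vanishes; and, for each stage of the
  renormalisation, the points fixed in absolute value, which never enter the next interval. Passing
  to all preimages keeps the set countable.\<close>

definition Q :: "real set" where
  "Q = Z \<union> base ` {..<n} \<union>
     (\<Union>i<n. \<Union>l<m. {base i + halfwidth \<beta> e l / (\<beta> ^ 2 ^ l + 1), base i - halfwidth \<beta> e l / (\<beta> ^ 2 ^ l + 1)})"

definition N :: "real set" where "N = (\<Union>j. (f ^^ j) -` Q \<inter> {0..L})"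

definition G :: "nat \<Rightarrow> real set" where "G i = {x. \<bar>x\<bar> < 1 \<and> base i + x \<notin> N}"

abbreviation h :: real where "h \<equiv> halfwidth \<beta> e m"

definition J :: "nat \<Rightarrow> real set" where "J i = {base i - h<..<base i + h} - N"

lemma countable_N: "countable N"
proof -
  have "finite Q" unfolding Q_def using finite_Z by auto
  then show ?thesis unfolding N_def by (intro countable_UN countable_vimage_funpow) (auto intro: countable_finite)
qed

lemma f_N: assumes "s \<in> {0..L}" "s \<notin> N" shows "f s \<in> {0..L}" "f s \<notin> N" "s \<notin> Q"
proof -
  show "f s \<in> {0..L}" using range assms by blast
  show "f s \<notin> N"
  proof
    assume "f s \<in> N"
    then obtain j where "(f ^^ j) (f s) \<in> Q" by (auto simp: N_def)
    then have "(f ^^ Suc j) s \<in> Q" by (simp add: funpow_swap1)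
    then show False using assms unfolding N_def by blast
  qed
  show "s \<notin> Q" using assms unfolding N_def by (auto dest: spec[of _ 0])
qed

lemma base_L: "i < n \<Longrightarrow> \<bar>x\<bar> < 1 \<Longrightarrow> base i + x \<in> {0..L}"
proof -
  assume "i < n" "\<bar>x\<bar> < 1"
  moreover have "0 \<le> 2 * real n * a" using a by simp
  ultimately have "0 < base i + x \<and> base i + x < L" using base_interval[of i x] by linarith
  then show ?thesis by simp
qed

lemma e_pos: "0 < e" using e \<beta> by simp

text \<open>Both legs reverse orientation and \<open>F\<close> is odd, so the reversals cancel and
  the second iterate on the base is \<open>F\<close> itself.\<close>

lemma G_facts:
  assumes "i < n" "x \<in> G i"
  shows "x \<noteq> 0" "\<bar>x\<bar> < 1" "base i + x \<notin> Q" "F x \<in> G i" "f (f (base i + x)) = base i + F x"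
proof -
  show x1: "\<bar>x\<bar> < 1" using assms by (simp add: G_def)
  have s: "base i + x \<in> {0..L}" "base i + x \<notin> N" using base_L assms x1 by (auto simp: G_def)
  show nq: "base i + x \<notin> Q" using f_N[OF s] by simp
  show x0: "x \<noteq> 0" using nq assms(1) by (auto simp: Q_def)
  have "f (base i + x) = cap i + a * (- x)" using f_base' assms x1 by simp
  also have "f \<dots> = base i - F (- x)" using x0 x1 assms(1) by (intro f_cap') auto
  finally show ff: "f (f (base i + x)) = base i + F x" by (simp add: F_uminus)
  have "f (f (base i + x)) \<notin> N" using f_N s by blast
  then show "F x \<in> G i" using F_bound[of x] x0 x1 ff by (simp add: G_def)
qed

lemma G_funpow: "i < n \<Longrightarrow> x \<in> G i \<Longrightarrow> (F ^^ j) x \<in> G i"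
  by (induction j) (auto intro: G_facts(4))

lemma f_even: assumes "i < n" "x \<in> G i" shows "(f ^^ (2 * j)) (base i + x) = base i + (F ^^ j) x"
proof (induction j)
  case (Suc j)
  have "(f ^^ (2 * Suc j)) (base i + x) = f (f ((f ^^ (2 * j)) (base i + x)))" by simp
  then show ?case using Suc G_facts(5)[OF assms(1) G_funpow[OF assms]] by simp
qed simp

text \<open>Even iterates stay on the base and odd ones lie on its cap, so any arrival at a base
  happens at an even time and at the same base. This is the factor 2 in every mixing period.\<close>

lemma return_to_base:
  assumes "i < n" "x \<in> G i" "i' < n" "\<bar>x'\<bar> < 1" "(f ^^ l) (base i + x) = base i' + x'"
  obtains j where "l = 2 * j" "i' = i" "(F ^^ j) x = x'"
proof (cases "even l")
  case True
  then obtain j where j: "l = 2 * j" by blast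
  have "base i' + x' = base i + (F ^^ j) x" using assms(5) f_even[OF assms(1,2)] j by simp
  then have "i' = i" "x' = (F ^^ j) x" using base_inj assms(4) G_facts(2)[OF assms(1) G_funpow[OF assms(1,2)]] by blast+
  then show thesis using that j by simp
next
  case False
  then obtain j where j: "l = Suc (2 * j)" by (auto elim: oddE)
  have g: "\<bar>(F ^^ j) x\<bar> < 1" using G_facts(2)[OF assms(1) G_funpow[OF assms(1,2)]] .
  have "(f ^^ l) (base i + x) = f (base i + (F ^^ j) x)" using f_even[OF assms(1,2)] j by simp
  also have "\<dots> = cap i + a * (- (F ^^ j) x)" using f_base' assms(1) g by simp
  finally have "base i' + x' < 2 * real n * a" using cap_interval[of i "- (F ^^ j) x"] assms(1,5) g by simp
  then show thesis using base_interval[OF assms(3,4)] by simp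
qed

text \<open>As long as \<open>\<bar>x\<bar> \<ge> e\<close>, the next absolute value is
  \<open>\<beta> * \<bar>x\<bar> - e\<close>, which is smaller by at least
  \<open>e - (\<beta> - 1) > 0\<close> because \<open>\<bar>x\<bar> < 1\<close>.\<close>

lemma hit_base_interval:
  assumes "i < n" "x \<in> G i"
  shows "\<exists>j. \<bar>(F ^^ j) x\<bar> < e"
proof (rule ccontr)
  assume none: "\<nexists>j. \<bar>(F ^^ j) x\<bar> < e"
  define c where "c = e - (\<beta> - 1)"
  have c: "0 < c" using e by (simp add: c_def)
  have "\<bar>(F ^^ j) x\<bar> \<le> 1 - j * c" for j
  proof (induction j)
    case 0
    show ?case using G_facts(2)[OF assms] by simp
  next
    case (Suc j)
    let ?y = "(F ^^ j) x"
    note g = G_facts[OF assms(1) G_funpow[OF assms, of j]]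
    have ge: "e \<le> \<bar>?y\<bar>" "e \<le> \<bar>F ?y\<bar>" using none by (metis funpow.simps(2) comp_apply not_le)+
    have "\<bar>?y\<bar> \<le> \<beta> * \<bar>?y\<bar>" using \<beta> by (simp add: mult_le_cancel_right1)
    then have "\<bar>F ?y\<bar> = \<beta> * \<bar>?y\<bar> - e" using F_abs[OF g(1)] ge by auto
    moreover have "(\<beta> - 1) * \<bar>?y\<bar> \<le> (\<beta> - 1) * 1" using g(2) \<beta> by (intro mult_left_mono) auto
    ultimately have "\<bar>F ?y\<bar> \<le> \<bar>?y\<bar> - c" by (simp add: c_def algebra_simps)
    then show ?case using Suc by (simp add: algebra_simps)
  qed
  moreover obtain j where "1 < real j * c" using reals_Archimedean3[OF c] by blast
  ultimately show False by (smt (verit) abs_ge_zero)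
qed

lemma renormalizes:
  assumes "i < n"
  shows "renormalizes F (G i) (2 ^ m) 2 h"
proof -
  have "renormalizes F (G i) (2 ^ m) (\<beta> ^ 2 ^ m) (halfwidth \<beta> e m)"
  proof (rule renormalization[OF _ _ _ e_pos \<beta>])
    fix x l assume "x \<in> G i" "l < m"
    have "base i + x \<notin> Q" using G_facts(3)[OF assms \<open>x \<in> G i\<close>] .
    then have "base i + x \<noteq> base i + halfwidth \<beta> e l / (\<beta> ^ 2 ^ l + 1)"
      "base i + x \<noteq> base i - halfwidth \<beta> e l / (\<beta> ^ 2 ^ l + 1)"
      using assms \<open>l < m\<close> unfolding Q_def by blast+
    then show "\<bar>x\<bar> \<noteq> halfwidth \<beta> e l / (\<beta> ^ 2 ^ l + 1)" by (auto simp: abs_if)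
  qed (use G_facts[OF assms] hit_base_interval[OF assms] F_def in auto)
  then show ?thesis by (simp only: \<beta>(2))
qed

lemma h_bounds: "0 < h" "h < 1"
proof -
  show "0 < h" using halfwidth_pos \<beta>(1) e_pos by simp
  have "(\<Prod>i<m. \<beta> ^ 2 ^ i - 1) \<le> 1"
  proof (intro prod_le_1 conjI)
    fix i assume "i \<in> {..<m}"
    then have "\<beta> ^ 2 ^ i \<le> \<beta> ^ 2 ^ m" using \<beta>(1) by (intro power_increasing) auto
    then show "\<beta> ^ 2 ^ i - 1 \<le> 1" using \<beta>(2) by simp
  qed (use \<beta>(1) in simp)
  then have "h \<le> e * 1" unfolding halfwidth_def using e_pos by (intro mult_left_mono) auto
  then show "h < 1" using e by simp
qed

lemma J_iff: "i < n \<Longrightarrow> base i + x \<in> J i \<longleftrightarrow> x \<in> G i \<and> \<bar>x\<bar> < h"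
  using h_bounds by (auto simp: J_def G_def)

lemma J_E:
  assumes "i < n" "s \<in> J i"
  obtains x where "s = base i + x" "x \<in> G i" "\<bar>x\<bar> < h"
  using J_iff[OF assms(1), of "s - base i"] assms(2) that[of "s - base i"] by simp

lemma doubling_tower:
  assumes i: "i < n"
  shows "doubling_tower f L a P q (3 * n) (2 ^ Suc m) (base i) h N (J i)"
proof
  have k: "2 ^ Suc m = 2 * (2::nat) ^ m" by simp
  note ren = renormalizes[OF i, unfolded renormalizes_def]
  show "1 \<le> (2::nat) ^ Suc m" "0 < h" "countable N" using h_bounds countable_N by auto
  show "{base i - h<..<base i + h} \<subseteq> {0..L}"
  proof
    fix s assume "s \<in> {base i - h<..<base i + h}"
    then show "s \<in> {0..L}" using base_L[OF i, of "s - base i"] h_bounds by auto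
  qed
  show "J i = {base i - h<..<base i + h} - N" by (rule J_def)
  have "base i \<in> Q" "base i \<in> {0..L}" using i base_L[OF i, of 0] by (auto simp: Q_def)
  then show "base i \<in> N" unfolding N_def by (auto intro!: exI[of _ 0])
  show ret: "(f ^^ 2 ^ Suc m) s \<in> J i"
    and "(f ^^ 2 ^ Suc m) s = base i + 2 * (s - base i) - h * sgn (s - base i)" if s: "s \<in> J i" for s
  proof -
    obtain x where x: "s = base i + x" "x \<in> G i" "\<bar>x\<bar> < h" using J_E[OF i s] .
    have Fx: "(F ^^ 2 ^ m) x = 2 * x - h * sgn x" using ren x by blast
    have "(f ^^ 2 ^ Suc m) s = base i + (F ^^ 2 ^ m) x" unfolding k x(1) by (rule f_even[OF i x(2)])
    then show "(f ^^ 2 ^ Suc m) s = base i + 2 * (s - base i) - h * sgn (s - base i)"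
      using Fx x(1) by simp
    have "x \<noteq> 0" using G_facts(1)[OF i x(2)] .
    then have "\<bar>(F ^^ 2 ^ m) x\<bar> < h" using Fx x(3) by (auto simp: sgn_if abs_if split: if_splits)
    then show "(f ^^ 2 ^ Suc m) s \<in> J i"
      using \<open>(f ^^ 2 ^ Suc m) s = base i + (F ^^ 2 ^ m) x\<close> J_iff[OF i] G_funpow[OF i x(2)] by simp
  qed
  show "2 ^ Suc m dvd l" if s: "s \<in> J i" "(f ^^ l) s \<in> J i" for s l
  proof -
    obtain x where x: "s = base i + x" "x \<in> G i" "\<bar>x\<bar> < h" using J_E[OF i s(1)] .
    obtain x' where x': "(f ^^ l) s = base i + x'" "x' \<in> G i" "\<bar>x'\<bar> < h" using J_E[OF i s(2)] .
    obtain j where j: "l = 2 * j" "(F ^^ j) x = x'"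
      using return_to_base[OF i x(2) i] x' x(1) G_facts(2)[OF i] by metis
    then have "2 ^ m dvd j" using ren x x' by blast
    then show ?thesis unfolding j(1) k by (rule mult_dvd_mono[OF dvd_refl])
  qed
qed

definition W :: "nat \<Rightarrow> real set" where "W i = {s\<in>{0..L}. \<exists>j. (f ^^ j) s \<in> J i}"

lemma W_tower: "i < n \<Longrightarrow> doubling_tower.W f L (J i) = W i"
  using doubling_tower.W_def[OF doubling_tower] by (simp add: W_def)

lemma W_borel: "i < n \<Longrightarrow> W i \<in> sets B"
  using doubling_tower.W_B[OF doubling_tower] W_tower by simp

lemma W_inv: "i < n \<Longrightarrow> f -` W i \<inter> {0..L} = W i"
  using doubling_tower.W_invariant[OF doubling_tower] W_tower by simp

text \<open>Of two visits the later one is a forward iterate of the earlier, and an orbit starting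
  on a base never comes to another base.\<close>

lemma W_disjoint:
  assumes "i < n" "i' < n" "s \<in> W i" "s \<in> W i'"
  shows "i = i'"
proof -
  have main: "i = i'"
    if i: "i < n" "i' < n" and j: "(f ^^ j) s \<in> J i" "(f ^^ j') s \<in> J i'" "j \<le> j'" for i i' j j'
  proof -
    obtain x where x: "(f ^^ j) s = base i + x" "x \<in> G i" using J_E[OF i(1) j(1)] .
    obtain x' where x': "(f ^^ j') s = base i' + x'" "x' \<in> G i'" using J_E[OF i(2) j(2)] .
    have "(f ^^ (j' - j)) (base i + x) = base i' + x'"
      using funpow_funpow[where f = f, of "j' - j" j s] j(3) by (simp add: x(1) x'(1))
    from return_to_base[OF i(1) x(2) i(2) G_facts(2)[OF i(2) x'(2)] this] show ?thesis by blast
  qed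
  obtain j j' where "(f ^^ j) s \<in> J i" "(f ^^ j') s \<in> J i'" using assms by (auto simp: W_def)
  then show ?thesis using main assms(1,2) by (metis nat_le_linear)
qed

text \<open>On a base the last clause of \<open>renormalizes\<close> suffices; a point of a cap
  reaches its base in one step, and basins are invariant.\<close>

lemma W_cover:
  assumes "s \<in> {0..L}" "s \<notin> N"
  shows "\<exists>i<n. s \<in> W i"
proof -
  have onbase: "base i + x \<in> W i" if "i < n" "x \<in> G i" for i x
  proof -
    have "\<exists>j. \<bar>(F ^^ j) x\<bar> < h" using renormalizes[OF that(1)] that(2) by (auto simp: renormalizes_def)
    then obtain j where "\<bar>(F ^^ j) x\<bar> < h" by blast
    then have "(f ^^ (2 * j)) (base i + x) \<in> J i" by (simp add: f_even[OF that] J_iff that G_funpow)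
    then show ?thesis using base_L[OF that(1) G_facts(2)[OF that]] unfolding W_def by blast
  qed
  have "s \<notin> Z" using f_N(3)[OF assms] by (auto simp: Q_def)
  then obtain j where j: "j < 3 * n" "P j < s" "s < P (Suc j)" using assms(1) piece_cases by metis
  then show ?thesis
  proof (cases rule: side_cases)
    case (base x)
    then show ?thesis using onbase[of "j - 2 * n" x] assms by (auto simp: G_def)
  next
    case (cap y)
    have fs: "f s = base (j div 2) + (- F y)" using cap by (simp add: f_cap')
    have "- F y \<in> G (j div 2)" using F_bound[of y] cap f_N[OF assms] fs by (simp add: G_def)
    then have "f s \<in> W (j div 2)" unfolding fs by (rule onbase[OF cap(2)])
    then have "s \<in> W (j div 2)" using W_inv[of "j div 2"] cap assms by blast
    then show ?thesis using cap by blast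
  qed
qed

text \<open>An ergodic acip gives each invariant basin mass 0 or 1. Since the basins exhaust the
  interval up to a countable set, not all these masses vanish, and uniqueness within a basin
  identifies the measure. Disjointness of the basins makes the \<open>n\<close> measures
  distinct.\<close>

lemma components:
  "card {\<nu>. ergodic_acip L f \<nu>} = n \<and>
   (\<forall>\<nu>. ergodic_acip L f \<nu> \<longrightarrow> (\<exists>k. mixing_period L f \<nu> k \<and> even k))"
proof -
  have "\<forall>i<n. \<exists>\<mu>. ergodic_acip L f \<mu> \<and> mixing_period L f \<mu> (2 ^ Suc m) \<and> emeasure \<mu> (W i) = 1 \<and>
     (\<forall>\<nu>. acip L f \<nu> \<longrightarrow> emeasure \<nu> (W i) = 1 \<longrightarrow> \<nu> = \<mu>)"
    using doubling_tower.ergodic_component[OF doubling_tower] W_tower by simp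
  then obtain \<mu> where \<mu>: "\<And>i. i < n \<Longrightarrow> ergodic_acip L f (\<mu> i)"
    "\<And>i. i < n \<Longrightarrow> mixing_period L f (\<mu> i) (2 ^ Suc m)"
    "\<And>i. i < n \<Longrightarrow> emeasure (\<mu> i) (W i) = 1"
    "\<And>i \<nu>. i < n \<Longrightarrow> acip L f \<nu> \<Longrightarrow> emeasure \<nu> (W i) = 1 \<Longrightarrow> \<nu> = \<mu> i"
    by metis
  have ex: "\<exists>i<n. \<nu> = \<mu> i" if \<nu>: "ergodic_acip L f \<nu>" for \<nu>
  proof (rule ccontr)
    assume none: "\<not> (\<exists>i<n. \<nu> = \<mu> i)"
    have ac: "acip L f \<nu>" and erg: "ergodic_prob \<nu> f" using \<nu> by (auto simp: ergodic_acip_def)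
    have sets: "sets \<nu> = sets B" and abs: "absolutely_continuous (restrict_space lborel {0..L}) \<nu>"
      and inv: "invariant_prob \<nu> f"
      using ac by (auto simp: acip_def)
    have sp: "space \<nu> = {0..L}" using sets_eq_imp_space_eq[OF sets] by (simp add: space_restrict_space)
    have 1: "W i \<in> null_sets \<nu>" if "i < n" for i
    proof -
      have Ws: "W i \<in> sets \<nu>" using W_borel that sets by simp
      have "emeasure \<nu> (W i) = 0 \<or> emeasure \<nu> (W i) = 1"
        using erg Ws W_inv[OF that] sp by (simp add: ergodic_prob_def)
      then have "emeasure \<nu> (W i) = 0" using none \<mu>(4)[OF that ac] that by auto
      then show ?thesis using Ws by (intro null_setsI)
    qed
    have "N \<in> null_sets (restrict_space lborel {0..L})"
      using countable_imp_null_set_lborel[OF countable_N]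
      by (subst null_sets_restrict_space) (auto simp: N_def)
    then have 2: "N \<in> null_sets \<nu>" using abs by (auto simp: absolutely_continuous_def)
    have "N \<union> (\<Union>i<n. W i) \<in> null_sets \<nu>" using 1 2 by (intro null_sets.Un null_sets.finite_UN) auto
    moreover have "{0..L} \<subseteq> N \<union> (\<Union>i<n. W i)" using W_cover by blast
    ultimately have "space \<nu> \<in> null_sets \<nu>" using sp null_sets_subset[of "N \<union> (\<Union>i<n. W i)" \<nu>] sets.top[of \<nu>] by metis
    then have "emeasure \<nu> (space \<nu>) = 0" by (rule null_setsD1)
    then show False using prob_space.emeasure_space_1[of \<nu>] inv by (simp add: invariant_prob_def)
  qed
  have inj: "inj_on \<mu> {..<n}"
  proof (rule inj_onI, rule ccontr)
    fix i i' assume i: "i \<in> {..<n}" "i' \<in> {..<n}" "\<mu> i = \<mu> i'" "i \<noteq> i'"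
    have sets: "sets (\<mu> i) = sets B" and "invariant_prob (\<mu> i) f"
      using \<mu>(1)[of i] i by (auto simp: ergodic_acip_def acip_def)
    then interpret prob_space "\<mu> i" by (simp add: invariant_prob_def)
    have "W i \<inter> W i' = {}" using W_disjoint i by auto
    moreover have "W i \<in> sets (\<mu> i)" "W i' \<in> sets (\<mu> i)" using W_borel sets i by auto
    ultimately have "emeasure (\<mu> i) (W i \<union> W i') = emeasure (\<mu> i) (W i) + emeasure (\<mu> i) (W i')"
      by (intro plus_emeasure[symmetric])
    also have "\<dots> = 2" using \<mu>(3)[of i] \<mu>(3)[of i'] i by simp
    finally show False using emeasure_le_1[of "W i \<union> W i'"] by simp
  qed
  have "{\<nu>. ergodic_acip L f \<nu>} = \<mu> ` {..<n}" using \<mu>(1) ex by auto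
  then have "card {\<nu>. ergodic_acip L f \<nu>} = n" using inj by (simp add: card_image)
  moreover have "\<exists>k. mixing_period L f \<nu> k \<and> even k" if "ergodic_acip L f \<nu>" for \<nu>
    using ex[OF that] \<mu>(2) by (metis even_power even_Suc even_numeral power_Suc even_mult_iff)
  ultimately show ?thesis by blast
qed

end

section \<open>Choice of the parameters\<close>

lemma (in capped_polygon) slap_system:
  assumes "(1 + t\<^sup>2) ^ 2 ^ m = 2"
  shows "slap_system (slap_map vs) n m (1 + t\<^sup>2) a (t * (2 * H + t))"
proof
  show "0 < n" "0 < a" "a\<^sup>2 = 1 + t\<^sup>2" "1 < 1 + t\<^sup>2" "(1 + t\<^sup>2) ^ 2 ^ m = 2"
    using n t a assms by simp_all
  show "1 + t\<^sup>2 - 1 < t * (2 * H + t)" using t H by (simp add: algebra_simps power2_eq_square)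
  show "t * (2 * H + t) < 1" using t_small by (simp add: H_def \<delta>_def)
qed (fact slap_base slap_cap slap_cap_end slap_base_end)+

theorem proposition5p1:
  fixes n :: nat
  assumes "n \<ge> 2"
  shows "\<exists>vs :: complex list.
           convex_polygon vs \<and> length vs = 3 * n \<and>
           card {\<nu>. ergodic_acip (perimeter vs) (slap_map vs) \<nu>} = n \<and>
           (\<forall>\<nu>. ergodic_acip (perimeter vs) (slap_map vs) \<nu> \<longrightarrow>
              (\<exists>k. mixing_period (perimeter vs) (slap_map vs) \<nu> k \<and> even k))"
proof -
  define c where "c = cot (pi / (2 * n))"
  define x where "x = pi / (2 * n)"
  have x: "0 < x" "x < pi / 2" using assms by (auto simp: x_def field_simps)
  then have "0 < cos x / sin x" by (intro divide_pos_pos sin_gt_zero cos_gt_zero) linarith+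
  then have c: "0 < c" by (simp add: c_def cot_def x_def)
  \<comment> \<open>Any positive \<open>t < r\<close> is admissible: since \<open>r < 1\<close>, it
    satisfies \<open>t * (2 * c + t) < r * (2 * c + 1) = 1\<close>.\<close>
  define r where "r = 1 / (2 * c + 1)"
  have r: "0 < r" "r < 1" using c by (auto simp: r_def)
  \<comment> \<open>The bound \<open>1 + r\<^sup>2\<close> is exactly what makes
    \<open>sqrt (\<beta> - 1)\<close> smaller than \<open>r\<close>.\<close>
  obtain \<beta> :: real and m :: nat where \<beta>: "1 < \<beta>" "\<beta> < 1 + r\<^sup>2" "\<beta> ^ 2 ^ m = 2"
    using dyadic_root_of_two[of "r\<^sup>2"] r by auto
  define t where "t = sqrt (\<beta> - 1)"
  have tb: "0 < t" "1 + t\<^sup>2 = \<beta>" using \<beta> by (simp_all add: t_def)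
  have "t < r" using \<beta> r by (simp add: t_def real_less_lsqrt)
  have "t * (2 * c + t) < t * (2 * c + 1)" using tb \<open>t < r\<close> r by (intro mult_strict_left_mono) auto
  also have "\<dots> < r * (2 * c + 1)" using c \<open>t < r\<close> by (intro mult_strict_right_mono) auto
  also have "\<dots> = 1" using c by (simp add: r_def)
  finally interpret capped_polygon n t using assms tb by unfold_locales (simp_all add: c_def)
  interpret slap: slap_system "slap_map vs" n m "1 + t\<^sup>2" a "t * (2 * H + t)"
    using slap_system \<beta>(3) tb(2) by simp
  have "perimeter vs = slap.L" by (simp add: perimeter_eq slap.L_def)
  then show ?thesis using convex_polygon length_vs slap.components by (intro exI[of _ vs]) simp
qed

end
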